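(* Let $N\subset M$ be an inclusion of II$_1$ factors of finite Jones index, with Jones projection $\mathsf p$, and let ${\cal O}(\mathsf p)=\{u\mathsf p u^*: u\in U_M\}$. There exist constants $R>0$ and $R_2>0$ with the following properties. (i) Every $q\in{\cal O}(\mathsf p)$ with $\|q-\mathsf p\|<R_2$ can be written as $q=e^{z}\mathsf p e^{-z}$ for a unique $z\in{\cal H}$ with $\|z\|<R$; the curve $\delta(t)=e^{tz}\mathsf p e^{-tz}$, $t\in[0,1]$, is called the geodesic joining $\mathsf p$ to $q$. (ii) For every smooth curve $\gamma:[0,1]\to{\cal O}(\mathsf p)$ with $L_\infty(\gamma)\le R_2$ there exists a geodesic $\delta$ with the same endpoints as $\gamma$ such that $L_2(\delta)\le L_2(\gamma)$. (iii) If $\gamma:[0,1]\to{\cal O}(\mathsf p)$ is a smooth curve with $\gamma(0)=\mathsf p$ and $\|\gamma(t)-\mathsf p\|<R_2/2$ for all $t\in[0,1]$, and $\delta$ is the geodesic joining $\mathsf p$ to $\gamma(1)$, then $L_2(\gamma)\ge L_2(\delta)$.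
   Context: Let $N\subset M$ be II$_1$ factors with finite index $[M:N]=\lambda^{-1}$, $\tau$ the normalized trace of $M$ (and of $N$), $\mathsf p:L^2(M,\tau)\to L^2(N,\tau)$ the Jones (orthogonal) projection, $E:M\to N$ the trace-preserving conditional expectation, and $M_1$ the von Neumann algebra of operators on $L^2(M,\tau)$ generated by $M$ and $\mathsf p$. $M_1$ is a II$_1$ factor whose normalized trace, also denoted $\tau$, restricts to the traces of $M$ and $N$. $U_M$ is the unitary group of $M$; $\|\cdot\|$ is the operator norm and $\|x\|_2=\tau(x^*x)^{1/2}$. The orbit ${\cal O}(\mathsf p)\subset M_1$ is a smooth submanifold (in the operator norm structure) of the set of selfadjoint projections of $M_1$, with weak Riemannian metric $\langle x,y\rangle=\tau(y^*x)$ on each tangent space $(T{\cal O}(\mathsf p))_q=\{xq-qx: x\in M,\ x^*=-x\}$. "Smooth" refers to the norm structure. For a curve $\gamma$ on $[0,1]$, $L_2(\gamma)=\int_0^1\|\dot\gamma(t)\|_2\,dt$ and $L_\infty(\gamma)=\int_0^1\|\dot\gamma(t)\|\,dt$. Put ${\cal H}=\{z\in M: z^*=-z,\ E(z)=0\}$ and ${\cal H}_q=u{\cal H}u^*$ if $q=u\mathsf p u^*$, $u\in U_M$. Geodesics of the Levi-Civita connection of ${\cal O}(\mathsf p)$ starting at $q$ are the curves $e^{tz}qe^{-tz}$, $z\in{\cal H}_q$. *)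

theory Defs
  imports "HOL-Analysis.Analysis"
begin

section \<open>Complex Hilbert spaces and their bounded operators\<close>

class scaleC =
  fixes scaleC :: "complex \<Rightarrow> 'a \<Rightarrow> 'a" (infixr "*\<^sub>C" 75)

text \<open>The norm is the one induced by \<open>cinner\<close>, because that of a \<^class>\<open>real_inner\<close> space is
  induced by \<open>inner\<close>, the real part of \<open>cinner\<close>. The class \<^class>\<open>perfect_space\<close> says that the
  space is not zero. The form \<open>cinner\<close> is linear in the first argument.\<close>

class complex_hilbert = real_inner + banach + perfect_space + scaleC +
  fixes cinner :: "'a \<Rightarrow> 'a \<Rightarrow> complex"
  assumes scaleC_add_right: "c *\<^sub>C (x + y) = c *\<^sub>C x + c *\<^sub>C y"
    and scaleC_add_left: "(c + d) *\<^sub>C x = c *\<^sub>C x + d *\<^sub>C x"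
    and scaleC_scaleC: "c *\<^sub>C d *\<^sub>C x = (c * d) *\<^sub>C x"
    and scaleC_of_real: "complex_of_real r *\<^sub>C x = r *\<^sub>R x"
    and cinner_commute: "cinner x y = cnj (cinner y x)"
    and cinner_add_left: "cinner (x + y) z = cinner x z + cinner y z"
    and cinner_scaleC_left: "cinner (c *\<^sub>C x) y = c * cinner x y"
    and inner_eq_Re_cinner: "inner x y = Re (cinner x y)"
begin

lemma cinner_scaleC_right: "cinner x (c *\<^sub>C y) = cnj c * cinner x y"
  by (metis cinner_commute cinner_scaleC_left complex_cnj_mult)

lemma norm_scaleC: "norm (c *\<^sub>C x) = cmod c * norm x"
proof -
  have "cinner (c *\<^sub>C x) (c *\<^sub>C x) = complex_of_real ((cmod c)\<^sup>2) * cinner x x"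
    unfolding complex_norm_square by (simp add: cinner_scaleC_left cinner_scaleC_right)
  then have "inner (c *\<^sub>C x) (c *\<^sub>C x) = (cmod c)\<^sup>2 * inner x x"
    by (simp add: inner_eq_Re_cinner)
  then show ?thesis
    by (simp add: norm_eq_sqrt_inner real_sqrt_mult)
qed

end

lemma bounded_linear_scaleC: "bounded_linear (\<lambda>x :: 'h::complex_hilbert. c *\<^sub>C x)"
proof (rule bounded_linear_intro [where K = "cmod c"])
  show "c *\<^sub>C (r *\<^sub>R x) = r *\<^sub>R (c *\<^sub>C x)" for r and x :: 'h
    by (metis scaleC_of_real scaleC_scaleC mult.commute)
qed (simp_all add: scaleC_add_right norm_scaleC)

typedef (overloaded) ('h::complex_hilbert) bop =
  "{f :: 'h \<Rightarrow>\<^sub>L 'h. \<forall>c x. blinfun_apply f (c *\<^sub>C x) = c *\<^sub>C blinfun_apply f x}"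
  by (rule exI [where x = id_blinfun]) simp

setup_lifting type_definition_bop

lift_definition bop_apply :: "'h::complex_hilbert bop \<Rightarrow> 'h \<Rightarrow> 'h" (infixr "\<cdot>" 75)
  is blinfun_apply .

lemma bop_eqI: "(\<And>x. S \<cdot> x = T \<cdot> x) \<Longrightarrow> S = T"
  by transfer (rule blinfun_eqI)

text \<open>Operators carry the operator norm, composition as product and pointwise complex scalar
  multiplication; the library function \<^const>\<open>exp\<close> is then the exponential series of operators.\<close>

instantiation bop :: (complex_hilbert) real_normed_algebra_1
begin

lift_definition zero_bop :: "'a bop" is 0
  by (metis blinfun.zero_left mem_Collect_eq bounded_linear_scaleC linear_0 bounded_linear.linear)
lift_definition one_bop :: "'a bop" is id_blinfun by simp
lift_definition plus_bop :: "'a bop \<Rightarrow> 'a bop \<Rightarrow> 'a bop" is "(+)"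
  by (simp add: blinfun.add_left scaleC_add_right)
lift_definition minus_bop :: "'a bop \<Rightarrow> 'a bop \<Rightarrow> 'a bop" is "(-)"
  by (simp add: blinfun.diff_left linear_diff [OF bounded_linear.linear [OF bounded_linear_scaleC]])
lift_definition uminus_bop :: "'a bop \<Rightarrow> 'a bop" is uminus
  by (simp add: blinfun.minus_left linear_neg [OF bounded_linear.linear [OF bounded_linear_scaleC]])
lift_definition scaleR_bop :: "real \<Rightarrow> 'a bop \<Rightarrow> 'a bop" is "(*\<^sub>R)"
  by (simp add: blinfun.scaleR_left
      linear_scale [OF bounded_linear.linear [OF bounded_linear_scaleC], simplified])
lift_definition times_bop :: "'a bop \<Rightarrow> 'a bop \<Rightarrow> 'a bop" is "(o\<^sub>L)" by simp
lift_definition norm_bop :: "'a bop \<Rightarrow> real" is norm .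
lift_definition dist_bop :: "'a bop \<Rightarrow> 'a bop \<Rightarrow> real" is dist .
lift_definition sgn_bop :: "'a bop \<Rightarrow> 'a bop" is sgn
  by (simp add: sgn_div_norm blinfun.scaleR_left
      linear_scale [OF bounded_linear.linear [OF bounded_linear_scaleC], simplified])

definition uniformity_bop :: "('a bop \<times> 'a bop) filter"
  where "uniformity_bop = (INF e\<in>{0<..}. principal {(x, y). dist x y < e})"
definition open_bop :: "'a bop set \<Rightarrow> bool"
  where "open_bop U \<longleftrightarrow> (\<forall>x\<in>U. \<forall>\<^sub>F (x', y) in uniformity. x' = x \<longrightarrow> y \<in> U)"

instance
proof
  fix a b c :: "'a bop" and r s :: real and U :: "'a bop set"
  show "dist a b = norm (a - b)" by transfer (rule dist_norm)
  show "a + b + c = a + (b + c)" "a + b = b + a" "0 + a = a" "- a + a = 0" "a - b = a + - b"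
    by (transfer, simp)+
  show "r *\<^sub>R (a + b) = r *\<^sub>R a + r *\<^sub>R b" "(r + s) *\<^sub>R a = r *\<^sub>R a + s *\<^sub>R a"
    "r *\<^sub>R s *\<^sub>R a = (r * s) *\<^sub>R a" "1 *\<^sub>R a = a"
    by (transfer, simp add: algebra_simps)+
  show "sgn a = inverse (norm a) *\<^sub>R a" by transfer (rule sgn_div_norm)
  show "uniformity = (INF e\<in>{0<..}. principal {(x :: 'a bop, y). dist x y < e})"
    by (rule uniformity_bop_def)
  show "open U \<longleftrightarrow> (\<forall>x\<in>U. \<forall>\<^sub>F (x', y) in uniformity. x' = x \<longrightarrow> y \<in> U)"
    by (rule open_bop_def)
  show "norm a = 0 \<longleftrightarrow> a = 0" "norm (r *\<^sub>R a) = \<bar>r\<bar> * norm a" by (transfer, simp)+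
  show "norm (a + b) \<le> norm a + norm b" by transfer (rule norm_triangle_ineq)
  show "a * b * c = a * (b * c)" "1 * a = a" "a * 1 = a"
    by (transfer, rule blinfun_eqI, simp)+
  show "(a + b) * c = a * c + b * c" "a * (b + c) = a * b + a * c"
    "r *\<^sub>R a * b = r *\<^sub>R (a * b)" "a * r *\<^sub>R b = r *\<^sub>R (a * b)"
    by (transfer, rule blinfun_eqI, simp add: blinfun.bilinear_simps)+
  show "norm (a * b) \<le> norm a * norm b" by transfer (rule norm_blinfun_compose)
  show "norm (1 :: 'a bop) = 1" by transfer (rule norm_blinfun_id)
  moreover have "norm (0 :: 'a bop) = 0" by transfer simp
  ultimately show "(0 :: 'a bop) \<noteq> 1" by force
qed

end

instance bop :: (complex_hilbert) banach
proof
  fix X :: "nat \<Rightarrow> 'a bop"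
  assume X: "Cauchy X"
  define Y where "Y n = Rep_bop (X n)" for n
  have d: "dist (X m) (X n) = dist (Y m) (Y n)" for m n
    by (simp add: Y_def dist_bop.rep_eq)
  have "Cauchy Y" using X by (simp add: Cauchy_def d)
  then obtain L where L: "Y \<longlonglongrightarrow> L"
    by (auto simp: Cauchy_convergent_iff convergent_def)
  have ptw: "(\<lambda>n. blinfun_apply (Y n) x) \<longlonglongrightarrow> blinfun_apply L x" for x
    by (intro tendsto_intros L)
  have "blinfun_apply L (c *\<^sub>C x) = c *\<^sub>C blinfun_apply L x" for c x
  proof (rule LIMSEQ_unique [OF ptw])
    have "blinfun_apply (Y n) (c *\<^sub>C x) = c *\<^sub>C blinfun_apply (Y n) x" for n
      using Rep_bop [of "X n"] by (simp add: Y_def)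
    then show "(\<lambda>n. blinfun_apply (Y n) (c *\<^sub>C x)) \<longlonglongrightarrow> c *\<^sub>C blinfun_apply L x"
      using bounded_linear.tendsto [OF bounded_linear_scaleC ptw] by simp
  qed
  then have "Rep_bop (Abs_bop L) = L" by (simp add: Abs_bop_inverse)
  then have "dist (X n) (Abs_bop L) = dist (Y n) L" for n
    by (simp add: Y_def dist_bop.rep_eq)
  with L have "X \<longlonglongrightarrow> Abs_bop L" by (simp add: tendsto_dist_iff [of _ L] tendsto_dist_iff [of X])
  then show "convergent X" by (auto simp: convergent_def)
qed

instantiation bop :: (complex_hilbert) scaleC
begin

lift_definition scaleC_bop :: "complex \<Rightarrow> 'a bop \<Rightarrow> 'a bop"
  is "\<lambda>c f. Blinfun (\<lambda>x. c *\<^sub>C blinfun_apply f x)"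
  by (simp add: bounded_linear_Blinfun_apply
      bounded_linear_compose [OF bounded_linear_scaleC blinfun.bounded_linear_right]
      scaleC_scaleC mult.commute)

instance ..

end

lemma bop_apply_simps [simp]:
  "(S + T) \<cdot> x = S \<cdot> x + T \<cdot> x" "(S * T) \<cdot> x = S \<cdot> (T \<cdot> x)" "1 \<cdot> x = x" "(c *\<^sub>C T) \<cdot> x = c *\<^sub>C (T \<cdot> x)"
  by (transfer, simp add: blinfun.add_left bounded_linear_Blinfun_apply
      bounded_linear_compose [OF bounded_linear_scaleC blinfun.bounded_linear_right])+

definition adj :: "'h::complex_hilbert bop \<Rightarrow> 'h bop" where
  "adj x = (THE y. \<forall>\<xi> \<eta>. cinner (x \<cdot> \<xi>) \<eta> = cinner \<xi> (y \<cdot> \<eta>))"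

text \<open>The orthogonal projection onto a closed complex subspace.\<close>

definition orth_proj :: "'h::complex_hilbert set \<Rightarrow> 'h bop" where
  "orth_proj S = (THE e. \<forall>\<xi>. e \<cdot> \<xi> \<in> S \<and> (\<forall>\<eta>\<in>S. cinner (\<xi> - e \<cdot> \<xi>) \<eta> = 0))"

section \<open>Von Neumann algebras, factors and traces\<close>

definition commutant :: "'h::complex_hilbert bop set \<Rightarrow> 'h bop set" where
  "commutant A = {x. \<forall>a\<in>A. x * a = a * x}"

definition von_neumann_algebra :: "'h::complex_hilbert bop set \<Rightarrow> bool" where
  "von_neumann_algebra A \<longleftrightarrow> (\<forall>x\<in>A. adj x \<in> A) \<and> commutant (commutant A) = A"

definition vN_generated :: "'h::complex_hilbert bop set \<Rightarrow> 'h bop set" where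
  "vN_generated S = \<Inter>{A. von_neumann_algebra A \<and> S \<subseteq> A}"

definition factor :: "'h::complex_hilbert bop set \<Rightarrow> bool" where
  "factor A \<longleftrightarrow> von_neumann_algebra A \<and> A \<inter> commutant A = range (\<lambda>c. c *\<^sub>C 1)"

definition clinear_on :: "'h::complex_hilbert bop set \<Rightarrow> ('h bop \<Rightarrow> complex) \<Rightarrow> bool" where
  "clinear_on A \<phi> \<longleftrightarrow>
     (\<forall>x\<in>A. \<forall>y\<in>A. \<phi> (x + y) = \<phi> x + \<phi> y) \<and> (\<forall>c. \<forall>x\<in>A. \<phi> (c *\<^sub>C x) = c * \<phi> x)"

text \<open>A functional is normal if it is ultraweakly continuous, that is, an absolutely convergent
  sum of vector functionals with square summable vectors.\<close>

definition normal_functional :: "'h::complex_hilbert bop set \<Rightarrow> ('h bop \<Rightarrow> complex) \<Rightarrow> bool" where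
  "normal_functional A \<phi> \<longleftrightarrow>
     (\<exists>\<xi> \<eta> :: nat \<Rightarrow> 'h. summable (\<lambda>n. (norm (\<xi> n))\<^sup>2) \<and> summable (\<lambda>n. (norm (\<eta> n))\<^sup>2) \<and>
        (\<forall>x\<in>A. (\<lambda>n. cinner (x \<cdot> \<xi> n) (\<eta> n)) sums \<phi> x))"

text \<open>Faithful normal tracial states of \<open>A\<close>; values outside \<open>A\<close> are irrelevant.\<close>

definition normalized_trace :: "'h::complex_hilbert bop set \<Rightarrow> ('h bop \<Rightarrow> complex) \<Rightarrow> bool" where
  "normalized_trace A \<tau> \<longleftrightarrow>
     clinear_on A \<tau> \<and> \<tau> 1 = 1 \<and>
     (\<forall>x\<in>A. \<tau> (adj x * x) \<in> \<real>\<^sub>\<ge>\<^sub>0) \<and> (\<forall>x\<in>A. \<tau> (adj x * x) = 0 \<longrightarrow> x = 0) \<and>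
     (\<forall>x\<in>A. \<forall>y\<in>A. \<tau> (x * y) = \<tau> (y * x)) \<and> normal_functional A \<tau>"

definition finite_factor :: "'h::complex_hilbert bop set \<Rightarrow> bool" where
  "finite_factor A \<longleftrightarrow> factor A \<and> (\<exists>\<tau>. normalized_trace A \<tau>)"

text \<open>Infinite dimension separates the factors of type II\<open>\<^sub>1\<close> from the finite factors of type I.\<close>

definition II1_factor :: "'h::complex_hilbert bop set \<Rightarrow> bool" where
  "II1_factor A \<longleftrightarrow> finite_factor A \<and> \<not> (\<exists>B. finite B \<and> A \<subseteq> span B)"

text \<open>The normalized trace of a finite factor is unique.\<close>

definition trace_of :: "'h::complex_hilbert bop set \<Rightarrow> 'h bop \<Rightarrow> complex" where
  "trace_of A x = (THE c. \<exists>\<tau>. normalized_trace A \<tau> \<and> c = \<tau> x)"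

definition norm2 :: "('h::complex_hilbert bop \<Rightarrow> complex) \<Rightarrow> 'h bop \<Rightarrow> real" where
  "norm2 \<tau> x = sqrt (Re (\<tau> (adj x * x)))"

section \<open>Subfactors and the Jones projection\<close>

definition cyclic_subspace :: "'h::complex_hilbert bop set \<Rightarrow> 'h \<Rightarrow> 'h set" where
  "cyclic_subspace A \<xi> = closure ((\<lambda>a. a \<cdot> \<xi>) ` A)"

text \<open>The Hilbert space is \<open>L\<^sup>2(M, \<tau>)\<close> with \<open>M\<close> acting by left multiplication, and \<open>\<Omega>\<close> is the
  vector of \<open>1\<close>: the map \<open>x \<mapsto> x \<cdot> \<Omega>\<close> exhibits the space as the completion of \<open>M\<close> for the inner
  product \<open>\<langle>x, y\<rangle> = \<tau> (y\<^sup>* x)\<close>.\<close>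

definition is_L2_space ::
    "'h::complex_hilbert bop set \<Rightarrow> ('h bop \<Rightarrow> complex) \<Rightarrow> 'h \<Rightarrow> bool" where
  "is_L2_space M \<tau> \<Omega> \<longleftrightarrow>
     (\<forall>x\<in>M. \<forall>y\<in>M. cinner (x \<cdot> \<Omega>) (y \<cdot> \<Omega>) = \<tau> (adj y * x)) \<and> cyclic_subspace M \<Omega> = UNIV"

definition jones_projection :: "'h::complex_hilbert bop set \<Rightarrow> 'h \<Rightarrow> 'h bop" where
  "jones_projection N \<Omega> = orth_proj (cyclic_subspace N \<Omega>)"

definition basic_construction :: "'h::complex_hilbert bop set \<Rightarrow> 'h bop set \<Rightarrow> 'h \<Rightarrow> 'h bop set"
  where "basic_construction M N \<Omega> = vN_generated (insert (jones_projection N \<Omega>) M)"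

text \<open>The dimension of the Hilbert space over a finite factor \<open>A\<close>, that is, the coupling constant of
  Murray and von Neumann; the quotient is the same for all nonzero vectors.\<close>

definition vN_dim :: "'h::complex_hilbert bop set \<Rightarrow> ennreal" where
  "vN_dim A =
     (if finite_factor (commutant A)
      then (THE d. \<forall>\<xi>. \<xi> \<noteq> 0 \<longrightarrow>
        d = ennreal (Re (trace_of A (orth_proj (cyclic_subspace (commutant A) \<xi>))) /
                     Re (trace_of (commutant A) (orth_proj (cyclic_subspace A \<xi>)))))
      else \<infinity>)"

text \<open>The Jones index \<open>[M : N] = dim\<^sub>N H / dim\<^sub>M H\<close>, computed on a space \<open>H\<close> on which the commutant
  of \<open>M\<close> is finite. On \<open>H = L\<^sup>2(M, \<tau>)\<close> the denominator is \<open>1\<close>.\<close>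

definition jones_index :: "'h::complex_hilbert bop set \<Rightarrow> 'h bop set \<Rightarrow> ennreal" where
  "jones_index M N = vN_dim N / vN_dim M"

definition positive_op :: "'h::complex_hilbert bop \<Rightarrow> bool" where
  "positive_op x \<longleftrightarrow> (\<forall>\<xi>. cinner (x \<cdot> \<xi>) \<xi> \<in> \<real>\<^sub>\<ge>\<^sub>0)"

definition trace_preserving_cond_exp ::
    "'h::complex_hilbert bop set \<Rightarrow> 'h bop set \<Rightarrow> ('h bop \<Rightarrow> complex) \<Rightarrow> ('h bop \<Rightarrow> 'h bop) \<Rightarrow> bool"
  where
  "trace_preserving_cond_exp M N \<tau> E \<longleftrightarrow>
     E ` M \<subseteq> N \<and> (\<forall>y\<in>N. E y = y) \<and>
     (\<forall>x\<in>M. \<forall>y\<in>M. E (x + y) = E x + E y) \<and> (\<forall>c. \<forall>x\<in>M. E (c *\<^sub>C x) = c *\<^sub>C E x) \<and>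
     (\<forall>x\<in>M. positive_op x \<longrightarrow> positive_op (E x)) \<and>
     (\<forall>a\<in>N. \<forall>b\<in>N. \<forall>x\<in>M. E (a * x * b) = a * E x * b) \<and>
     (\<forall>x\<in>M. \<tau> (E x) = \<tau> x)"

section \<open>The orbit of the Jones projection\<close>

definition unitaries :: "'h::complex_hilbert bop set \<Rightarrow> 'h bop set" where
  "unitaries M = {u\<in>M. adj u * u = 1 \<and> u * adj u = 1}"

definition orbit :: "'h::complex_hilbert bop set \<Rightarrow> 'h bop \<Rightarrow> 'h bop set" where
  "orbit M p = {u * p * adj u |u. u \<in> unitaries M}"

definition horizontal :: "'h::complex_hilbert bop set \<Rightarrow> ('h bop \<Rightarrow> 'h bop) \<Rightarrow> 'h bop set" where
  "horizontal M E = {z\<in>M. adj z = - z \<and> E z = 0}"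

definition horizontal_at ::
    "'h::complex_hilbert bop set \<Rightarrow> ('h bop \<Rightarrow> 'h bop) \<Rightarrow> 'h bop \<Rightarrow> 'h bop \<Rightarrow> 'h bop set" where
  "horizontal_at M E p q =
     {u * z * adj u |u z. u \<in> unitaries M \<and> q = u * p * adj u \<and> z \<in> horizontal M E}"

definition geodesic_curve :: "'h::complex_hilbert bop \<Rightarrow> 'h bop \<Rightarrow> real \<Rightarrow> 'h bop" where
  "geodesic_curve q z = (\<lambda>t. exp (t *\<^sub>R z) * q * exp (- (t *\<^sub>R z)))"

text \<open>The geodesics \<open>[0, 1] \<rightarrow> O(p)\<close> of the Levi-Civita connection in their explicit form.\<close>

definition is_geodesic ::
    "'h::complex_hilbert bop set \<Rightarrow> ('h bop \<Rightarrow> 'h bop) \<Rightarrow> 'h bop \<Rightarrow> (real \<Rightarrow> 'h bop) \<Rightarrow> bool" where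
  "is_geodesic M E p \<delta> \<longleftrightarrow>
     (\<exists>q\<in>orbit M p. \<exists>z\<in>horizontal_at M E p q. \<forall>t\<in>{0..1}. \<delta> t = geodesic_curve q z t)"

text \<open>Curves are functions on \<^typ>\<open>real\<close> of which only the restriction to \<open>[0, 1]\<close> matters; smooth
  means infinitely often differentiable in the operator norm, one-sidedly at the end points.\<close>

definition smooth_curve_in :: "'b::real_normed_vector set \<Rightarrow> (real \<Rightarrow> 'b) \<Rightarrow> bool" where
  "smooth_curve_in S \<gamma> \<longleftrightarrow>
     \<gamma> ` {0..1} \<subseteq> S \<and>
     (\<exists>D :: nat \<Rightarrow> real \<Rightarrow> 'b. D 0 = \<gamma> \<and>
        (\<forall>n. \<forall>t\<in>{0..1}. (D n has_vector_derivative D (Suc n) t) (at t within {0..1})))"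

definition length2 :: "('h::complex_hilbert bop \<Rightarrow> complex) \<Rightarrow> (real \<Rightarrow> 'h bop) \<Rightarrow> real" where
  "length2 \<tau> \<gamma> = integral {0..1} (\<lambda>t. norm2 \<tau> (vector_derivative \<gamma> (at t within {0..1})))"

definition length_inf :: "(real \<Rightarrow> 'b::real_normed_vector) \<Rightarrow> real" where
  "length_inf \<gamma> = integral {0..1} (\<lambda>t. norm (vector_derivative \<gamma> (at t within {0..1})))"

end

theory Submission
  imports Defs
begin

text \<open>Write \<open>\<kappa> = \<tau>(p)\<close>. The trace on the basic construction alone gives what finite index is needed for: the
  Markov property \<open>\<tau>(xp) = \<kappa> \<tau>(x)\<close> on \<open>M\<close>, hence the Pimsner--Popa inequality
  \<open>\<kappa> \<parallel>x\<parallel>\<^sup>2 \<le> \<parallel>xp\<parallel>\<^sup>2\<close>. By the latter \<open>z \<mapsto> e\<^sup>z p e\<^bsup>-z\<^esup>\<close> is injective with Lipschitz inverse near \<open>0\<close> on the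
  kernel of \<open>E\<close>. For a projection \<open>q = u p u\<^sup>*\<close> near \<open>p\<close>, the element \<open>w = u E(u)\<^sup>*\<close> of \<open>M\<close> is near \<open>1\<close> and
  satisfies \<open>q w = w p\<close>; factoring \<open>w = e\<^sup>z e\<^sup>a\<close> with \<open>E(z) = 0\<close> and \<open>a \<in> N\<close> by Banach's fixed point
  theorem gives \<open>q = e\<^sup>z p e\<^bsup>-z\<^esup>\<close>, and \<open>q = q\<^sup>*\<close> forces \<open>z = -z\<^sup>*\<close> by injectivity. Minimality follows
  from the Gauss lemma: for unitaries \<open>W\<close> of \<open>M\<close> one has \<open>\<parallel>WpW\<^sup>* - p\<parallel>\<^sub>2 = (2\<kappa>)\<^bsup>1/2\<^esup> \<parallel>W - E(W)\<parallel>\<^sub>2\<close>, so to first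
  order the radius \<open>\<parallel>z\<parallel>\<^sub>2\<close> of \<open>e\<^sup>z p e\<^bsup>-z\<^esup>\<close> grows at most like \<open>(2\<kappa>)\<^bsup>-1/2\<^esup>\<close> times the length of the curve.\<close>

section \<open>Orthogonal projections and adjoints\<close>

text \<open>Two norms compete: the chart around \<open>p\<close> is controlled in the operator norm,
  lengths in the 2-norm, and the latter does not dominate the former. So the normal coordinate
  \<open>z t\<close> of a curve is never differentiated. Expansivity of \<open>orbit_exp\<close>
  makes it Lipschitz in the operator norm, and the Gauss lemma is stated for pairs of points, with
  an error quadratic in their operator norm distance; such errors disappear when the unit interval
  is subdivided finely. Expansivity is proved on the whole kernel of \<open>E\<close>, since the
  fixed point argument does not keep track of skew-adjointness. In \<open>q = u * p * adj u\<close>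
  the unitary \<open>u\<close> is determined only up to a right factor from \<open>N\<close> and
  need not be near 1; multiplying by \<open>adj (E u)\<close> removes this freedom, and it is
  harmless because it commutes with \<open>p\<close>.\<close>

lemma norm_midpoint_square:
  fixes x y :: "'a::real_inner"
  shows "(norm (x - y))\<^sup>2 = 2 * (norm x)\<^sup>2 + 2 * (norm y)\<^sup>2 - 4 * (norm ((1/2) *\<^sub>R x + (1/2) *\<^sub>R y))\<^sup>2"
proof -
  have "4 * (norm ((1/2) *\<^sub>R x + (1/2) *\<^sub>R y))\<^sup>2 = (norm (x + y))\<^sup>2"
    by (simp flip: scaleR_add_right add: power_mult_distrib power2_eq_square)
  then show ?thesis
    by (simp add: power2_norm_eq_inner inner_simps inner_commute)
qed

text \<open>A minimizing sequence is Cauchy by the parallelogram law, because midpoints stay in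
  \<open>S\<close>. This serves twice: for orthogonal projections, and for the element of least
  2-norm in \<open>trace_mult_p_N\<close>.\<close>

lemma closed_convex_min_norm_exists:
  fixes S :: "'a::{real_inner,banach} set"
  assumes "closed S" "convex S" "S \<noteq> {}"
  shows "\<exists>x\<in>S. \<forall>y\<in>S. norm x \<le> norm y"
proof -
  define d where "d = (INF y\<in>S. (norm y)\<^sup>2)"
  have bdd: "bdd_below ((\<lambda>y. (norm y)\<^sup>2) ` S)" by (rule bdd_belowI2 [where m = 0]) simp
  have d_le: "d \<le> (norm y)\<^sup>2" if "y \<in> S" for y
    unfolding d_def by (rule cINF_lower [OF bdd that])
  have "\<exists>y\<in>S. (norm y)\<^sup>2 < d + 1 / Suc n" for n
    using assms(3) by (subst cInf_less_iff [OF _ bdd, symmetric, unfolded image_image bex_simps]) (auto simp: d_def)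
  then obtain x where x: "\<And>n. x n \<in> S" "\<And>n. (norm (x n))\<^sup>2 < d + 1 / Suc n" by metis
  have close: "(norm (x m - x n))\<^sup>2 < 2 / Suc m + 2 / Suc n" for m n
  proof -
    have "(1/2) *\<^sub>R x m + (1/2) *\<^sub>R x n \<in> S"
      by (rule convexD [OF assms(2) x(1) x(1)]) auto
    from d_le [OF this] x(2) [of m] x(2) [of n] show ?thesis
      unfolding norm_midpoint_square [of "x m"] by simp
  qed
  have "Cauchy x"
  proof (rule metric_CauchyI)
    fix e :: real assume "0 < e"
    then obtain K where K: "4 / e\<^sup>2 < real K" using reals_Archimedean2 by blast
    have "dist (x m) (x n) < e" if "m \<ge> K" "n \<ge> K" for m n
    proof -
      have "2 / Suc j \<le> e\<^sup>2 / 2" if "j \<ge> K" for j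
      proof -
        have "4 / e\<^sup>2 \<le> real (Suc j)" using K that by simp
        then show ?thesis using \<open>0 < e\<close> by (simp add: field_simps)
      qed
      from this [OF that(1)] this [OF that(2)] close [of m n]
      have "(norm (x m - x n))\<^sup>2 < e\<^sup>2" by linarith
      then show ?thesis using \<open>0 < e\<close> by (simp add: dist_norm power2_less_imp_less)
    qed
    then show "\<exists>K. \<forall>m\<ge>K. \<forall>n\<ge>K. dist (x m) (x n) < e" by blast
  qed
  then obtain l where l: "x \<longlonglongrightarrow> l" by (auto simp: Cauchy_convergent_iff convergent_def)
  have "l \<in> S" using closed_sequentially [OF assms(1)] x(1) l by blast
  moreover have "norm l \<le> norm y" if "y \<in> S" for y
  proof -
    have "(norm l)\<^sup>2 \<le> d + 0"
    proof (rule LIMSEQ_le)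
      show "(\<lambda>n. (norm (x n))\<^sup>2) \<longlonglongrightarrow> (norm l)\<^sup>2" by (intro tendsto_intros l)
      show "(\<lambda>n. d + 1 / Suc n) \<longlonglongrightarrow> d + 0"
        by (intro tendsto_intros LIMSEQ_Suc [OF lim_1_over_n])
      show "\<exists>N. \<forall>n\<ge>N. (norm (x n))\<^sup>2 \<le> d + 1 / Suc n" using x(2) less_imp_le by blast
    qed
    then have "(norm l)\<^sup>2 \<le> (norm y)\<^sup>2" using d_le [OF that] by linarith
    then show ?thesis by (rule power2_le_imp_le) simp
  qed
  ultimately show ?thesis by blast
qed

lemma convex_min_norm_unique:
  fixes x y :: "'a::real_inner"
  assumes "convex S" "x \<in> S" "y \<in> S" "norm x = norm y" "\<And>z. z \<in> S \<Longrightarrow> norm x \<le> norm z"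
  shows "x = y"
proof -
  have "(1/2) *\<^sub>R x + (1/2) *\<^sub>R y \<in> S"
    by (rule convexD [OF assms(1-3)]) auto
  then have "(norm x)\<^sup>2 \<le> (norm ((1/2) *\<^sub>R x + (1/2) *\<^sub>R y))\<^sup>2" using assms(5) by simp
  then have "(norm (x - y))\<^sup>2 \<le> 0" unfolding norm_midpoint_square assms(4) by simp
  then show ?thesis by simp
qed

lemma min_norm_imp_orthogonal:
  fixes x k :: "'a::real_inner"
  assumes "\<And>t :: real. norm x \<le> norm (x + t *\<^sub>R k)"
  shows "inner x k = 0"
proof (cases "k = 0")
  case False
  \<comment> \<open>The minimizer of the quadratic polynomial
    \<open>t \<mapsto> (norm (x + t *\<^sub>R k))\<^sup>2\<close>.\<close>
  define t where "t = - inner x k / (norm k)\<^sup>2"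
  have "(norm x)\<^sup>2 \<le> (norm (x + t *\<^sub>R k))\<^sup>2" using assms by simp
  also have "\<dots> = (norm x)\<^sup>2 + 2 * t * inner x k + t\<^sup>2 * (norm k)\<^sup>2"
    unfolding power2_norm_eq_inner
    by (simp add: inner_simps inner_commute power2_eq_square algebra_simps)
  also have "\<dots> = (norm x)\<^sup>2 - (inner x k)\<^sup>2 / (norm k)\<^sup>2"
    using False by (simp add: t_def field_simps power2_eq_square)
  finally have "(inner x k)\<^sup>2 / (norm k)\<^sup>2 \<le> 0" by simp
  then show ?thesis using False by (simp add: divide_le_0_iff)
qed simp

lemma orthogonal_decomposition:
  fixes \<xi> :: "'a::{real_inner,banach}"
  assumes "closed S" "subspace S"
  shows "\<exists>e\<in>S. \<forall>s\<in>S. inner (\<xi> - e) s = 0"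
proof -
  let ?T = "(\<lambda>s. \<xi> - s) ` S"
  have "?T = (\<lambda>x. \<xi> + x) ` uminus ` S" by (auto simp: image_image)
  then have "closed ?T" using assms(1) by (simp add: closed_translation closed_negations)
  moreover have "convex ?T"
    using subspace_imp_convex [OF assms(2)] convex_translation [of "uminus ` S" \<xi>] \<open>?T = _\<close>
    by (simp add: convex_negations)
  moreover have "?T \<noteq> {}" using subspace_0 [OF assms(2)] by auto
  ultimately obtain e where e: "e \<in> S" "\<And>s. s \<in> S \<Longrightarrow> norm (\<xi> - e) \<le> norm (\<xi> - s)"
    using closed_convex_min_norm_exists by (metis (no_types, lifting) imageE imageI)
  have "inner (\<xi> - e) s = 0" if "s \<in> S" for s
  proof (rule min_norm_imp_orthogonal)
    fix t :: real
    have "e - t *\<^sub>R s \<in> S" using assms(2) e(1) that by (simp add: subspace_diff subspace_scale)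
    from e(2) [OF this] show "norm (\<xi> - e) \<le> norm (\<xi> - e + t *\<^sub>R s)" by (simp add: algebra_simps)
  qed
  with e(1) show ?thesis by blast
qed

lemma riesz_representation:
  fixes f :: "'a::{real_inner,banach} \<Rightarrow> real"
  assumes f: "bounded_linear f"
  shows "\<exists>\<eta>. \<forall>x. f x = inner x \<eta>"
proof (cases "\<forall>x. f x = 0")
  case False
  interpret bounded_linear f by fact
  let ?K = "{x. f x = 0}"
  obtain a where a: "f a \<noteq> 0" using False by blast
  have "closed ?K" by (intro closed_Collect_eq continuous_on continuous_intros)
  moreover have "subspace ?K" by (auto simp: subspace_def add scaleR zero)
  ultimately obtain e where e: "f e = 0" "\<And>s. f s = 0 \<Longrightarrow> inner (a - e) s = 0"
    using orthogonal_decomposition [of ?K a] by blast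
  \<comment> \<open>A normal vector of the kernel with \<open>f b = f a\<close>; subtracting a
    suitable multiple of it puts any vector into the kernel.\<close>
  define b where "b = a - e"
  have fb: "f b = f a" by (simp add: b_def diff e)
  then have b0: "b \<noteq> 0" using a zero by auto
  have "f x = inner x ((f a / (norm b)\<^sup>2) *\<^sub>R b)" for x
  proof -
    have "inner b (x - (f x / f a) *\<^sub>R b) = 0"
      unfolding b_def by (rule e(2)) (use a fb in \<open>simp add: b_def diff scaleR\<close>)
    then have "inner x b = f x / f a * (norm b)\<^sup>2"
      by (simp add: inner_simps inner_commute power2_norm_eq_inner)
    then show ?thesis using a b0 by simp
  qed
  then show ?thesis by blast
qed (rule exI [where x = 0], simp)

section \<open>Complex inner products, bounded operators and adjoints\<close>

lemma cinner_eq_Complex_inner: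
  "cinner x y = Complex (inner x y) (inner x (\<i> *\<^sub>C y))" for x y :: "'h::complex_hilbert"
  by (simp add: complex_eq_iff inner_eq_Re_cinner cinner_scaleC_right)

text \<open>\<open>z = 1\<close> gives the real parts and \<open>z = \<i>\<close> the imaginary
  parts. This carries the real Riesz theorem over to \<open>cinner\<close>.\<close>

lemma cinner_eq_iff_inner:
  fixes a b c d :: "'h::complex_hilbert"
  shows "(\<And>z. inner (z *\<^sub>C a) b = inner (z *\<^sub>C c) d) \<Longrightarrow> cinner a b = cinner c d"
proof -
  assume a: "\<And>z. inner (z *\<^sub>C a) b = inner (z *\<^sub>C c) d"
  from a [of 1] have "Re (cinner a b) = Re (cinner c d)"
    by (simp add: inner_eq_Re_cinner cinner_scaleC_left)
  moreover from a [of "\<i>"] have "Im (cinner a b) = Im (cinner c d)"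
    by (simp add: inner_eq_Re_cinner cinner_scaleC_left)
  ultimately show ?thesis by (simp add: complex_eq_iff)
qed

lemma bop_of_fun:
  fixes f :: "'h::complex_hilbert \<Rightarrow> 'h"
  assumes "\<And>x y. f (x + y) = f x + f y" "\<And>c x. f (c *\<^sub>C x) = c *\<^sub>C f x" "\<And>x. norm (f x) \<le> K * norm x"
  shows "\<exists>T. \<forall>x. T \<cdot> x = f x"
proof -
  have bl: "bounded_linear f"
  proof (rule bounded_linear_intro)
    show "f (r *\<^sub>R x) = r *\<^sub>R f x" for r x using assms(2) [of "complex_of_real r" x] by (simp add: scaleC_of_real)
    show "norm (f x) \<le> norm x * K" for x using assms(3) by (simp add: mult.commute)
  qed (use assms in auto)
  then have "Blinfun f \<in> {f. \<forall>c x. blinfun_apply f (c *\<^sub>C x) = c *\<^sub>C blinfun_apply f x}"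
    by (simp add: bounded_linear_Blinfun_apply assms(2))
  then have "Abs_bop (Blinfun f) \<cdot> x = f x" for x
    by (simp add: bop_apply.rep_eq Abs_bop_inverse bounded_linear_Blinfun_apply [OF bl])
  then show ?thesis by blast
qed

lemma bop_apply_scaleC [simp]: "T \<cdot> (c *\<^sub>C x) = c *\<^sub>C (T \<cdot> x)"
  by transfer simp

lemma bounded_bilinear_bop_apply: "bounded_bilinear (\<cdot>)"
proof
  show "\<exists>K. \<forall>a b. norm ((a :: 'a bop) \<cdot> b) \<le> norm a * norm b * K"
    by (rule exI [where x = 1]) (transfer, simp add: norm_blinfun)
qed (transfer, simp add: blinfun.bilinear_simps)+

interpretation bop_apply: bounded_bilinear "(\<cdot>) :: 'h::complex_hilbert bop \<Rightarrow> _"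
  by (rule bounded_bilinear_bop_apply)

lemma norm_bop_apply: "norm (T \<cdot> x) \<le> norm T * norm x"
  by transfer (rule norm_blinfun)

lemma norm_bop_bound: "0 \<le> b \<Longrightarrow> (\<And>x. norm (T \<cdot> x) \<le> b * norm x) \<Longrightarrow> norm T \<le> b"
  by transfer (rule norm_blinfun_bound)

lemma cinner_diff_left: "cinner (x - y) z = cinner x z - cinner y z" for x :: "'h::complex_hilbert"
  by (metis add_diff_cancel cinner_add_left diff_add_cancel)

lemma cinner_add_right: "cinner z (x + y) = cinner z x + cinner z y" for x :: "'h::complex_hilbert"
  by (metis cinner_add_left cinner_commute complex_cnj_add)

lemma cinner_diff_right: "cinner z (x - y) = cinner z x - cinner z y" for x :: "'h::complex_hilbert"
  by (metis cinner_diff_left cinner_commute complex_cnj_diff)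

lemma cinner_self: "cinner x x = complex_of_real ((norm x)\<^sup>2)" for x :: "'h::complex_hilbert"
proof -
  have "cinner x x = cnj (cinner x x)" by (rule cinner_commute)
  then have "Im (cinner x x) = 0" by (simp add: complex_eq_iff)
  then show ?thesis by (simp add: complex_eq_iff power2_norm_eq_inner inner_eq_Re_cinner)
qed

lemma cinner_left_eqI: "(\<And>z. cinner z x = cinner z y) \<Longrightarrow> x = y" for x :: "'h::complex_hilbert"
  using cinner_self [of "x - y"] by (simp add: cinner_diff_right)

lemma norm_cinner_le: "norm (cinner x y) \<le> norm x * norm y" for x :: "'h::complex_hilbert"
proof (cases "cinner x y = 0")
  case False
  define c where "c = cnj (cinner x y) / cmod (cinner x y)"
  have "cmod c = 1" using False by (simp add: c_def norm_divide)
  have "c * cinner x y = complex_of_real (cmod (cinner x y))"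
    using False complex_norm_square [of "cinner x y"]
    by (simp add: c_def mult.commute power2_eq_square field_simps)
  then have "cmod (cinner x y) = Re (c * cinner x y)" by simp
  also have "\<dots> = inner (c *\<^sub>C x) y" by (simp add: inner_eq_Re_cinner cinner_scaleC_left)
  also have "\<dots> \<le> norm (c *\<^sub>C x) * norm y" by (rule norm_cauchy_schwarz)
  finally show ?thesis by (simp add: norm_scaleC \<open>cmod c = 1\<close>)
qed simp

lemma adjoint_exists:
  fixes x :: "'h::complex_hilbert bop"
  shows "\<exists>y. \<forall>\<xi> \<eta>. cinner (x \<cdot> \<xi>) \<eta> = cinner \<xi> (y \<cdot> \<eta>)"
proof -
  have "\<exists>\<zeta>. \<forall>\<xi>. inner (x \<cdot> \<xi>) \<eta> = inner \<xi> \<zeta>" for \<eta>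
    by (rule riesz_representation) (intro bounded_linear_intros bop_apply.bounded_linear_right)
  then obtain f where f: "\<And>\<xi> \<eta>. inner (x \<cdot> \<xi>) \<eta> = inner \<xi> (f \<eta>)" by metis
  have cf: "cinner (x \<cdot> \<xi>) \<eta> = cinner \<xi> (f \<eta>)" for \<xi> \<eta>
    by (rule cinner_eq_iff_inner) (simp flip: f)
  have "\<exists>T. \<forall>\<eta>. T \<cdot> \<eta> = f \<eta>"
  proof (rule bop_of_fun)
    show "f (a + b) = f a + f b" for a b
      by (rule cinner_left_eqI) (simp add: cinner_add_right flip: cf)
    show "f (c *\<^sub>C a) = c *\<^sub>C f a" for c a
      by (rule cinner_left_eqI) (simp add: cinner_scaleC_right flip: cf)
    show "norm (f \<eta>) \<le> norm x * norm \<eta>" for \<eta>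
    proof (cases "f \<eta> = 0")
      case False
      have "norm (f \<eta>) * norm (f \<eta>) = inner (x \<cdot> f \<eta>) \<eta>"
        by (simp add: f flip: power2_norm_eq_inner power2_eq_square)
      also have "\<dots> \<le> norm (x \<cdot> f \<eta>) * norm \<eta>" by (rule norm_cauchy_schwarz)
      also have "\<dots> \<le> norm x * norm (f \<eta>) * norm \<eta>" by (intro mult_right_mono norm_bop_apply) simp
      finally show ?thesis using False by (simp add: mult.assoc mult.left_commute)
    qed simp
  qed
  then show ?thesis by (metis cf)
qed

lemma adj_unique: "(\<And>\<xi> \<eta>. cinner (x \<cdot> \<xi>) \<eta> = cinner \<xi> (y \<cdot> \<eta>)) \<Longrightarrow> adj x = y"
  unfolding adj_def
proof (rule the_equality)
  fix y' assume "\<forall>\<xi> \<eta>. cinner (x \<cdot> \<xi>) \<eta> = cinner \<xi> (y' \<cdot> \<eta>)"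
    and "\<And>\<xi> \<eta>. cinner (x \<cdot> \<xi>) \<eta> = cinner \<xi> (y \<cdot> \<eta>)"
  then show "y' = y" by (intro bop_eqI cinner_left_eqI) simp
qed simp

lemma cinner_adj: "cinner (x \<cdot> \<xi>) \<eta> = cinner \<xi> (adj x \<cdot> \<eta>)"
proof -
  obtain y where "\<And>\<xi> \<eta>. cinner (x \<cdot> \<xi>) \<eta> = cinner \<xi> (y \<cdot> \<eta>)" using adjoint_exists by blast
  then show ?thesis using adj_unique [of x y] by simp
qed

lemma cinner_adj': "cinner (adj x \<cdot> \<xi>) \<eta> = cinner \<xi> (x \<cdot> \<eta>)"
  by (metis cinner_adj cinner_commute)

lemma adj_adj [simp]: "adj (adj x) = x"
  by (rule adj_unique) (rule cinner_adj')

lemma adj_add [simp]: "adj (x + y) = adj x + adj y"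
  by (rule adj_unique) (simp add: cinner_add_left cinner_add_right cinner_adj)

lemma adj_mult [simp]: "adj (x * y) = adj y * adj x"
  by (rule adj_unique) (simp add: cinner_adj)

lemma adj_one [simp]: "adj 1 = 1"
  by (rule adj_unique) simp

lemma adj_scaleC [simp]: "adj (c *\<^sub>C x) = cnj c *\<^sub>C adj x"
  by (rule adj_unique) (simp add: cinner_scaleC_left cinner_scaleC_right cinner_adj)

lemma bop_scaleC_of_real: "complex_of_real r *\<^sub>C x = r *\<^sub>R (x :: 'h::complex_hilbert bop)"
  by (rule bop_eqI) (simp add: scaleC_of_real bop_apply.scaleR_left)

lemma adj_scaleR [simp]: "adj (r *\<^sub>R x) = r *\<^sub>R adj x"
  using adj_scaleC [of "complex_of_real r" x] by (simp add: bop_scaleC_of_real)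

lemma adj_minus [simp]: "adj (- x) = - adj x"
  using adj_scaleR [of "-1" x] by simp

lemma adj_diff [simp]: "adj (x - y) = adj x - adj y"
  using adj_add [of x "- y"] by simp

lemma adj_zero [simp]: "adj 0 = 0"
  using adj_scaleR [of 0 0] by simp

lemma norm_square_apply: "(norm (x \<cdot> \<xi>))\<^sup>2 = Re (cinner ((adj x * x) \<cdot> \<xi>) \<xi>)"
  using cinner_self [of "x \<cdot> \<xi>"] cinner_adj' [of x "x \<cdot> \<xi>" \<xi>] by simp

lemma norm_square_le_norm_adj_mult: "(norm x)\<^sup>2 \<le> norm (adj x * x)"
proof -
  have "norm x \<le> sqrt (norm (adj x * x))"
  proof (rule norm_bop_bound)
    fix \<xi>
    have "(norm (x \<cdot> \<xi>))\<^sup>2 \<le> norm (cinner ((adj x * x) \<cdot> \<xi>) \<xi>)"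
      unfolding norm_square_apply by (rule complex_Re_le_cmod)
    also have "\<dots> \<le> norm ((adj x * x) \<cdot> \<xi>) * norm \<xi>" by (rule norm_cinner_le)
    also have "\<dots> \<le> (norm (adj x * x) * norm \<xi>) * norm \<xi>"
      by (intro mult_right_mono norm_bop_apply) simp
    also have "\<dots> = (sqrt (norm (adj x * x)) * norm \<xi>)\<^sup>2"
      by (simp add: power_mult_distrib power2_eq_square)
    finally show "norm (x \<cdot> \<xi>) \<le> sqrt (norm (adj x * x)) * norm \<xi>"
      by (rule power2_le_imp_le) simp
  qed simp
  then have "(norm x)\<^sup>2 \<le> (sqrt (norm (adj x * x)))\<^sup>2" by (intro power_mono) auto
  then show ?thesis by simp
qed

lemma norm_adj [simp]: "norm (adj x) = norm x"
proof -
  have le: "norm x \<le> norm (adj x)" for x :: "'a bop"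
  proof (cases "x = 0")
    case False
    have "norm x * norm x \<le> norm (adj x * x)"
      using norm_square_le_norm_adj_mult [of x] by (simp add: power2_eq_square)
    also have "\<dots> \<le> norm (adj x) * norm x" by (rule norm_mult_ineq)
    finally show ?thesis using False by simp
  qed simp
  from le [of x] le [of "adj x"] show ?thesis by simp
qed

lemma norm_adj_mult_self: "norm (adj x * x) = (norm x)\<^sup>2"
  using norm_square_le_norm_adj_mult [of x] norm_mult_ineq [of "adj x" x]
  by (simp add: power2_eq_square)

lemma bounded_linear_adj: "bounded_linear adj"
  by (rule bounded_linear_intro [where K = 1]) simp_all

lemma adj_power: "adj (x ^ n) = adj x ^ n"
  by (induction n) (simp_all add: power_commutes)

lemma adj_exp: "adj (exp x) = exp (adj x)"
proof -
  have "(\<lambda>n. adj (x ^ n /\<^sub>R fact n)) sums adj (exp x)"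
    by (rule bounded_linear.sums [OF bounded_linear_adj exp_converges])
  then show ?thesis using exp_converges [of "adj x"] by (simp add: adj_power sums_unique2)
qed

section \<open>Orthogonal projections onto closed complex subspaces\<close>

lemma closure_scaleC_closed:
  fixes S :: "'h::complex_hilbert set"
  assumes "\<And>c x. x \<in> S \<Longrightarrow> c *\<^sub>C x \<in> S" "x \<in> closure S"
  shows "c *\<^sub>C x \<in> closure S"
proof -
  have "(\<lambda>x. c *\<^sub>C x) ` closure S \<subseteq> closure ((\<lambda>x. c *\<^sub>C x) ` S)"
    by (rule closure_bounded_linear_image_subset [OF bounded_linear_scaleC])
  also have "\<dots> \<subseteq> closure S" using assms(1) by (intro closure_mono) auto
  finally show ?thesis using assms(2) by auto
qed

text \<open>Since \<open>orth_proj\<close> is a definite description of an operator, the operator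
  has to be built first. Real orthogonality becomes complex because \<open>S\<close> is stable under
  \<open>\<i>\<close>; uniqueness of the decomposition gives linearity, and Cauchy--Schwarz the
  bound 1.\<close>

lemma orth_proj:
  fixes S :: "'h::complex_hilbert set"
  assumes S: "closed S" "subspace S" "\<And>c x. x \<in> S \<Longrightarrow> c *\<^sub>C x \<in> S"
  shows orth_proj_in: "orth_proj S \<cdot> \<xi> \<in> S"
    and orth_proj_orthogonal: "\<eta> \<in> S \<Longrightarrow> cinner (\<xi> - orth_proj S \<cdot> \<xi>) \<eta> = 0"
    and orth_proj_eqI: "e \<in> S \<Longrightarrow> (\<And>\<eta>. \<eta> \<in> S \<Longrightarrow> cinner (\<xi> - e) \<eta> = 0) \<Longrightarrow> orth_proj S \<cdot> \<xi> = e"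
proof -
  have uniq: "e = e'" if "e \<in> S" "e' \<in> S" "\<And>\<eta>. \<eta> \<in> S \<Longrightarrow> cinner (\<xi> - e) \<eta> = 0"
    "\<And>\<eta>. \<eta> \<in> S \<Longrightarrow> cinner (\<xi> - e') \<eta> = 0" for e e' \<xi>
  proof -
    have "e - e' \<in> S" using S(2) that by (simp add: subspace_diff)
    then have "cinner (\<xi> - e') (e - e') - cinner (\<xi> - e) (e - e') = 0" using that by simp
    then show ?thesis by (simp add: cinner_self flip: cinner_diff_left)
  qed
  have "\<exists>e\<in>S. \<forall>\<eta>\<in>S. cinner (\<xi> - e) \<eta> = 0" for \<xi>
  proof -
    obtain e where e: "e \<in> S" "\<And>s. s \<in> S \<Longrightarrow> inner (\<xi> - e) s = 0"
      using orthogonal_decomposition [OF S(1,2)] by blast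
    have "cinner (\<xi> - e) \<eta> = 0" if "\<eta> \<in> S" for \<eta>
      unfolding cinner_eq_Complex_inner using e(2) that S(3) by (simp add: complex_eq_iff)
    with e(1) show ?thesis by blast
  qed
  then obtain f where f: "\<And>\<xi>. f \<xi> \<in> S" "\<And>\<xi> \<eta>. \<eta> \<in> S \<Longrightarrow> cinner (\<xi> - f \<xi>) \<eta> = 0" by metis
  have "\<exists>T. \<forall>\<xi>. T \<cdot> \<xi> = f \<xi>"
  proof (rule bop_of_fun)
    show "f (a + b) = f a + f b" for a b
    proof (rule uniq [of _ _ "a + b"])
      show "cinner (a + b - (f a + f b)) \<eta> = 0" if "\<eta> \<in> S" for \<eta>
        using f(2) [OF that, of a] f(2) [OF that, of b]
        by (simp add: cinner_diff_left cinner_add_left)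
    qed (use f in \<open>auto intro: subspace_add [OF S(2)]\<close>)
    show "f (c *\<^sub>C a) = c *\<^sub>C f a" for c a
    proof (rule uniq [of _ _ "c *\<^sub>C a"])
      show "cinner (c *\<^sub>C a - c *\<^sub>C f a) \<eta> = 0" if "\<eta> \<in> S" for \<eta>
        using f(2) [OF that, of a] by (simp add: cinner_diff_left cinner_scaleC_left)
    qed (use f S(3) in auto)
    show "norm (f \<xi>) \<le> 1 * norm \<xi>" for \<xi>
    proof (cases "f \<xi> = 0")
      case False
      have "inner (\<xi> - f \<xi>) (f \<xi>) = 0" using f by (simp add: inner_eq_Re_cinner)
      then have "norm (f \<xi>) * norm (f \<xi>) = inner \<xi> (f \<xi>)"
        by (simp add: inner_diff_left flip: power2_norm_eq_inner power2_eq_square)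
      also have "\<dots> \<le> norm \<xi> * norm (f \<xi>)" by (rule norm_cauchy_schwarz)
      finally show ?thesis using False by simp
    qed simp
  qed
  then obtain T where T: "\<And>\<xi>. T \<cdot> \<xi> = f \<xi>" by blast
  have "orth_proj S = T" unfolding orth_proj_def
  proof (rule the_equality)
    fix e assume "\<forall>\<xi>. e \<cdot> \<xi> \<in> S \<and> (\<forall>\<eta>\<in>S. cinner (\<xi> - e \<cdot> \<xi>) \<eta> = 0)"
    then have "e \<cdot> \<xi> = f \<xi>" for \<xi> using f by (intro uniq [of _ _ \<xi>]) auto
    then show "e = T" by (intro bop_eqI) (simp add: T)
  qed (simp add: f T)
  then have op: "orth_proj S \<cdot> \<xi> = f \<xi>" for \<xi> by (simp add: T)
  show "orth_proj S \<cdot> \<xi> \<in> S" by (simp add: f op)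
  show "\<eta> \<in> S \<Longrightarrow> cinner (\<xi> - orth_proj S \<cdot> \<xi>) \<eta> = 0" by (simp add: f op)
  show "orth_proj S \<cdot> \<xi> = e" if "e \<in> S" "\<And>\<eta>. \<eta> \<in> S \<Longrightarrow> cinner (\<xi> - e) \<eta> = 0"
    unfolding op by (rule uniq [of _ _ \<xi>]) (use that f in auto)
qed

section \<open>Estimates for the exponential in a Banach algebra\<close>

lemma norm_power_le: "norm x \<le> r \<Longrightarrow> norm (x ^ n) \<le> r ^ n"
  for x :: "'a::real_normed_algebra_1"
  by (rule order_trans [OF norm_power_ineq power_mono]) auto

lemma norm_power_diff_le:
  fixes x y :: "'a::real_normed_algebra_1" and r :: real
  assumes "norm x \<le> r" "norm y \<le> r"
  shows "norm (x ^ Suc n - y ^ Suc n) \<le> Suc n * r ^ n * norm (x - y)"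
proof (induction n)
  case (Suc n)
  have r: "0 \<le> r" using assms(1) norm_ge_zero order_trans by blast
  have "norm (x ^ Suc (Suc n) - y ^ Suc (Suc n)) = norm (x * (x ^ Suc n - y ^ Suc n) + (x - y) * y ^ Suc n)"
    by (simp add: algebra_simps)
  also have "\<dots> \<le> norm (x * (x ^ Suc n - y ^ Suc n)) + norm ((x - y) * y ^ Suc n)"
    by (rule norm_triangle_ineq)
  also have "\<dots> \<le> norm x * norm (x ^ Suc n - y ^ Suc n) + norm (x - y) * norm (y ^ Suc n)"
    by (intro add_mono norm_mult_ineq)
  also have "\<dots> \<le> r * (Suc n * r ^ n * norm (x - y)) + norm (x - y) * r ^ Suc n"
    using r by (intro add_mono mult_mono Suc.IH assms(1) norm_power_le assms(2)) auto
  also have "\<dots> = Suc (Suc n) * r ^ Suc n * norm (x - y)" by (simp add: algebra_simps)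
  finally show ?case .
qed simp

lemma exp_minus_one_sums:
  fixes x :: "'a::{real_normed_algebra_1,banach}"
  shows "(\<lambda>n. x ^ Suc n /\<^sub>R fact (Suc n)) sums (exp x - 1)"
  using exp_converges [of x] by (subst sums_Suc_iff) simp

lemma norm_exp_minus_one_le:
  fixes x :: "'a::{real_normed_algebra_1,banach}"
  assumes "norm x \<le> r"
  shows "norm (exp x - 1) \<le> exp r - 1"
proof (rule norm_sums_le [OF exp_minus_one_sums exp_minus_one_sums])
  show "norm (x ^ Suc n /\<^sub>R fact (Suc n)) \<le> r ^ Suc n /\<^sub>R fact (Suc n)" for n
    unfolding norm_scaleR real_scaleR_def by (intro mult_mono norm_power_le assms) auto
qed

lemma norm_exp_diff_le:
  fixes x y :: "'a::{real_normed_algebra_1,banach}"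
  assumes "norm x \<le> r" "norm y \<le> r"
  shows "norm (exp x - exp y - (x - y)) \<le> (exp r - 1) * norm (x - y)"
    and "norm (exp x - exp y) \<le> exp r * norm (x - y)"
proof -
  let ?d = "norm (x - y)"
  have r: "0 \<le> r" using assms(1) norm_ge_zero order_trans by blast
  have b: "norm (x ^ Suc n /\<^sub>R fact (Suc n) - y ^ Suc n /\<^sub>R fact (Suc n)) \<le> (r ^ n /\<^sub>R fact n) * ?d" for n
  proof -
    have "norm (x ^ Suc n /\<^sub>R fact (Suc n) - y ^ Suc n /\<^sub>R fact (Suc n))
        = norm (x ^ Suc n - y ^ Suc n) / fact (Suc n)"
      by (simp flip: scaleR_diff_right add: divide_inverse mult.commute)
    also have "\<dots> \<le> (Suc n * r ^ n * ?d) / fact (Suc n)"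
      using norm_power_diff_le [OF assms] by (intro divide_right_mono) auto
    also have "\<dots> = (r ^ n /\<^sub>R fact n) * ?d" by (simp add: divide_simps del: of_nat_Suc)
    finally show ?thesis .
  qed
  have "(\<lambda>n. x ^ Suc n /\<^sub>R fact (Suc n) - y ^ Suc n /\<^sub>R fact (Suc n)) sums (exp x - 1 - (exp y - 1))"
    by (intro sums_diff exp_minus_one_sums)
  then have s: "(\<lambda>n. x ^ Suc n /\<^sub>R fact (Suc n) - y ^ Suc n /\<^sub>R fact (Suc n)) sums (exp x - exp y)"
    by simp
  show "norm (exp x - exp y) \<le> exp r * ?d"
    by (rule norm_sums_le [OF s sums_mult2 [OF exp_converges] b])
  let ?g = "\<lambda>n. (x ^ Suc n /\<^sub>R fact (Suc n) - y ^ Suc n /\<^sub>R fact (Suc n))"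
  from s have "(\<lambda>n. ?g (Suc n)) sums (exp x - exp y - (x - y))"
    by (subst sums_Suc_iff) simp
  then show "norm (exp x - exp y - (x - y)) \<le> (exp r - 1) * ?d"
    by (rule norm_sums_le [OF _ sums_mult2 [OF exp_minus_one_sums] b])
qed

text \<open>The linear part of \<open>exp a * c * exp b\<close> at the origin is
  \<open>a * c + c * b\<close>, and what remains has a small Lipschitz constant near the origin. The
  case \<open>c = p\<close> yields expansivity of \<open>orbit_exp\<close>, the case
  \<open>c = 1\<close> the contraction in \<open>exp_factorization\<close>.\<close>

lemma norm_exp_mult_exp_diff_le:
  fixes a1 a2 b1 b2 c :: "'a::{real_normed_algebra_1,banach}"
  assumes le: "norm a1 \<le> r" "norm a2 \<le> r" "norm b1 \<le> r" "norm b2 \<le> r" and c: "norm c \<le> 1"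
  shows "norm (exp a1 * c * exp b1 - exp a2 * c * exp b2 - ((a1 - a2) * c + c * (b1 - b2)))
    \<le> (exp r - 1) * (exp r + 1) * (norm (a1 - a2) + norm (b1 - b2))"
proof -
  let ?k = "exp r - 1" and ?A = "exp a1 - exp a2" and ?B = "exp b1 - exp b2"
  let ?a = "norm (a1 - a2)" and ?b = "norm (b1 - b2)"
  have r: "0 \<le> r" using le(1) norm_ge_zero order_trans by blast
  have m: "norm (u * c * v) \<le> s * t" if "norm u \<le> s" "norm v \<le> t" for u v s t
  proof -
    have "norm (u * c * v) \<le> norm u * norm c * norm v"
      by (meson mult_right_mono norm_ge_zero norm_mult_ineq order_trans)
    also have "\<dots> \<le> s * 1 * t"
      using that c by (intro mult_mono) (auto intro: order_trans [OF norm_ge_zero])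
    finally show ?thesis by simp
  qed
  \<comment> \<open>First \<open>a1\<close> is replaced by \<open>a2\<close>, then \<open>b1\<close>
    by \<open>b2\<close>; once the linear parts are subtracted, every term carries a factor bounded
    by \<open>exp r - 1\<close>.\<close>
  have "exp a1 * c * exp b1 - exp a2 * c * exp b2 - ((a1 - a2) * c + c * (b1 - b2))
    = (?A * c * (exp b1 - 1) + (?A - (a1 - a2)) * c * 1)
      + ((exp a2 - 1) * c * ?B + 1 * c * (?B - (b1 - b2)))"
    by (simp add: algebra_simps)
  also have "norm \<dots> \<le> (exp r * ?a * ?k + ?k * ?a * 1) + (?k * (exp r * ?b) + 1 * (?k * ?b))"
    by (intro norm_triangle_mono m norm_exp_diff_le norm_exp_minus_one_le le) auto
  also have "\<dots> = ?k * (exp r + 1) * (?a + ?b)" by (simp add: algebra_simps)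
  finally show ?thesis .
qed

lemma exp_commute_arg:
  fixes x y :: "'a::{real_normed_algebra_1,banach}"
  assumes "x * y = y * x"
  shows "exp x * y = y * exp x"
proof -
  have p: "x ^ n * y = y * x ^ n" for n
    by (induction n) (simp_all add: assms mult.assoc, simp flip: mult.assoc add: assms)
  have "(\<lambda>n. x ^ n /\<^sub>R fact n * y) sums (exp x * y)" by (intro sums_mult2 exp_converges)
  moreover have "(\<lambda>n. y * (x ^ n /\<^sub>R fact n)) sums (y * exp x)" by (intro sums_mult exp_converges)
  ultimately show ?thesis by (simp add: p sums_unique2)
qed

lemma exp_minus_cancel [simp]:
  fixes x :: "'a::{real_normed_algebra_1,banach}"
  shows "exp x * exp (- x) = 1" "exp (- x) * exp x = 1"
    "exp x * (exp (- x) * y) = y" "exp (- x) * (exp x * y) = y"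
proof -
  show *: "exp x * exp (- x) = 1" "exp (- x) * exp x = 1" for x :: 'a
    using exp_minus_inverse [of x] exp_minus_inverse [of "- x"] by simp_all
  show "exp x * (exp (- x) * y) = y" "exp (- x) * (exp x * y) = y"
    by (simp_all flip: mult.assoc add: *)
qed

section \<open>Norm-closed algebras of operators with a trace\<close>

lemma bop_scaleC_mult [simp]:
  "(c *\<^sub>C x) * y = c *\<^sub>C (x * y)" "x * (c *\<^sub>C y) = c *\<^sub>C (x * y)" for x y :: "'h::complex_hilbert bop"
  by (rule bop_eqI, simp)+

locale star_algebra =
  fixes A :: "'h::complex_hilbert bop set"
  assumes one: "1 \<in> A" and closed: "closed A" and adj: "x \<in> A \<Longrightarrow> adj x \<in> A"
    and scaleC: "x \<in> A \<Longrightarrow> c *\<^sub>C x \<in> A" and add: "x \<in> A \<Longrightarrow> y \<in> A \<Longrightarrow> x + y \<in> A"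
    and mult: "x \<in> A \<Longrightarrow> y \<in> A \<Longrightarrow> x * y \<in> A"
begin

lemma scaleR: "x \<in> A \<Longrightarrow> r *\<^sub>R x \<in> A"
  using scaleC [of x "complex_of_real r"] by (simp add: bop_scaleC_of_real)

lemma zero: "0 \<in> A"
  using scaleR [OF one, of 0] by simp

lemma minus: "x \<in> A \<Longrightarrow> - x \<in> A"
  using scaleR [of x "-1"] by simp

lemma diff: "x \<in> A \<Longrightarrow> y \<in> A \<Longrightarrow> x - y \<in> A"
  using add [of x "- y"] minus [of y] by simp

lemma power: "x \<in> A \<Longrightarrow> x ^ n \<in> A"
  by (induction n) (simp_all add: one mult)

lemma exp: "x \<in> A \<Longrightarrow> exp x \<in> A"
proof -
  assume "x \<in> A"
  then have "(\<Sum>i<n. x ^ i /\<^sub>R fact i) \<in> A" for n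
    by (induction n) (simp_all add: zero add scaleR power)
  moreover have "(\<lambda>n. \<Sum>i<n. x ^ i /\<^sub>R fact i) \<longlonglongrightarrow> exp x"
    using exp_converges [of x] by (simp add: sums_def)
  ultimately show ?thesis
    by (rule closed_sequentially [OF closed, where f = "\<lambda>n. \<Sum>i<n. x ^ i /\<^sub>R fact i"])
qed

text \<open>Difference quotients stay in \<open>A\<close>, a norm-closed real subspace. Hence the
  trace estimates apply to velocities of curves.\<close>

lemma derivative_mem:
  assumes "a < b" "t \<in> {a..b}" "\<And>t. t \<in> {a..b} \<Longrightarrow> \<gamma> t \<in> A"
    and "(\<gamma> has_vector_derivative y) (at t within {a..b})"
  shows "y \<in> A"
proof (rule Lim_in_closed_set [OF closed])
  have "((\<lambda>s. norm ((1 / norm (s - t)) *\<^sub>R (\<gamma> s - (\<gamma> t + (s - t) *\<^sub>R y)))) \<longlongrightarrow> 0) (at t within {a..b})"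
    using assms(4) unfolding has_vector_derivative_def has_derivative_within
    by (intro tendsto_norm_zero) blast
  then have "((\<lambda>s. norm ((\<gamma> s - \<gamma> t) /\<^sub>R (s - t) - y)) \<longlongrightarrow> 0) (at t within {a..b})"
  proof (rule Lim_transform_eventually)
    have "norm ((1 / norm (s - t)) *\<^sub>R (\<gamma> s - (\<gamma> t + (s - t) *\<^sub>R y))) = norm ((\<gamma> s - \<gamma> t) /\<^sub>R (s - t) - y)"
      if "s \<noteq> t" for s
    proof -
      have "(\<gamma> s - \<gamma> t) /\<^sub>R (s - t) - y = (\<gamma> s - (\<gamma> t + (s - t) *\<^sub>R y)) /\<^sub>R (s - t)"
        using that by (simp add: scaleR_diff_right scaleR_add_right)
      then show ?thesis by (simp add: divide_inverse)
    qed
    then show "\<forall>\<^sub>F s in at t within {a..b}. norm ((1 / norm (s - t)) *\<^sub>R (\<gamma> s - (\<gamma> t + (s - t) *\<^sub>R y)))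
        = norm ((\<gamma> s - \<gamma> t) /\<^sub>R (s - t) - y)"
      by (simp add: eventually_at_filter)
  qed
  then show "((\<lambda>s. (\<gamma> s - \<gamma> t) /\<^sub>R (s - t)) \<longlongrightarrow> y) (at t within {a..b})"
    by (subst Lim_null) (rule tendsto_norm_zero_cancel)
  show "\<forall>\<^sub>F s in at t within {a..b}. (\<gamma> s - \<gamma> t) /\<^sub>R (s - t) \<in> A"
    unfolding eventually_at_filter by (rule always_eventually) (use assms(2,3) in \<open>blast intro: scaleR diff\<close>)
  show "at t within {a..b} \<noteq> bot" using assms(1,2) by (simp add: trivial_limit_within islimpt_Icc)
qed

end

section \<open>Commutants, the basic construction and normal functionals\<close>

lemma star_algebra_commutant:
  assumes "\<And>x. x \<in> B \<Longrightarrow> adj x \<in> B"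
  shows "star_algebra (commutant B)"
proof
  have "commutant B = (\<Inter>a\<in>B. {x. x * a = a * x})" by (auto simp: commutant_def)
  moreover have "closed (\<Inter>a\<in>B. {x. x * a = a * x})"
    by (intro closed_INT ballI closed_Collect_eq continuous_intros)
  ultimately show "closed (commutant B)" by simp
  show "adj x \<in> commutant B" if x: "x \<in> commutant B" for x
    unfolding commutant_def
  proof safe
    fix a assume "a \<in> B"
    then have "adj (x * adj a) = adj (adj a * x)" using assms x by (simp add: commutant_def)
    then show "adj x * a = a * adj x" by simp
  qed
  show "x * y \<in> commutant B" if "x \<in> commutant B" "y \<in> commutant B" for x y
    using that by (simp add: commutant_def) (metis mult.assoc)
qed (auto simp: commutant_def algebra_simps)

lemma von_neumann_algebra_commutant_adj:
  assumes "von_neumann_algebra A" "x \<in> commutant A"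
  shows "adj x \<in> commutant A"
  using star_algebra.adj [OF star_algebra_commutant] assms by (auto simp: von_neumann_algebra_def)

lemma von_neumann_algebra_star_algebra: "von_neumann_algebra A \<Longrightarrow> star_algebra A"
  using star_algebra_commutant [of "commutant A"] von_neumann_algebra_commutant_adj [of A]
  by (simp add: von_neumann_algebra_def)

lemma star_algebra_Inter:
  assumes "\<And>A. A \<in> F \<Longrightarrow> star_algebra A"
  shows "star_algebra (\<Inter>F)"
  using assms by unfold_locales (auto simp: star_algebra_def intro!: closed_Inter)

lemma star_algebra_basic_construction: "star_algebra (basic_construction M N \<Omega>)"
  unfolding basic_construction_def vN_generated_def
  by (rule star_algebra_Inter) (auto intro: von_neumann_algebra_star_algebra)

lemma basic_construction_mem:
  "M \<subseteq> basic_construction M N \<Omega>" "jones_projection N \<Omega> \<in> basic_construction M N \<Omega>"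
  by (auto simp: basic_construction_def vN_generated_def)

text \<open>Normality enters as continuity in the operator norm. A bounded linear extension to all
  operators gives access to the rules for limits, derivatives and integrals under the trace.\<close>

lemma normal_functional_extension:
  assumes "normal_functional A \<phi>"
  shows "\<exists>f. bounded_linear f \<and> (\<forall>x\<in>A. f x = \<phi> x)"
proof -
  from assms obtain \<xi> \<eta> :: "nat \<Rightarrow> 'a" where s: "summable (\<lambda>n. (norm (\<xi> n))\<^sup>2)" "summable (\<lambda>n. (norm (\<eta> n))\<^sup>2)"
    and phi: "\<And>x. x \<in> A \<Longrightarrow> (\<lambda>n. cinner (x \<cdot> \<xi> n) (\<eta> n)) sums \<phi> x"
    unfolding normal_functional_def by blast
  let ?g = "\<lambda>n. (norm (\<xi> n))\<^sup>2 + (norm (\<eta> n))\<^sup>2"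
  have g: "summable ?g" by (intro summable_add s)
  have b: "norm (cinner (x \<cdot> \<xi> n) (\<eta> n)) \<le> norm x * ?g n" for x n
  proof -
    have "norm (cinner (x \<cdot> \<xi> n) (\<eta> n)) \<le> norm (x \<cdot> \<xi> n) * norm (\<eta> n)" by (rule norm_cinner_le)
    also have "\<dots> \<le> norm x * norm (\<xi> n) * norm (\<eta> n)" by (intro mult_right_mono norm_bop_apply) simp
    also have "\<dots> = norm x * (norm (\<xi> n) * norm (\<eta> n))" by simp
    also have "\<dots> \<le> norm x * ?g n"
      using sum_squares_bound [of "norm (\<xi> n)" "norm (\<eta> n)"]
      by (intro mult_left_mono) (auto intro: order_trans [rotated] simp: mult_nonneg_nonneg)
    finally show ?thesis .
  qed
  define f where "f x = (\<Sum>n. cinner (x \<cdot> \<xi> n) (\<eta> n))" for x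
  have f: "(\<lambda>n. cinner (x \<cdot> \<xi> n) (\<eta> n)) sums f x" for x
    unfolding f_def by (intro summable_sums summable_comparison_test' [OF summable_mult [OF g] b])
  have "bounded_linear f"
  proof (rule bounded_linear_intro)
    show "f (x + y) = f x + f y" for x y
      using sums_add [OF f [of x] f [of y]] f [of "x + y"] by (simp add: cinner_add_left sums_unique2)
    show "f (r *\<^sub>R x) = r *\<^sub>R f x" for r x
    proof -
      have "cinner ((r *\<^sub>R x) \<cdot> \<xi> n) (\<eta> n) = r *\<^sub>R cinner (x \<cdot> \<xi> n) (\<eta> n)" for n
        unfolding bop_apply.scaleR_left scaleC_of_real [symmetric] cinner_scaleC_left
        by (simp add: scaleR_conv_of_real)
      then show ?thesis
        using sums_scaleR_right [OF f [of x], of r] f [of "r *\<^sub>R x"] by (simp add: sums_unique2)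
    qed
    show "norm (f x) \<le> norm x * (\<Sum>n. ?g n)" for x
      by (rule norm_sums_le [OF f sums_mult [OF summable_sums [OF g]] b])
  qed
  moreover have "f x = \<phi> x" if "x \<in> A" for x
    using f phi [OF that] by (rule sums_unique2)
  ultimately show ?thesis by blast
qed

section \<open>Inequalities for the trace and its 2-norm\<close>

locale tracial_algebra = star_algebra A for A :: "'h::complex_hilbert bop set" +
  fixes \<tau> :: "'h bop \<Rightarrow> complex"
  assumes normalized_trace: "normalized_trace A \<tau>"
begin

lemma trace_add: "x \<in> A \<Longrightarrow> y \<in> A \<Longrightarrow> \<tau> (x + y) = \<tau> x + \<tau> y"
  and trace_scaleC: "x \<in> A \<Longrightarrow> \<tau> (c *\<^sub>C x) = c * \<tau> x"
  and trace_one: "\<tau> 1 = 1"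
  and trace_mult_commute: "x \<in> A \<Longrightarrow> y \<in> A \<Longrightarrow> \<tau> (x * y) = \<tau> (y * x)"
  and trace_faithful: "x \<in> A \<Longrightarrow> \<tau> (adj x * x) = 0 \<Longrightarrow> x = 0"
  and trace_nonneg_Reals: "x \<in> A \<Longrightarrow> \<tau> (adj x * x) \<in> \<real>\<^sub>\<ge>\<^sub>0"
  using normalized_trace by (auto simp: normalized_trace_def clinear_on_def)

lemma trace_scaleR: "x \<in> A \<Longrightarrow> \<tau> (r *\<^sub>R x) = r *\<^sub>R \<tau> x"
  using trace_scaleC [of x "complex_of_real r"] by (simp add: bop_scaleC_of_real scaleR_conv_of_real)

lemma trace_minus: "x \<in> A \<Longrightarrow> \<tau> (- x) = - \<tau> x"
  using trace_scaleR [of x "-1"] by simp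

lemma trace_diff: "x \<in> A \<Longrightarrow> y \<in> A \<Longrightarrow> \<tau> (x - y) = \<tau> x - \<tau> y"
  using trace_add [of x "- y"] by (simp add: trace_minus minus)

lemma trace_zero: "\<tau> 0 = 0"
  using trace_scaleR [OF one, of 0] by simp

lemma trace_extension: "\<exists>f. bounded_linear f \<and> (\<forall>x\<in>A. f x = \<tau> x)"
  using normalized_trace normal_functional_extension by (auto simp: normalized_trace_def)

lemma norm2_square: "x \<in> A \<Longrightarrow> \<tau> (adj x * x) = complex_of_real ((norm2 \<tau> x)\<^sup>2)"
  using trace_nonneg_Reals [of x] by (auto simp: norm2_def complex_nonneg_Reals_iff complex_eq_iff)

lemma norm2_nonneg: "x \<in> A \<Longrightarrow> 0 \<le> norm2 \<tau> x"
  using trace_nonneg_Reals [of x] by (auto simp: norm2_def complex_nonneg_Reals_iff)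

lemma norm2_eq_0: "x \<in> A \<Longrightarrow> norm2 \<tau> x = 0 \<Longrightarrow> x = 0"
  using norm2_square [of x] trace_faithful by simp

lemma norm2_adj: "x \<in> A \<Longrightarrow> norm2 \<tau> (adj x) = norm2 \<tau> x"
  by (simp add: norm2_def trace_mult_commute [of x "adj x"] adj)

text \<open>Positivity at \<open>1 + x\<close> makes the imaginary parts of \<open>\<tau> x\<close>
  and \<open>\<tau> (adj x)\<close> opposite, positivity at \<open>1 + \<i> *\<^sub>C x\<close>
  makes their real parts equal.\<close>

lemma trace_adj: "x \<in> A \<Longrightarrow> \<tau> (adj x) = cnj (\<tau> x)"
proof -
  assume x: "x \<in> A"
  have "Im (\<tau> (adj (1 + x) * (1 + x))) = 0" "Im (\<tau> (adj (1 + \<i> *\<^sub>C x) * (1 + \<i> *\<^sub>C x))) = 0"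
    "Im (\<tau> (adj x * x)) = 0"
    using trace_nonneg_Reals [of "1 + x"] trace_nonneg_Reals [of "1 + \<i> *\<^sub>C x"] trace_nonneg_Reals [of x] x
    by (auto simp: add one scaleC complex_nonneg_Reals_iff)
  moreover have "cnj \<i> *\<^sub>C \<i> *\<^sub>C y = y" for y :: "'h bop"
  proof (rule bop_eqI)
    show "(cnj \<i> *\<^sub>C \<i> *\<^sub>C y) \<cdot> x = y \<cdot> x" for x
      using scaleC_of_real [of 1 "y \<cdot> x"] by (simp add: scaleC_scaleC)
  qed
  ultimately show ?thesis
    using x by (simp add: algebra_simps trace_add add mult adj one scaleC trace_scaleC trace_one complex_eq_iff)
qed

lemma norm2_add_scaleR_square:
  assumes "x \<in> A" "y \<in> A"
  shows "(norm2 \<tau> (x + t *\<^sub>R y))\<^sup>2 = (norm2 \<tau> x)\<^sup>2 + 2 * t * Re (\<tau> (adj y * x)) + t\<^sup>2 * (norm2 \<tau> y)\<^sup>2"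
proof -
  have "Re (\<tau> (adj x * y)) = Re (\<tau> (adj y * x))"
    using trace_adj [of "adj y * x"] assms by (simp add: mult adj)
  moreover have "\<tau> (adj (x + t *\<^sub>R y) * (x + t *\<^sub>R y)) =
    \<tau> (adj x * x) + (t *\<^sub>R \<tau> (adj x * y) + t *\<^sub>R \<tau> (adj y * x) + (t * t) *\<^sub>R \<tau> (adj y * y))"
    using assms by (simp add: algebra_simps trace_add trace_scaleR mult adj scaleR add)
  ultimately show ?thesis
    using arg_cong [OF norm2_square [of "x + t *\<^sub>R y"], of Re] norm2_square [of x] norm2_square [of y] assms
    by (simp add: add scaleR power2_eq_square)
qed

lemma trace_cauchy_schwarz:
  assumes "x \<in> A" "y \<in> A"
  shows "Re (\<tau> (adj y * x)) \<le> norm2 \<tau> x * norm2 \<tau> y"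
proof (cases "norm2 \<tau> y = 0")
  case True
  then have "y = 0" using assms norm2_eq_0 by blast
  then show ?thesis using True by (simp add: trace_zero)
next
  case False
  define b where "b = Re (\<tau> (adj y * x))"
  define t where "t = - b / (norm2 \<tau> y)\<^sup>2"
  have "0 \<le> (norm2 \<tau> (x + t *\<^sub>R y))\<^sup>2" by simp
  also have "\<dots> = (norm2 \<tau> x)\<^sup>2 + 2 * t * b + t\<^sup>2 * (norm2 \<tau> y)\<^sup>2"
    unfolding b_def by (rule norm2_add_scaleR_square [OF assms])
  also have "\<dots> = (norm2 \<tau> x)\<^sup>2 - b\<^sup>2 / (norm2 \<tau> y)\<^sup>2"
    using False by (simp add: t_def field_simps power2_eq_square)
  finally have "b\<^sup>2 \<le> (norm2 \<tau> x * norm2 \<tau> y)\<^sup>2"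
    using False by (simp add: field_simps power_mult_distrib)
  then show ?thesis
    unfolding b_def by (rule power2_le_imp_le) (simp add: norm2_nonneg assms)
qed

lemma norm2_minus: "norm2 \<tau> (- x) = norm2 \<tau> x"
  by (simp add: norm2_def)

lemma abs_trace_cauchy_schwarz:
  assumes "x \<in> A" "y \<in> A"
  shows "\<bar>Re (\<tau> (adj y * x))\<bar> \<le> norm2 \<tau> x * norm2 \<tau> y"
  using trace_cauchy_schwarz [OF assms] trace_cauchy_schwarz [of "- x" y] assms
  by (simp add: norm2_minus minus trace_minus mult adj abs_le_iff)

lemma norm2_scaleC:
  assumes "x \<in> A"
  shows "norm2 \<tau> (c *\<^sub>C x) = cmod c * norm2 \<tau> x"
proof -
  have "\<tau> (adj (c *\<^sub>C x) * (c *\<^sub>C x)) = c * (cnj c * \<tau> (adj x * x))"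
    using assms by (simp add: trace_scaleC scaleC mult adj)
  also have "\<dots> = complex_of_real ((cmod c)\<^sup>2) * \<tau> (adj x * x)"
    unfolding complex_norm_square by simp
  finally show ?thesis
    by (simp add: norm2_def real_sqrt_mult flip: of_real_power)
qed

lemma norm_trace_cauchy_schwarz:
  assumes "x \<in> A" "y \<in> A"
  shows "cmod (\<tau> (adj y * x)) \<le> norm2 \<tau> x * norm2 \<tau> y"
proof -
  let ?t = "\<tau> (adj y * x)"
  obtain c where c: "cmod c = 1" "c * ?t = complex_of_real (cmod ?t)"
  proof (cases "?t = 0")
    case False
    then show ?thesis
      using that [of "cnj ?t / cmod ?t"] complex_norm_square [of ?t]
      by (simp add: norm_divide mult.commute power2_eq_square field_simps)
  qed (use that [of 1] in simp)
  have "cmod ?t = Re (\<tau> (adj y * (c *\<^sub>C x)))"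
    using assms c(2) by (simp add: trace_scaleC mult adj)
  also have "\<dots> \<le> norm2 \<tau> (c *\<^sub>C x) * norm2 \<tau> y"
    by (rule trace_cauchy_schwarz) (simp_all add: assms scaleC)
  finally show ?thesis using assms c(1) by (simp add: norm2_scaleC)
qed

text \<open>A positive functional \<open>\<omega>\<close> with \<open>\<omega>(h)\<^sup>2 \<le> \<omega>(1) \<omega>(h\<^sup>2)\<close> and \<open>\<omega>(h) \<le> C \<parallel>h\<parallel>\<close> satisfies
  \<open>\<omega>(h) \<le> \<omega>(1) \<parallel>h\<parallel>\<close>: apply the bound to the powers \<open>h\<^bsup>2^n\<^esup>\<close> and let \<open>n\<close> tend to infinity. This
  replaces the operator inequality \<open>h \<le> \<parallel>h\<parallel>\<close>, whose proof needs square roots.\<close>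

lemma norm2_mult_le:
  assumes k: "k \<in> A" and y: "y \<in> A"
  shows "norm2 \<tau> (k * y) \<le> norm k * norm2 \<tau> y"
proof (cases "norm2 \<tau> y = 0")
  case True
  then show ?thesis using norm2_eq_0 [OF y] by (simp add: norm2_def trace_zero)
next
  case False
  obtain f where f: "bounded_linear f" "\<And>x. x \<in> A \<Longrightarrow> f x = \<tau> x" using trace_extension by blast
  obtain C where C: "C > 0" "\<And>x. norm (f x) \<le> norm x * C"
    using bounded_linear.pos_bounded [OF f(1)] by blast
  define c where "c = (norm2 \<tau> y)\<^sup>2"
  have c: "c > 0" using False by (simp add: c_def)
  define h where "h = adj k * k"
  have hA: "h ^ n \<in> A" for n using k by (simp add: h_def power mult adj)
  have hs: "adj (h ^ n) = h ^ n" for n by (simp add: adj_power h_def)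
  define a where "a n = Re (\<tau> (adj y * (h ^ (2 ^ n) * y)))" for n :: nat
  define K where "K = norm y * norm y * C / c"
  have a_Suc: "(a n)\<^sup>2 \<le> a (Suc n) * c" for n
  proof -
    let ?g = "h ^ (2 ^ n)"
    have "\<bar>a n\<bar> \<le> norm2 \<tau> (?g * y) * norm2 \<tau> y"
      unfolding a_def by (rule abs_trace_cauchy_schwarz) (simp_all add: hA y mult)
    then have "(a n)\<^sup>2 \<le> (norm2 \<tau> (?g * y) * norm2 \<tau> y)\<^sup>2"
      by (metis abs_le_square_iff abs_of_nonneg hA mult mult_nonneg_nonneg norm2_nonneg y)
    also have "\<dots> = Re (\<tau> (adj (?g * y) * (?g * y))) * c"
      by (simp only: norm2_square [OF mult [OF hA y]] Re_complex_of_real power_mult_distrib c_def)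
    also have "adj (?g * y) * (?g * y) = adj y * (h ^ (2 ^ Suc n) * y)"
      by (simp add: hs mult.assoc mult_2 power_add)
    finally show ?thesis by (simp add: a_def)
  qed
  have a_le: "a n / c \<le> K * norm h ^ (2 ^ n)" for n
  proof -
    have "a n \<le> norm (f (adj y * (h ^ (2 ^ n) * y)))"
      unfolding a_def using f(2) hA y by (simp add: mult adj complex_Re_le_cmod)
    also have "\<dots> \<le> norm (adj y * (h ^ (2 ^ n) * y)) * C" by (rule C)
    also have "\<dots> \<le> (norm y * (norm h ^ (2 ^ n) * norm y)) * C"
      using C(1) norm_mult_ineq norm_power_ineq
      by (intro mult_right_mono order_trans [OF norm_mult_ineq] mult_mono) (auto intro: order_trans [OF norm_mult_ineq] mult_right_mono)
    finally show ?thesis using c by (simp add: K_def field_simps)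
  qed
  define r where "r = a 0 / c"
  have a0: "a 0 = (norm2 \<tau> (k * y))\<^sup>2"
    using arg_cong [OF norm2_square [OF mult [OF k y]], of Re] by (simp add: a_def h_def mult.assoc)
  have r0: "0 \<le> r" using c by (simp add: r_def a0)
  have r_le: "r ^ (2 ^ n) \<le> a n / c" for n
  proof (induction n)
    case (Suc n)
    have "r ^ (2 ^ Suc n) = (r ^ (2 ^ n))\<^sup>2" by (simp add: mult.commute flip: power_mult)
    also have "\<dots> \<le> (a n / c)\<^sup>2" using Suc r0 by (intro power_mono) auto
    also have "\<dots> = (a n)\<^sup>2 / c / c" by (simp add: power_divide power2_eq_square)
    also have "\<dots> \<le> a (Suc n) / c"
      using a_Suc [of n] c by (intro divide_right_mono) (simp_all add: divide_le_eq)
    finally show ?case .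
  qed (simp add: r_def)
  have "r \<le> norm h"
  proof (rule ccontr)
    assume "\<not> r \<le> norm h"
    then have less: "norm h < r" by simp
    have h0: "norm h \<noteq> 0"
    proof
      assume "norm h = 0"
      then have "a 0 = 0" by (simp add: a_def trace_zero)
      then show False using less by (simp add: r_def)
    qed
    then have "1 < r / norm h" using less by simp
    then obtain n where n: "K < (r / norm h) ^ n" using real_arch_pow by blast
    also have "\<dots> \<le> (r / norm h) ^ (2 ^ n)"
      using \<open>1 < r / norm h\<close> by (intro power_increasing) (auto simp: less_imp_le less_exp)
    also have "\<dots> \<le> K"
      using order_trans [OF r_le a_le, of n] h0 by (simp add: power_divide divide_le_eq)
    finally show False by simp
  qed
  then have "(norm2 \<tau> (k * y))\<^sup>2 \<le> (norm k * norm2 \<tau> y)\<^sup>2"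
    using c by (simp add: r_def a0 h_def norm_adj_mult_self c_def divide_le_eq power_mult_distrib)
  then show ?thesis by (rule power2_le_imp_le) (simp add: norm2_nonneg y)
qed

lemma norm2_mult_le':
  assumes "k \<in> A" "y \<in> A"
  shows "norm2 \<tau> (y * k) \<le> norm k * norm2 \<tau> y"
  using norm2_mult_le [of "adj k" "adj y"] norm2_adj [of "y * k"] assms
  by (simp add: norm2_adj mult adj)

lemma norm2_le_norm: "x \<in> A \<Longrightarrow> norm2 \<tau> x \<le> norm x"
  using norm2_mult_le [of x 1] by (simp add: one norm2_def trace_one)

lemma norm2_unitary_mult:
  assumes "u \<in> A" "adj u * u = 1" "x \<in> A"
  shows "norm2 \<tau> (u * x) = norm2 \<tau> x"
proof -
  have "adj (u * x) * (u * x) = adj x * (adj u * u) * x" by (simp add: mult.assoc)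
  then show ?thesis by (simp add: norm2_def assms)
qed

lemma norm2_mult_unitary:
  assumes "u \<in> A" "u * adj u = 1" "x \<in> A"
  shows "norm2 \<tau> (x * u) = norm2 \<tau> x"
  using norm2_unitary_mult [of "adj u" "adj x"] assms norm2_adj [of "x * u"] norm2_adj [of x]
  by (simp add: adj mult)

lemma continuous_on_norm2:
  assumes "continuous_on S g" "\<And>t. t \<in> S \<Longrightarrow> g t \<in> A"
  shows "continuous_on S (\<lambda>t. norm2 \<tau> (g t))"
proof -
  obtain f where f: "bounded_linear f" "\<And>x. x \<in> A \<Longrightarrow> f x = \<tau> x" using trace_extension by blast
  have "continuous_on S (\<lambda>t. sqrt (Re (f (adj (g t) * g t))))"
    by (intro continuous_intros bounded_linear.continuous_on [OF f(1)]
        bounded_linear.continuous_on [OF bounded_linear_adj] assms(1))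
  then show ?thesis
    by (rule continuous_on_eq) (simp add: norm2_def f(2) assms(2) mult adj)
qed

text \<open>Pairing the velocity with the total displacement \<open>y\<close> turns this into a
  scalar inequality: by Cauchy--Schwarz the integral of the pairing, which is the square of
  \<open>norm2 \<tau> y\<close>, is at most \<open>norm2 \<tau> y\<close> times the length.\<close>

lemma norm2_diff_le_integral:
  assumes "a \<le> b" and A: "\<And>t. t \<in> {a..b} \<Longrightarrow> \<gamma> t \<in> A" "\<And>t. t \<in> {a..b} \<Longrightarrow> \<gamma>' t \<in> A"
    and D: "\<And>t. t \<in> {a..b} \<Longrightarrow> (\<gamma> has_vector_derivative \<gamma>' t) (at t within {a..b})"
    and cont: "continuous_on {a..b} \<gamma>'"
  shows "norm2 \<tau> (\<gamma> b - \<gamma> a) \<le> integral {a..b} (\<lambda>t. norm2 \<tau> (\<gamma>' t))"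
proof -
  obtain f where f: "bounded_linear f" "\<And>x. x \<in> A \<Longrightarrow> f x = \<tau> x" using trace_extension by blast
  define y where "y = \<gamma> b - \<gamma> a"
  have y: "y \<in> A" using assms(1) by (simp add: y_def A diff)
  define I where "I = integral {a..b} (\<lambda>t. norm2 \<tau> (\<gamma>' t))"
  have I: "((\<lambda>t. norm2 \<tau> (\<gamma>' t)) has_integral I) {a..b}"
    unfolding I_def
    by (intro integrable_integral integrable_continuous_interval continuous_on_norm2 cont A)
  have bl: "bounded_linear (\<lambda>x. Re (f (adj y * x)))"
    by (intro bounded_linear_compose [OF bounded_linear_Re] bounded_linear_compose [OF f(1)]
        bounded_linear_mult_right)
  have "((\<lambda>t. Re (f (adj y * \<gamma>' t))) has_integral (Re (f (adj y * \<gamma> b)) - Re (f (adj y * \<gamma> a)))) {a..b}"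
    by (rule fundamental_theorem_of_calculus [OF assms(1)])
      (rule bounded_linear.has_vector_derivative [OF bl D])
  moreover have "((\<lambda>t. norm2 \<tau> (\<gamma>' t) * norm2 \<tau> y) has_integral (I * norm2 \<tau> y)) {a..b}"
    by (rule has_integral_mult_left [OF I])
  moreover have "Re (f (adj y * \<gamma>' t)) \<le> norm2 \<tau> (\<gamma>' t) * norm2 \<tau> y" if "t \<in> {a..b}" for t
    using trace_cauchy_schwarz [OF A(2) [OF that] y] A(2) [OF that] y by (simp add: f(2) mult adj)
  ultimately have "Re (f (adj y * \<gamma> b)) - Re (f (adj y * \<gamma> a)) \<le> I * norm2 \<tau> y"
    by (rule has_integral_le)
  moreover have "Re (f (adj y * \<gamma> b)) - Re (f (adj y * \<gamma> a)) = Re (f (adj y * y))"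
    using bounded_linear.linear [OF bl] by (simp add: y_def linear_diff right_diff_distrib bounded_linear.linear [OF f(1)])
  moreover have "\<dots> = (norm2 \<tau> y)\<^sup>2" using f(2) y by (simp add: mult adj norm2_square)
  ultimately have "norm2 \<tau> y * norm2 \<tau> y \<le> I * norm2 \<tau> y" by (simp add: power2_eq_square)
  moreover have "0 \<le> I" by (rule has_integral_nonneg [OF I]) (simp add: norm2_nonneg A)
  ultimately show ?thesis
    using norm2_nonneg [OF y] unfolding y_def [symmetric] I_def [symmetric]
    by (cases "norm2 \<tau> y = 0") (auto simp: mult_le_cancel_right)
qed

end

section \<open>The Markov property and the Pimsner--Popa inequality\<close>

lemma subspace_closure:
  fixes S :: "'a::real_normed_vector set"
  assumes "subspace S"
  shows "subspace (closure S)"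
  unfolding subspace_def
proof (intro conjI ballI allI)
  show "0 \<in> closure S" using subspace_0 [OF assms] closure_subset by blast
  fix x y assume "x \<in> closure S" "y \<in> closure S"
  then obtain s t where s: "\<And>n. s n \<in> S" "s \<longlonglongrightarrow> x" and t: "\<And>n. t n \<in> S" "t \<longlonglongrightarrow> y"
    unfolding closure_sequential by blast
  show "x + y \<in> closure S"
    unfolding closure_sequential
    by (rule exI [where x = "\<lambda>n. s n + t n"]) (simp add: s t tendsto_add subspace_add [OF assms])
  show "r *\<^sub>R x \<in> closure S" for r
    unfolding closure_sequential
    by (rule exI [where x = "\<lambda>n. r *\<^sub>R s n"]) (simp add: s tendsto_scaleR subspace_scale [OF assms])
qed

section \<open>The Jones relations and the uniqueness of the trace on \<open>N\<close>\<close>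

locale jones_setting =
  fixes M N :: "'h::complex_hilbert bop set" and \<Omega> :: 'h and \<tau> :: "'h bop \<Rightarrow> complex"
    and E :: "'h bop \<Rightarrow> 'h bop" and p :: "'h bop"
  assumes vN_M: "von_neumann_algebra M" and factor_N: "factor N" and N_subset_M: "N \<subseteq> M"
    and L2: "is_L2_space M \<tau> \<Omega>"
    and p_eq: "p = jones_projection N \<Omega>"
    and trace: "normalized_trace (basic_construction M N \<Omega>) \<tau>"
    and cond_exp: "trace_preserving_cond_exp M N \<tau> E"
begin

sublocale tracial_algebra "basic_construction M N \<Omega>" \<tau>
  by (intro tracial_algebra.intro star_algebra_basic_construction tracial_algebra_axioms.intro trace)

sublocale M: star_algebra M
  by (rule von_neumann_algebra_star_algebra [OF vN_M])

sublocale N: star_algebra N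
  using factor_N by (auto simp: factor_def intro: von_neumann_algebra_star_algebra)

abbreviation "A \<equiv> basic_construction M N \<Omega>"

lemma M_A: "x \<in> M \<Longrightarrow> x \<in> A"
  using basic_construction_mem by blast

lemma p_A: "p \<in> A"
  unfolding p_eq by (rule basic_construction_mem)

lemma N_M: "x \<in> N \<Longrightarrow> x \<in> M"
  using N_subset_M by blast

lemma N_A: "x \<in> N \<Longrightarrow> x \<in> A"
  by (intro M_A N_M)

lemma cinner_\<Omega>: "x \<in> M \<Longrightarrow> y \<in> M \<Longrightarrow> cinner (x \<cdot> \<Omega>) (y \<cdot> \<Omega>) = \<tau> (adj y * x)"
  using L2 by (simp add: is_L2_space_def)

lemma norm_\<Omega>: "x \<in> M \<Longrightarrow> norm (x \<cdot> \<Omega>) = norm2 \<tau> x"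
  using cinner_\<Omega> [of x x] cinner_self [of "x \<cdot> \<Omega>"] norm2_square [of x] norm2_nonneg [of x]
  by (simp add: M_A flip: of_real_power)

lemma \<Omega>_separating: "x \<in> M \<Longrightarrow> y \<in> M \<Longrightarrow> x \<cdot> \<Omega> = y \<cdot> \<Omega> \<Longrightarrow> x = y"
  using norm_\<Omega> [of "x - y"] norm2_eq_0 [of "x - y"] M.diff M_A
  by (simp add: bop_apply.diff_left)

lemma \<Omega>_dense: "closure ((\<lambda>a. a \<cdot> \<Omega>) ` M) = UNIV"
  using L2 by (simp add: is_L2_space_def cyclic_subspace_def)

lemma \<Omega>_dense_subset: "closed S \<Longrightarrow> (\<And>a. a \<in> M \<Longrightarrow> a \<cdot> \<Omega> \<in> S) \<Longrightarrow> \<xi> \<in> S"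
  using closure_minimal [of "(\<lambda>a. a \<cdot> \<Omega>) ` M" S] \<Omega>_dense by auto

lemma bop_eq_on_\<Omega>: "(\<And>a. a \<in> M \<Longrightarrow> S \<cdot> (a \<cdot> \<Omega>) = T \<cdot> (a \<cdot> \<Omega>)) \<Longrightarrow> S = T"
proof (rule bop_eqI)
  fix \<xi> assume "\<And>a. a \<in> M \<Longrightarrow> S \<cdot> (a \<cdot> \<Omega>) = T \<cdot> (a \<cdot> \<Omega>)"
  moreover have "closed {\<xi>. S \<cdot> \<xi> = T \<cdot> \<xi>}"
    by (intro closed_Collect_eq bounded_linear.continuous_on [OF bop_apply.bounded_linear_right] continuous_intros)
  ultimately show "S \<cdot> \<xi> = T \<cdot> \<xi>" using \<Omega>_dense_subset [of "{\<xi>. S \<cdot> \<xi> = T \<cdot> \<xi>}" \<xi>] by simp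
qed

lemma norm_bop_bound_\<Omega>:
  assumes "0 \<le> b" "\<And>a. a \<in> M \<Longrightarrow> norm (T \<cdot> (a \<cdot> \<Omega>)) \<le> b * norm (a \<cdot> \<Omega>)"
  shows "norm T \<le> b"
proof (rule norm_bop_bound [OF assms(1)])
  have "closed {\<xi>. norm (T \<cdot> \<xi>) \<le> b * norm \<xi>}"
    by (intro closed_Collect_le continuous_intros
        bounded_linear.continuous_on [OF bop_apply.bounded_linear_right])
  then show "norm (T \<cdot> \<xi>) \<le> b * norm \<xi>" for \<xi>
    using \<Omega>_dense_subset [of "{\<xi>. norm (T \<cdot> \<xi>) \<le> b * norm \<xi>}" \<xi>] assms(2) by simp
qed

lemma E_N: "x \<in> M \<Longrightarrow> E x \<in> N"
  using cond_exp unfolding trace_preserving_cond_exp_def by blast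

lemma E_id: "y \<in> N \<Longrightarrow> E y = y"
  and E_add: "x \<in> M \<Longrightarrow> y \<in> M \<Longrightarrow> E (x + y) = E x + E y"
  and E_scaleC: "x \<in> M \<Longrightarrow> E (c *\<^sub>C x) = c *\<^sub>C E x"
  and E_bimodule: "a \<in> N \<Longrightarrow> b \<in> N \<Longrightarrow> x \<in> M \<Longrightarrow> E (a * x * b) = a * E x * b"
  and trace_E: "x \<in> M \<Longrightarrow> \<tau> (E x) = \<tau> x"
  using cond_exp unfolding trace_preserving_cond_exp_def by blast+

lemma E_mult_left: "a \<in> N \<Longrightarrow> x \<in> M \<Longrightarrow> E (a * x) = a * E x"
  using E_bimodule [of a 1 x] by (simp add: N.one)

lemma E_mult_right: "a \<in> N \<Longrightarrow> x \<in> M \<Longrightarrow> E (x * a) = E x * a"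
  using E_bimodule [of 1 a x] by (simp add: N.one)

lemma E_minus: "x \<in> M \<Longrightarrow> E (- x) = - E x"
  using E_scaleC [of x "complex_of_real (-1)"] by (simp only: bop_scaleC_of_real) simp

lemma E_diff: "x \<in> M \<Longrightarrow> y \<in> M \<Longrightarrow> E (x - y) = E x - E y"
  using E_add [of x "- y"] by (simp add: E_minus M.minus)

lemma E_M: "x \<in> M \<Longrightarrow> E x \<in> M"
  by (rule N_M [OF E_N])

lemma cyclic_subspace_N:
  shows "closed (cyclic_subspace N \<Omega>)" "subspace (cyclic_subspace N \<Omega>)"
    "\<xi> \<in> cyclic_subspace N \<Omega> \<Longrightarrow> c *\<^sub>C \<xi> \<in> cyclic_subspace N \<Omega>"
    "a \<in> N \<Longrightarrow> a \<cdot> \<Omega> \<in> cyclic_subspace N \<Omega>"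
proof -
  have "subspace ((\<lambda>a. a \<cdot> \<Omega>) ` N)"
    unfolding subspace_def
  proof (intro conjI ballI allI)
    show "0 \<in> (\<lambda>a. a \<cdot> \<Omega>) ` N"
      using N.zero by (rule rev_image_eqI) (simp add: bop_apply.zero_left)
    fix \<xi> \<eta> assume "\<xi> \<in> (\<lambda>a. a \<cdot> \<Omega>) ` N" "\<eta> \<in> (\<lambda>a. a \<cdot> \<Omega>) ` N"
    then obtain a b where ab: "a \<in> N" "\<xi> = a \<cdot> \<Omega>" "b \<in> N" "\<eta> = b \<cdot> \<Omega>" by blast
    show "\<xi> + \<eta> \<in> (\<lambda>a. a \<cdot> \<Omega>) ` N"
      using N.add [OF ab(1,3)] by (rule rev_image_eqI) (simp add: ab)
    show "r *\<^sub>R \<xi> \<in> (\<lambda>a. a \<cdot> \<Omega>) ` N" for r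
      using N.scaleR [OF ab(1), of r] by (rule rev_image_eqI) (simp add: ab bop_apply.scaleR_left)
  qed
  then show "subspace (cyclic_subspace N \<Omega>)"
    unfolding cyclic_subspace_def by (rule subspace_closure)
  show "\<xi> \<in> cyclic_subspace N \<Omega> \<Longrightarrow> c *\<^sub>C \<xi> \<in> cyclic_subspace N \<Omega>"
    unfolding cyclic_subspace_def
  proof (rule closure_scaleC_closed)
    fix c \<xi> assume "\<xi> \<in> (\<lambda>a. a \<cdot> \<Omega>) ` N"
    then obtain a where a: "a \<in> N" "\<xi> = a \<cdot> \<Omega>" by blast
    show "c *\<^sub>C \<xi> \<in> (\<lambda>a. a \<cdot> \<Omega>) ` N"
      using N.scaleC [OF a(1), of c] by (rule rev_image_eqI) (simp add: a)
  qed
  show "a \<in> N \<Longrightarrow> a \<cdot> \<Omega> \<in> cyclic_subspace N \<Omega>"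
    unfolding cyclic_subspace_def by (intro subsetD [OF closure_subset] imageI)
qed (simp add: cyclic_subspace_def)

text \<open>Orthogonality of \<open>x - E x\<close> to \<open>N\<close> under the trace is the
  bimodule property followed by invariance of the trace under \<open>E\<close>; it passes to the
  closure of \<open>N \<Omega>\<close> by continuity.\<close>

lemma p_\<Omega>: "x \<in> M \<Longrightarrow> p \<cdot> (x \<cdot> \<Omega>) = E x \<cdot> \<Omega>"
  unfolding p_eq jones_projection_def
proof (rule orth_proj_eqI [OF cyclic_subspace_N(1,2,3)])
  assume x: "x \<in> M"
  show "E x \<cdot> \<Omega> \<in> cyclic_subspace N \<Omega>" by (intro cyclic_subspace_N E_N x)
  let ?S = "{\<eta>. cinner (x \<cdot> \<Omega> - E x \<cdot> \<Omega>) \<eta> = 0}"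
  have "?S = {\<eta>. inner (x \<cdot> \<Omega> - E x \<cdot> \<Omega>) \<eta> = 0} \<inter> {\<eta>. inner (x \<cdot> \<Omega> - E x \<cdot> \<Omega>) (\<i> *\<^sub>C \<eta>) = 0}"
    by (auto simp: cinner_eq_Complex_inner complex_eq_iff)
  moreover have "closed \<dots>"
    by (intro closed_Int closed_Collect_eq continuous_intros
        bounded_linear.continuous_on [OF bounded_linear_scaleC])
  ultimately have "closed ?S" by simp
  moreover have "(\<lambda>a. a \<cdot> \<Omega>) ` N \<subseteq> ?S"
  proof safe
    fix y assume y: "y \<in> N"
    have "cinner (x \<cdot> \<Omega> - E x \<cdot> \<Omega>) (y \<cdot> \<Omega>) = \<tau> (adj y * x) - \<tau> (adj y * E x)"
      using x y by (simp add: cinner_diff_left cinner_\<Omega> N_M E_N)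
    also have "\<tau> (adj y * E x) = \<tau> (E (adj y * x))" by (simp add: E_mult_left x y N.adj)
    finally show "cinner (x \<cdot> \<Omega> - E x \<cdot> \<Omega>) (y \<cdot> \<Omega>) = 0"
      using x y by (simp add: trace_E M.mult N_M M.adj)
  qed
  ultimately show "cinner (x \<cdot> \<Omega> - E x \<cdot> \<Omega>) \<eta> = 0" if "\<eta> \<in> cyclic_subspace N \<Omega>" for \<eta>
    using closure_minimal [of "(\<lambda>a. a \<cdot> \<Omega>) ` N" ?S] that by (auto simp: cyclic_subspace_def)
qed

lemma p_idem: "p * p = p"
  by (rule bop_eq_on_\<Omega>) (simp add: p_\<Omega> E_id E_N E_M)

lemma p_idem': "p * (p * x) = p * x"
  by (simp add: p_idem flip: mult.assoc)

lemma p_adj: "adj p = p"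
proof (rule adj_unique)
  fix \<xi> \<eta>
  have o: "cinner (\<xi> - p \<cdot> \<xi>) (p \<cdot> \<eta>) = 0" for \<xi> \<eta>
    unfolding p_eq jones_projection_def
    by (intro orth_proj_orthogonal orth_proj_in cyclic_subspace_N) auto
  have "cinner \<xi> (p \<cdot> \<eta>) = cinner (p \<cdot> \<xi>) (p \<cdot> \<eta>)"
    using o [of \<xi> \<eta>] by (simp add: cinner_diff_left)
  also have "\<dots> = cinner (p \<cdot> \<xi>) \<eta>"
    using o [of \<eta> \<xi>] cinner_commute [of \<eta> "p \<cdot> \<xi>"] cinner_commute [of "p \<cdot> \<eta>" "p \<cdot> \<xi>"]
    by (simp add: cinner_diff_left)
  finally show "cinner (p \<cdot> \<xi>) \<eta> = cinner \<xi> (p \<cdot> \<eta>)" by simp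
qed

lemma norm_p: "norm p \<le> 1"
  using norm_adj_mult_self [of p] by (cases "norm p = 0") (simp_all add: p_adj p_idem power2_eq_square)

lemma p_commute: "y \<in> N \<Longrightarrow> p * y = y * p"
proof (rule bop_eq_on_\<Omega>)
  fix a assume "y \<in> N" "a \<in> M"
  then show "(p * y) \<cdot> (a \<cdot> \<Omega>) = (y * p) \<cdot> (a \<cdot> \<Omega>)"
    using p_\<Omega> [of "y * a"] by (simp add: p_\<Omega> E_mult_left N_M M.mult)
qed

lemma p_mult_p: "x \<in> M \<Longrightarrow> p * x * p = E x * p"
proof (rule bop_eq_on_\<Omega>)
  fix a assume "x \<in> M" "a \<in> M"
  then show "(p * x * p) \<cdot> (a \<cdot> \<Omega>) = (E x * p) \<cdot> (a \<cdot> \<Omega>)"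
    using p_\<Omega> [of "x * E a"] by (simp add: p_\<Omega> E_mult_right E_M E_N M.mult)
qed

text \<open>Take adjoints in \<open>p * x * p = E x * p\<close> and evaluate at
  \<open>\<Omega>\<close>, which is fixed by \<open>p\<close> and separating for
  \<open>M\<close>.\<close>

lemma E_adj: "x \<in> M \<Longrightarrow> E (adj x) = adj (E x)"
proof (rule \<Omega>_separating)
  assume x: "x \<in> M"
  have "E (adj x) * p = adj (p * x * p)" by (simp add: p_adj p_mult_p [symmetric] x M.adj mult.assoc)
  also have "\<dots> = adj (E x) * p" using x by (simp add: p_mult_p p_adj p_commute N.adj E_N)
  finally have "(E (adj x) * p) \<cdot> (1 \<cdot> \<Omega>) = (adj (E x) * p) \<cdot> (1 \<cdot> \<Omega>)" by simp
  moreover have "p \<cdot> \<Omega> = \<Omega>" using p_\<Omega> [OF M.one] by (simp add: E_id N.one)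
  ultimately show "E (adj x) \<cdot> \<Omega> = adj (E x) \<cdot> \<Omega>" by simp
qed (simp_all add: E_M M.adj)

text \<open>The trace of \<open>p\<close>, written as a square so that it is visibly real and
  nonnegative.\<close>

definition "\<kappa> = (norm2 \<tau> p)\<^sup>2"

lemma trace_p: "\<tau> p = complex_of_real \<kappa>"
  using norm2_square [OF p_A] by (simp add: \<kappa>_def p_adj p_idem)

lemma \<kappa>_pos: "0 < \<kappa>"
proof -
  have "p \<noteq> 0"
  proof
    assume "p = 0"
    then have "E 1 \<cdot> \<Omega> = 0" using p_\<Omega> [OF M.one] by (simp add: bop_apply.zero_left)
    then have "norm2 \<tau> 1 = 0" using norm_\<Omega> [OF M.one] by (simp add: E_id N.one)
    then show False by (simp add: norm2_def trace_one)
  qed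
  then have "norm2 \<tau> p \<noteq> 0" using norm2_eq_0 [OF p_A] by blast
  then show ?thesis by (simp add: \<kappa>_def)
qed

text \<open>Convergence at \<open>\<Omega>\<close> suffices because right multiplication by
  \<open>a\<close> in \<open>M\<close> is bounded for the 2-norm, which gives convergence at
  \<open>a \<cdot> \<Omega>\<close>. Density and the uniform bound \<open>C\<close> extend it to all
  vectors, and the strong limit stays in the double commutant of \<open>N\<close>, that is, in
  \<open>N\<close>.\<close>

lemma bounded_strong_limit:
  assumes y: "\<And>n. y n \<in> N" "\<And>n. norm (y n) \<le> C" and lim: "(\<lambda>n. y n \<cdot> \<Omega>) \<longlonglongrightarrow> \<eta>"
  shows "\<exists>z\<in>N. norm z \<le> C \<and> z \<cdot> \<Omega> = \<eta>"
proof -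
  have C: "0 \<le> C" using y(2) [of 0] norm_ge_zero order_trans by blast
  have "Cauchy (\<lambda>n. y n \<cdot> \<xi>)" for \<xi>
  proof (rule metric_CauchyI)
    fix e :: real assume e: "0 < e"
    define d where "d = (e / 3) / (C + 1)"
    have C1: "C + 1 \<noteq> 0" using C by linarith
    have d: "0 < d" using e C by (simp add: d_def)
    have "\<xi> \<in> closure ((\<lambda>a. a \<cdot> \<Omega>) ` M)" by (simp add: \<Omega>_dense)
    then obtain a where a: "a \<in> M" "dist (a \<cdot> \<Omega>) \<xi> < d" using d by (auto simp: closure_approachable)
    define b where "b = norm a + 1"
    have b: "0 < b" "norm a < b" by (auto simp: b_def add_nonneg_pos)
    obtain K where K: "\<And>m n. m \<ge> K \<Longrightarrow> n \<ge> K \<Longrightarrow> dist (y m \<cdot> \<Omega>) (y n \<cdot> \<Omega>) < e / (3 * b)"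
      using metric_CauchyD [OF LIMSEQ_imp_Cauchy [OF lim], of "e / (3 * b)"] e b by auto
    have "dist (y m \<cdot> \<xi>) (y n \<cdot> \<xi>) < e" if "m \<ge> K" "n \<ge> K" for m n
    proof -
      have 1: "norm (y k \<cdot> (\<xi> - a \<cdot> \<Omega>)) \<le> e / 3" for k
      proof -
        have "norm (y k \<cdot> (\<xi> - a \<cdot> \<Omega>)) \<le> norm (y k) * norm (\<xi> - a \<cdot> \<Omega>)" by (rule norm_bop_apply)
        also have "\<dots> \<le> (C + 1) * d"
          using y(2) [of k] a(2) C d by (intro mult_mono) (auto simp: dist_norm norm_minus_commute)
        also have "\<dots> = e / 3"
          by (subst d_def, subst times_divide_eq_right, rule nonzero_mult_div_cancel_left [OF C1])
        finally show ?thesis .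
      qed
      have "norm ((y m - y n) \<cdot> (a \<cdot> \<Omega>)) = norm2 \<tau> ((y m - y n) * a)"
        using norm_\<Omega> [of "(y m - y n) * a"] y a by (simp add: M.mult M.diff N_M)
      also have "\<dots> \<le> norm a * norm2 \<tau> (y m - y n)"
        using y a by (intro norm2_mult_le') (simp_all add: M_A M.diff N_M)
      also have "\<dots> = norm a * dist (y m \<cdot> \<Omega>) (y n \<cdot> \<Omega>)"
        using norm_\<Omega> [of "y m - y n"] y by (simp add: dist_norm bop_apply.diff_left M.diff N_M)
      also have "\<dots> \<le> norm a * (e / (3 * b))"
        using K [OF that] by (intro mult_left_mono) auto
      also have "\<dots> < b * (e / (3 * b))"
        using b e by (intro mult_strict_right_mono) auto
      also have "\<dots> = e / 3" using b by simp
      finally have 2: "norm ((y m - y n) \<cdot> (a \<cdot> \<Omega>)) < e / 3" .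
      have "y m \<cdot> \<xi> - y n \<cdot> \<xi> = y m \<cdot> (\<xi> - a \<cdot> \<Omega>) + (y m - y n) \<cdot> (a \<cdot> \<Omega>) - y n \<cdot> (\<xi> - a \<cdot> \<Omega>)"
        by (simp add: bop_apply.diff_left bop_apply.diff_right)
      also have "norm \<dots> \<le> norm (y m \<cdot> (\<xi> - a \<cdot> \<Omega>)) + norm ((y m - y n) \<cdot> (a \<cdot> \<Omega>)) + norm (y n \<cdot> (\<xi> - a \<cdot> \<Omega>))"
        by (intro order_trans [OF norm_triangle_ineq4] add_right_mono norm_triangle_ineq)
      also have "\<dots> < e" using 1 [of m] 1 [of n] 2 by linarith
      finally show ?thesis by (simp add: dist_norm)
    qed
    then show "\<exists>K. \<forall>m\<ge>K. \<forall>n\<ge>K. dist (y m \<cdot> \<xi>) (y n \<cdot> \<xi>) < e" by blast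
  qed
  then obtain f where f: "\<And>\<xi>. (\<lambda>n. y n \<cdot> \<xi>) \<longlonglongrightarrow> f \<xi>"
    unfolding Cauchy_convergent_iff convergent_def by metis
  have "\<exists>z. \<forall>\<xi>. z \<cdot> \<xi> = f \<xi>"
  proof (rule bop_of_fun)
    show "f (a + b) = f a + f b" for a b
      using tendsto_add [OF f [of a] f [of b]] f [of "a + b"]
      by (simp add: bop_apply.add_right LIMSEQ_unique)
    show "f (c *\<^sub>C a) = c *\<^sub>C f a" for c a
      using bounded_linear.tendsto [OF bounded_linear_scaleC f [of a], of c] f [of "c *\<^sub>C a"]
      by (simp add: LIMSEQ_unique)
    show "norm (f a) \<le> C * norm a" for a
    proof (rule tendsto_upperbound [OF tendsto_norm [OF f]])
      show "\<forall>\<^sub>F n in sequentially. norm (y n \<cdot> a) \<le> C * norm a"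
        using y(2) by (intro always_eventually allI order_trans [OF norm_bop_apply] mult_right_mono) auto
    qed simp
  qed
  then obtain z where z: "\<And>\<xi>. (\<lambda>n. y n \<cdot> \<xi>) \<longlonglongrightarrow> z \<cdot> \<xi>" using f by metis
  have "norm z \<le> C"
  proof (rule norm_bop_bound [OF C])
    show "norm (z \<cdot> a) \<le> C * norm a" for a
    proof (rule tendsto_upperbound [OF tendsto_norm [OF z]])
      show "\<forall>\<^sub>F n in sequentially. norm (y n \<cdot> a) \<le> C * norm a"
        using y(2) by (intro always_eventually allI order_trans [OF norm_bop_apply] mult_right_mono) auto
    qed simp
  qed
  moreover have "z \<in> commutant (commutant N)"
    unfolding commutant_def [of "commutant N"]
  proof safe
    fix b assume b: "b \<in> commutant N"
    show "z * b = b * z"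
    proof (rule bop_eqI)
      fix \<xi>
      have "y n \<cdot> (b \<cdot> \<xi>) = b \<cdot> (y n \<cdot> \<xi>)" for n
        using b y(1) [of n] by (simp add: commutant_def flip: bop_apply_simps(2))
      then have "(\<lambda>n. y n \<cdot> (b \<cdot> \<xi>)) \<longlonglongrightarrow> b \<cdot> (z \<cdot> \<xi>)"
        using bounded_linear.tendsto [OF bop_apply.bounded_linear_right z] by simp
      then show "(z * b) \<cdot> \<xi> = (b * z) \<cdot> \<xi>" using z LIMSEQ_unique by simp blast
    qed
  qed
  then have "z \<in> N" using factor_N by (simp add: factor_def von_neumann_algebra_def)
  moreover have "z \<cdot> \<Omega> = \<eta>" using z lim LIMSEQ_unique by blast
  ultimately show ?thesis by blast
qed

text \<open>The unitaries \<open>exp (t *\<^sub>R h)\<close> with \<open>h\<close> skew-adjoint are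
  enough: the derivative at \<open>t = 0\<close> gives commutation with \<open>h\<close>, and each
  element of \<open>N\<close> is \<open>a + b\<close> with \<open>a\<close> and
  \<open>\<i> *\<^sub>C b\<close> skew-adjoint.\<close>

lemma commutant_if_commute_unitaries:
  assumes "\<And>u. u \<in> N \<Longrightarrow> adj u * u = 1 \<Longrightarrow> u * adj u = 1 \<Longrightarrow> u * y = y * u"
  shows "y \<in> commutant N"
proof -
  have skew: "h * y = y * h" if h: "h \<in> N" "adj h = - h" for h
  proof -
    have e: "exp (t *\<^sub>R h) * y = y * exp (t *\<^sub>R h)" for t
      by (rule assms) (use h in \<open>simp_all add: adj_exp N.exp N.scaleR\<close>)
    have "((\<lambda>t. exp (t *\<^sub>R h) * y) has_vector_derivative (h * exp (0 *\<^sub>R h)) * y) (at 0)"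
      by (intro has_vector_derivative_mult_left exp_scaleR_has_vector_derivative_left)
    moreover have "((\<lambda>t. exp (t *\<^sub>R h) * y) has_vector_derivative y * (h * exp (0 *\<^sub>R h))) (at 0)"
      unfolding e by (intro has_vector_derivative_mult_right exp_scaleR_has_vector_derivative_left)
    ultimately show ?thesis by (simp add: vector_derivative_unique_at)
  qed
  have "y * x = x * y" if x: "x \<in> N" for x
  proof -
    define a where "a = (1/2) *\<^sub>R (x - adj x)"
    define b where "b = (1/2) *\<^sub>R (x + adj x)"
    have i: "\<i> *\<^sub>C \<i> *\<^sub>C T = - T" for T :: "'h bop"
    proof (rule bop_eqI)
      show "(\<i> *\<^sub>C \<i> *\<^sub>C T) \<cdot> \<xi> = (- T) \<cdot> \<xi>" for \<xi>
        using scaleC_of_real [of "-1" "T \<cdot> \<xi>"] by (simp add: scaleC_scaleC bop_apply.minus_left)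
    qed
    have "adj a = - a" by (simp add: a_def algebra_simps)
    then have 1: "a * y = y * a" by (rule skew [rotated]) (simp add: a_def x N.scaleR N.diff N.adj)
    have "(- \<i>) *\<^sub>C b = - (\<i> *\<^sub>C b)"
    proof (rule bop_eqI)
      show "((- \<i>) *\<^sub>C b) \<cdot> \<xi> = (- (\<i> *\<^sub>C b)) \<cdot> \<xi>" for \<xi>
        using scaleC_of_real [of "-1" "\<i> *\<^sub>C (b \<cdot> \<xi>)"] by (simp add: scaleC_scaleC bop_apply.minus_left)
    qed
    moreover have "adj b = b" by (simp add: b_def add.commute)
    ultimately have "adj (\<i> *\<^sub>C b) = - (\<i> *\<^sub>C b)" by simp
    then have "(\<i> *\<^sub>C b) * y = y * (\<i> *\<^sub>C b)"
      by (rule skew [rotated]) (simp add: b_def x N.scaleC N.scaleR N.add N.adj)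
    then have "\<i> *\<^sub>C \<i> *\<^sub>C (b * y) = \<i> *\<^sub>C \<i> *\<^sub>C (y * b)" by simp
    then have 2: "b * y = y * b" by (simp add: i)
    have "x = a + b" by (simp add: a_def b_def algebra_simps flip: scaleR_add_left)
    then show ?thesis using 1 2 by (simp add: algebra_simps)
  qed
  then show ?thesis by (simp add: commutant_def)
qed

text \<open>Uniqueness of the trace of the factor \<open>N\<close>, applied to \<open>x \<mapsto> \<tau>(xp)\<close>. The elements of \<open>N\<close> on
  which both traces take the same values as on \<open>x\<close>, with norm at most \<open>\<parallel>x\<parallel>\<close>, form a convex set that
  is closed for \<open>\<parallel>\<sqdot>\<parallel>\<^sub>2\<close> and invariant under inner automorphisms. Its element of least \<open>\<parallel>\<sqdot>\<parallel>\<^sub>2\<close>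
  is fixed by inner automorphisms, hence a scalar.\<close>

lemma trace_mult_p_N:
  assumes x: "x \<in> N"
  shows "\<tau> (x * p) = \<tau> x * \<tau> p"
proof -
  define K where "K = {y \<in> N. norm y \<le> norm x \<and> \<tau> y = \<tau> x \<and> \<tau> (y * p) = \<tau> (x * p)}"
  let ?S = "(\<lambda>y. y \<cdot> \<Omega>) ` K"
  have KN: "y \<in> N" if "y \<in> K" for y using that by (simp add: K_def)
  have "convex ?S"
  proof (rule convexI)
    fix \<xi> \<eta> and s t :: real assume "\<xi> \<in> ?S" "\<eta> \<in> ?S" and st: "0 \<le> s" "0 \<le> t" "s + t = 1"
    then obtain a b where a: "a \<in> K" "\<xi> = a \<cdot> \<Omega>" and b: "b \<in> K" "\<eta> = b \<cdot> \<Omega>" by blast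
    have ab: "a \<in> N" "b \<in> N" using a b KN by auto
    have c: "s *\<^sub>R c + t *\<^sub>R c = c" for c :: complex using st(3) by (simp flip: scaleR_add_left)
    have "norm (s *\<^sub>R a + t *\<^sub>R b) \<le> s * norm a + t * norm b"
      using st norm_triangle_ineq [of "s *\<^sub>R a" "t *\<^sub>R b"] by simp
    also have "\<dots> \<le> s * norm x + t * norm x"
      using a(1) b(1) st by (intro add_mono mult_left_mono) (auto simp: K_def)
    also have "\<dots> = norm x" using st(3) by (simp flip: distrib_right)
    finally have "s *\<^sub>R a + t *\<^sub>R b \<in> K"
      using a(1) b(1) ab p_A
      by (simp add: K_def N.add N.scaleR distrib_right trace_add trace_scaleR scaleR mult N_A c)
    then show "s *\<^sub>R \<xi> + t *\<^sub>R \<eta> \<in> ?S"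
      by (rule rev_image_eqI) (simp add: a b bop_apply.scaleR_left)
  qed
  moreover have "closed ?S"
    unfolding closed_sequential_limits
  proof safe
    fix f \<eta> assume "\<forall>n. f n \<in> ?S" and lim: "f \<longlonglongrightarrow> \<eta>"
    then obtain y where y: "\<And>n. y n \<in> K" "f = (\<lambda>n. y n \<cdot> \<Omega>)"
      unfolding image_iff Bex_def choice_iff by blast
    obtain z where z: "z \<in> N" "norm z \<le> norm x" "z \<cdot> \<Omega> = \<eta>"
      using bounded_strong_limit [of y "norm x" \<eta>] y lim by (auto simp: K_def)
    have yN: "y n \<in> N" for n using y KN by blast
    have "(\<lambda>n. norm (f n - \<eta>)) \<longlonglongrightarrow> 0"
      using lim by (simp add: tendsto_norm_zero LIM_zero)
    moreover have "norm (f n - \<eta>) = norm2 \<tau> (y n - z)" for n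
      using norm_\<Omega> [of "y n - z"] yN z y(2) by (simp add: bop_apply.diff_left M.diff N_M)
    ultimately have lim2: "(\<lambda>n. norm2 \<tau> (y n - z)) \<longlonglongrightarrow> 0" by simp
    \<comment> \<open>With \<open>c = 1\<close> and \<open>c = p\<close> this shows that both
      functionals defining \<open>K\<close> are continuous for the 2-norm.\<close>
    have lim3: "(\<lambda>n. \<tau> (y n * c)) \<longlonglongrightarrow> \<tau> (z * c)" if c: "c \<in> A" for c
    proof -
      have "(\<lambda>n. \<tau> (y n * c) - \<tau> (z * c)) \<longlonglongrightarrow> 0"
      proof (rule Lim_null_comparison)
        have "norm (\<tau> (y n * c) - \<tau> (z * c)) \<le> norm2 \<tau> (y n - z) * norm2 \<tau> (adj c)" for n
        proof -
          have "\<tau> (y n * c) - \<tau> (z * c) = \<tau> ((y n - z) * c)"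
            using yN z(1) c by (simp add: left_diff_distrib trace_diff mult N_A)
          also have "\<dots> = \<tau> (adj (adj c) * (y n - z))"
            using yN z(1) c by (simp add: trace_mult_commute diff N_A)
          finally show ?thesis
            using norm_trace_cauchy_schwarz [of "y n - z" "adj c"] yN z(1) c
            by (simp add: diff N_A adj)
        qed
        then show "\<forall>\<^sub>F n in sequentially. norm (\<tau> (y n * c) - \<tau> (z * c)) \<le> norm2 \<tau> (y n - z) * norm2 \<tau> (adj c)"
          by simp
        show "(\<lambda>n. norm2 \<tau> (y n - z) * norm2 \<tau> (adj c)) \<longlonglongrightarrow> 0"
          using tendsto_mult_right [OF lim2] by simp
      qed
      then show ?thesis by (simp add: LIM_zero_iff)
    qed
    have "\<tau> z = \<tau> x" "\<tau> (z * p) = \<tau> (x * p)"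
      using lim3 [OF one] lim3 [OF p_A] y(1) by (simp_all add: K_def LIMSEQ_const_iff)
    with z show "\<eta> \<in> ?S" by (auto simp: K_def)
  qed
  moreover have "?S \<noteq> {}" using x by (auto simp: K_def)
  ultimately obtain y where y: "y \<in> K" "\<And>z. z \<in> K \<Longrightarrow> norm (y \<cdot> \<Omega>) \<le> norm (z \<cdot> \<Omega>)"
    using closed_convex_min_norm_exists [of ?S] by auto
  have yN: "y \<in> N" using y KN by blast
  have "y \<in> commutant N"
  proof (rule commutant_if_commute_unitaries)
    fix u assume u: "u \<in> N" "adj u * u = 1" "u * adj u = 1"
    define z where "z = u * y * adj u"
    have nu: "norm u = 1" using norm_adj_mult_self [of u] u by (simp add: power2_eq_1_iff) (metis norm_ge_zero not_one_le_zero neg_0_le_iff_le)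
    have n2: "norm2 \<tau> z = norm2 \<tau> y"
      unfolding z_def using u yN
      by (simp add: norm2_mult_unitary norm2_unitary_mult N_A N.adj N.mult)
    have "norm z \<le> norm u * norm y * norm (adj u)"
      unfolding z_def by (intro order_trans [OF norm_mult_ineq] mult_right_mono norm_mult_ineq) simp
    also have "\<dots> = norm y" by (simp add: nu)
    also have "\<dots> \<le> norm x" using y(1) by (simp add: K_def)
    finally have "norm z \<le> norm x" .
    moreover have "\<tau> z = \<tau> y"
      using trace_mult_commute [of "u * y" "adj u"] u yN by (simp add: z_def N_A mult adj flip: mult.assoc)
    \<comment> \<open>The second functional is tracial on \<open>N\<close> as well, because
      \<open>p\<close> commutes with \<open>N\<close>.\<close>
    moreover have "\<tau> (z * p) = \<tau> (y * p)"
    proof -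
      have "z * p = u * y * p * adj u"
        using p_commute [of "adj u"] u by (simp add: z_def N.adj mult.assoc)
      then show ?thesis
        using trace_mult_commute [of "u * y * p" "adj u"] u yN p_A by (simp add: N_A mult adj flip: mult.assoc)
    qed
    ultimately have "z \<in> K" using y(1) u yN by (simp add: K_def) (simp add: z_def N.mult N.adj)
    have "y \<cdot> \<Omega> = z \<cdot> \<Omega>"
    proof (rule convex_min_norm_unique [OF \<open>convex ?S\<close>])
      show "norm (y \<cdot> \<Omega>) = norm (z \<cdot> \<Omega>)"
        using n2 \<open>z \<in> K\<close> y(1) KN by (simp add: norm_\<Omega> N_M)
    qed (use y \<open>z \<in> K\<close> in auto)
    then have "y = z" using \<Omega>_separating \<open>z \<in> K\<close> y(1) KN N_M by blast
    then have "y * u = z * u" by simp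
    also have "\<dots> = u * y" using u by (simp add: z_def mult.assoc)
    finally show "u * y = y * u" by simp
  qed
  then have "y \<in> range (\<lambda>c. c *\<^sub>C 1)" using factor_N yN by (auto simp: factor_def)
  then obtain c where "y = c *\<^sub>C 1" by blast
  then have "\<tau> y = c" "\<tau> (y * p) = c * \<tau> p" by (simp_all add: trace_scaleC trace_one one p_A)
  moreover have "\<tau> y = \<tau> x" "\<tau> (y * p) = \<tau> (x * p)" using y(1) by (simp_all add: K_def)
  ultimately show ?thesis by metis
qed

text \<open>Compression by \<open>p\<close> moves \<open>x\<close> into \<open>N\<close>:
  \<open>\<tau> (x * p) = \<tau> (p * x * p) = \<tau> (E x * p)\<close>, where the uniqueness of the
  trace on \<open>N\<close> applies.\<close>

lemma trace_mult_p:
  assumes x: "x \<in> M"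
  shows "\<tau> (x * p) = \<kappa> * \<tau> x"
proof -
  have "\<tau> (x * p) = \<tau> ((x * p) * p)" by (simp add: mult.assoc p_idem)
  also have "\<dots> = \<tau> (p * x * p)"
    using x by (subst trace_mult_commute) (simp_all add: mult.assoc mult M_A p_A)
  also have "\<dots> = \<tau> (E x) * \<tau> p" by (simp add: p_mult_p x trace_mult_p_N E_N)
  finally show ?thesis by (simp add: trace_E x trace_p mult.commute)
qed

lemma trace_p_mult: "x \<in> M \<Longrightarrow> \<tau> (p * x) = \<kappa> * \<tau> x"
  by (subst trace_mult_commute) (simp_all add: M_A p_A trace_mult_p)

text \<open>By the Markov property \<open>norm2 \<tau> (p * adj x * y) = sqrt \<kappa> * norm2
  \<tau> (adj x * y)\<close> for all \<open>y\<close> in \<open>M\<close>. Density of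
  \<open>M \<Omega>\<close> turns this equality of 2-norms into a comparison of operator
  norms.\<close>

lemma pimsner_popa:
  assumes x: "x \<in> M"
  shows "sqrt \<kappa> * norm x \<le> norm (x * p)"
proof -
  let ?k = "p * adj x"
  have "norm (adj x) \<le> norm ?k / sqrt \<kappa>"
  proof (rule norm_bop_bound_\<Omega>)
    fix y assume y: "y \<in> M"
    have m: "adj x \<in> M" "adj y \<in> M" using x y M.adj by auto
    have "adj (?k * y) * (?k * y) = (adj y * x * p) * (adj x * y)"
      by (simp add: p_adj p_idem' mult.assoc)
    then have "\<tau> (adj (?k * y) * (?k * y)) = \<tau> ((adj x * y * adj y * x) * p)"
      using trace_mult_commute [of "adj y * x * p" "adj x * y"] x y m
      by (simp add: mult M_A p_A mult.assoc)
    also have "\<dots> = \<kappa> * \<tau> (adj (adj y * x) * (adj y * x))"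
      using x y m by (subst trace_mult_p) (simp_all add: M.mult mult.assoc)
    also have "\<dots> = complex_of_real (\<kappa> * (norm2 \<tau> (adj y * x))\<^sup>2)"
      by (simp only: norm2_square [OF M_A [OF M.mult [OF m(2) x]]] of_real_mult)
    also have "norm2 \<tau> (adj y * x) = norm2 \<tau> (adj x * y)"
      using norm2_adj [of "adj x * y"] x y m by (simp add: M_A M.mult)
    finally have "(norm2 \<tau> (?k * y))\<^sup>2 = \<kappa> * (norm2 \<tau> (adj x * y))\<^sup>2"
      using norm2_square [of "?k * y"] x y m by (simp only: mult M_A p_A of_real_eq_iff)
    then have "(sqrt \<kappa> * norm2 \<tau> (adj x * y))\<^sup>2 = (norm2 \<tau> (?k * y))\<^sup>2"
      using \<kappa>_pos by (simp add: power_mult_distrib)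
    then have "sqrt \<kappa> * norm2 \<tau> (adj x * y) = norm2 \<tau> (?k * y)"
      using \<kappa>_pos m y by (subst (asm) power2_eq_iff_nonneg) (simp_all add: norm2_nonneg mult M_A p_A)
    also have "\<dots> \<le> norm ?k * norm2 \<tau> y"
      using m y by (intro norm2_mult_le) (simp_all add: mult M_A p_A)
    finally have "norm2 \<tau> (adj x * y) \<le> norm ?k / sqrt \<kappa> * norm2 \<tau> y"
      using \<kappa>_pos by (simp add: field_simps)
    then show "norm (adj x \<cdot> (y \<cdot> \<Omega>)) \<le> norm ?k / sqrt \<kappa> * norm (y \<cdot> \<Omega>)"
      using norm_\<Omega> [of "adj x * y"] norm_\<Omega> [OF y] m y by (simp add: M.mult)
  qed (use \<kappa>_pos in simp)
  moreover have "norm ?k = norm (x * p)" using norm_adj [of ?k] by (simp add: p_adj)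
  ultimately show ?thesis using \<kappa>_pos by (simp add: field_simps)
qed

text \<open>\<open>E x * p\<close> is the compression of \<open>x\<close> by \<open>p\<close>, and
  the Pimsner--Popa inequality removes the factor \<open>p\<close>. The loss of
  \<open>1 / sqrt \<kappa>\<close> only makes the later radii smaller.\<close>

lemma norm_E_le:
  assumes x: "x \<in> M"
  shows "norm (E x) \<le> norm x / sqrt \<kappa>"
proof -
  have "sqrt \<kappa> * norm (E x) \<le> norm (p * x * p)"
    using pimsner_popa [of "E x"] x by (simp add: E_M p_mult_p)
  also have "\<dots> \<le> norm p * norm x * norm p"
    by (intro order_trans [OF norm_mult_ineq] mult_right_mono norm_mult_ineq) simp
  also have "\<dots> \<le> 1 * norm x * 1"
    using norm_p by (intro mult_mono) auto
  finally show ?thesis using \<kappa>_pos by (simp add: field_simps)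
qed

text \<open>As \<open>E x\<close> commutes with \<open>p\<close>, only \<open>x - E x\<close>
  matters; its compression by \<open>p\<close> vanishes, so the two terms of its commutator with
  \<open>p\<close> are orthogonal and each contributes \<open>\<kappa>\<close> times the squared
  2-norm. The computation obtains this by expanding the trace.\<close>

lemma norm2_commutator:
  assumes x: "x \<in> M"
  shows "norm2 \<tau> (x * p - p * x) = sqrt (2 * \<kappa>) * norm2 \<tau> (x - E x)"
proof -
  define y where "y = E x"
  have y: "y \<in> N" "y \<in> M" "adj y \<in> N" "adj y \<in> M" "adj x \<in> M" "E (adj x) = adj y"
    using x by (auto simp: y_def E_N E_M N.adj M.adj E_adj)
  note mem = x y(2,4,5) M_A p_A M.mult mult M.diff diff
  have c1: "\<tau> (adj y * x) = \<tau> (adj y * y)"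
    using trace_E [of "adj y * x"] x y by (simp add: E_mult_left M.mult) (simp add: y_def)
  have c2: "\<tau> (adj x * y) = \<tau> (adj y * y)"
    using trace_E [of "adj x * y"] x y by (simp add: E_mult_right M.mult)
  have c3: "\<tau> (x * adj y) = \<tau> (adj y * y)"
    using trace_mult_commute [of x "adj y"] c1 by (simp add: mem)
  have "\<tau> (adj (x - y) * (x - y)) = \<tau> (adj x * x) - \<tau> (adj y * y)"
    by (simp add: algebra_simps trace_diff trace_add add mem c1 c2)
  then have 1: "complex_of_real ((norm2 \<tau> (x - y))\<^sup>2) = \<tau> (adj x * x) - \<tau> (adj y * y)"
    by (rule trans [OF norm2_square [OF M_A [OF M.diff [OF x y(2)]], symmetric]])
  have px: "p * adj x * p = adj y * p" "p * x * p = y * p"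
    using p_mult_p [of "adj x"] p_mult_p [of x] x y by (simp_all add: y_def)
  have "adj (x * p - p * x) * (x * p - p * x)
    = p * (adj x * x * p) - (p * adj x * p) * x - adj x * (p * x * p) + adj x * (p * x)"
    by (simp add: p_adj algebra_simps p_idem')
  also have "\<tau> \<dots> = \<tau> (p * (adj x * x * p)) - \<tau> (adj y * p * x) - \<tau> (adj x * y * p) + \<tau> (adj x * (p * x))"
    unfolding px by (simp add: trace_diff trace_add mem mult.assoc)
  also have "\<tau> (p * (adj x * x * p)) = \<kappa> * \<tau> (adj x * x)"
    using trace_mult_commute [of p "adj x * x * p"] trace_mult_p [of "adj x * x"]
    by (simp add: mem mult.assoc p_idem)
  also have "\<tau> (adj y * p * x) = \<kappa> * \<tau> (adj y * y)"
    using trace_mult_commute [of "adj y * p" x] trace_mult_p [of "x * adj y"] c3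
    by (simp add: mem mult.assoc)
  also have "\<tau> (adj x * y * p) = \<kappa> * \<tau> (adj y * y)"
    using trace_mult_p [of "adj x * y"] c2 by (simp add: mem)
  also have "\<tau> (adj x * (p * x)) = \<kappa> * \<tau> (adj x * x)"
    using trace_mult_commute [of "adj x" "p * x"] trace_p_mult [of "x * adj x"] trace_mult_commute [of x "adj x"]
    by (simp add: mem mult.assoc)
  finally have "\<tau> (adj (x * p - p * x) * (x * p - p * x)) = complex_of_real (2 * \<kappa>) * (\<tau> (adj x * x) - \<tau> (adj y * y))"
    by (simp add: algebra_simps)
  moreover have "x * p - p * x \<in> A" by (simp add: mem)
  ultimately have "complex_of_real ((norm2 \<tau> (x * p - p * x))\<^sup>2) = complex_of_real (2 * \<kappa> * (norm2 \<tau> (x - y))\<^sup>2)"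
    unfolding of_real_mult [of "2 * \<kappa>"] 1 by (metis norm2_square)
  then have "(norm2 \<tau> (x * p - p * x))\<^sup>2 = 2 * \<kappa> * (norm2 \<tau> (x - y))\<^sup>2"
    by (simp only: of_real_eq_iff)
  then have "(norm2 \<tau> (x * p - p * x))\<^sup>2 = (sqrt (2 * \<kappa>) * norm2 \<tau> (x - y))\<^sup>2"
    using \<kappa>_pos by (simp add: power_mult_distrib)
  then show ?thesis
    unfolding y_def [symmetric] using \<kappa>_pos
    by (subst (asm) power2_eq_iff_nonneg) (simp_all add: norm2_nonneg mem)
qed

end

section \<open>Normal coordinates on the orbit\<close>

lemma exp_conjugate:
  fixes u v x :: "'a::{real_normed_algebra_1,banach}"
  assumes "v * u = 1" "u * v = 1"
  shows "u * exp x * v = exp (u * x * v)"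
proof -
  have vu: "v * (u * y) = y" for y by (simp add: assms flip: mult.assoc)
  have "(u * x * v) ^ n = u * x ^ n * v" for n
    by (induction n) (simp_all add: assms mult.assoc vu)
  moreover have "(\<lambda>n. u * (x ^ n /\<^sub>R fact n) * v) sums (u * exp x * v)"
    by (intro sums_mult sums_mult2 exp_converges)
  ultimately show ?thesis using exp_converges [of "u * x * v"] by (simp add: sums_unique2)
qed

lemma increment_square_bound_imp_le:
  fixes h :: "real \<Rightarrow> real"
  assumes "\<And>a b. 0 \<le> a \<Longrightarrow> a \<le> b \<Longrightarrow> b \<le> 1 \<Longrightarrow> h b - h a \<le> K * (b - a)\<^sup>2"
  shows "h 1 \<le> h 0"
proof -
  have "h 1 - h 0 \<le> K * (1 / Suc n)" for n
  proof -
    have "h (k / Suc n) - h 0 \<le> k * (K * (1 / Suc n)\<^sup>2)" if "k \<le> Suc n" for k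
      using that
    proof (induction k)
      case (Suc k)
      have "h (Suc k / Suc n) - h (k / Suc n) \<le> K * (Suc k / Suc n - k / Suc n)\<^sup>2"
        using Suc.prems by (intro assms) (auto simp: divide_right_mono)
      also have "real (Suc k) / Suc n - k / Suc n = 1 / Suc n" by (simp flip: diff_divide_distrib)
      finally show ?case using Suc by (simp add: distrib_right)
    qed simp
    from this [of "Suc n"] show ?thesis by (simp add: power2_eq_square del: of_nat_Suc)
  qed
  moreover have "(\<lambda>n. K * (1 / Suc n)) \<longlonglongrightarrow> K * 0"
    by (intro tendsto_mult_left LIMSEQ_Suc [OF lim_1_over_n])
  ultimately have "h 1 - h 0 \<le> K * 0" by (intro LIMSEQ_le_const) auto
  then show ?thesis by simp
qed

lemma horizontal_memD:
  "z \<in> horizontal M E \<Longrightarrow> z \<in> M" "z \<in> horizontal M E \<Longrightarrow> adj z = - z" "z \<in> horizontal M E \<Longrightarrow> E z = 0"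
  by (auto simp: horizontal_def)

lemma vector_derivative_within_unit_interval:
  "t \<in> {0..1::real} \<Longrightarrow> (\<gamma> has_vector_derivative y) (at t within {0..1}) \<Longrightarrow>
    vector_derivative \<gamma> (at t within {0..1}) = y"
  by (rule vector_derivative_within) (simp_all add: trivial_limit_within islimpt_Icc)

section \<open>The Gauss lemma in finite increments\<close>

context jones_setting
begin

definition "orbit_exp z = exp z * p * exp (- z)"

lemma orbit_exp_0: "orbit_exp 0 = p"
  by (simp add: orbit_exp_def)

lemma orbit_exp_A: "z \<in> M \<Longrightarrow> orbit_exp z \<in> A"
  unfolding orbit_exp_def by (intro mult p_A M_A M.exp M.minus)

lemma abs_Re_trace_le: "x \<in> A \<Longrightarrow> \<bar>Re (\<tau> x)\<bar> \<le> norm x"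
  using abs_trace_cauchy_schwarz [of x 1] norm2_le_norm [of x] by (simp add: one norm2_def trace_one)

lemma E_horizontal_zero:
  assumes "z \<in> horizontal M E"
  shows "adj z \<in> M" "E (adj z) = 0"
proof -
  have 0: "E 0 = 0" using E_id [OF N.zero] .
  show "adj z \<in> M" "E (adj z) = 0"
    using horizontal_memD [OF assms] by (simp_all add: M.minus E_minus)
qed

text \<open>The exponential map is a radial isometry: pairing \<open>W = e\<^bsup>-z\<^esup>e\<^bsup>y\<^esup>\<close> with \<open>z\<close> only sees the first
  order term \<open>y - z\<close>, because \<open>z\<close> commutes with \<open>e\<^bsup>sz\<^esup>\<close> under the trace. This is the Gauss lemma in
  finite increments.\<close>

lemma trace_radial_increment:
  assumes z: "z \<in> horizontal M E" and y: "y \<in> M" and r: "norm z \<le> r" "norm y \<le> r"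
  shows "\<bar>Re (\<tau> (adj z * (exp (- z) * exp y))) - Re (\<tau> (adj z * (y - z)))\<bar>
    \<le> r * exp r * exp r * (norm (y - z))\<^sup>2"
proof -
  note z' = horizontal_memD [OF z]
  have r0: "0 \<le> r" using r(1) norm_ge_zero order_trans by blast
  obtain f where f: "bounded_linear f" "\<And>x. x \<in> A \<Longrightarrow> f x = \<tau> x" using trace_extension by blast
  \<comment> \<open>A path from 1 to \<open>exp (- z) * exp y\<close>, to which the mean value
    theorem is applied after pairing with \<open>z\<close>; its value at 0 drops out because
    \<open>E z = 0\<close> forces \<open>\<tau> (adj z) = 0\<close>.\<close>
  let ?w = "\<lambda>s. exp (s *\<^sub>R (- z)) * exp (s *\<^sub>R y)"
  let ?w' = "\<lambda>s. exp (s *\<^sub>R (- z)) * (y - z) * exp (s *\<^sub>R y)"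
  have w: "(?w has_vector_derivative ?w' s) (at s)" for s
    by (rule has_vector_derivative_eq_rhs [OF has_vector_derivative_mult
          [OF exp_scaleR_has_vector_derivative_right exp_scaleR_has_vector_derivative_left]])
      (simp add: algebra_simps)
  have bl: "bounded_linear (\<lambda>x. Re (f (adj z * x)))"
    by (intro bounded_linear_compose [OF bounded_linear_Re] bounded_linear_compose [OF f(1)]
        bounded_linear_mult_right)
  have "((\<lambda>s. Re (f (adj z * ?w s))) has_real_derivative Re (f (adj z * ?w' s))) (at s)" for s
    unfolding has_real_derivative_iff_has_vector_derivative
    by (rule bounded_linear.has_vector_derivative [OF bl w])
  from MVT2 [of 0 1, OF _ this] obtain s where s: "0 < s" "s < 1"
    and mvt: "Re (f (adj z * ?w 1)) - Re (f (adj z * ?w 0)) = Re (f (adj z * ?w' s))"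
    by auto
  have mem: "z \<in> A" "y \<in> A" "exp (s *\<^sub>R (- z)) \<in> A" "exp (s *\<^sub>R y) \<in> A" "exp (s *\<^sub>R z) \<in> A" "adj z \<in> A"
    "exp (- z) \<in> A" "exp y \<in> A"
    using z' y by (simp_all add: M_A M.exp M.scaleR M.minus)
  have "\<tau> (adj z) = 0"
    using trace_E [OF E_horizontal_zero(1) [OF z]] by (simp add: E_horizontal_zero(2) [OF z] trace_zero)
  then have 1: "Re (\<tau> (adj z * (exp (- z) * exp y))) = Re (\<tau> (adj z * ?w' s))"
    using mvt mem by (simp add: f(2) mult diff)
  have comm: "exp (s *\<^sub>R z) * z = z * exp (s *\<^sub>R z)"
    by (rule exp_commute_arg) simp
  have "\<tau> (adj z * (exp (s *\<^sub>R (- z)) * (y - z) * exp (s *\<^sub>R z)))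
    = \<tau> (exp (s *\<^sub>R z) * (adj z * (exp (s *\<^sub>R (- z)) * (y - z))))"
    using trace_mult_commute [of "adj z * (exp (s *\<^sub>R (- z)) * (y - z))" "exp (s *\<^sub>R z)"] mem
    by (simp add: mult diff mult.assoc)
  also have "exp (s *\<^sub>R z) * (adj z * (exp (s *\<^sub>R (- z)) * (y - z)))
      = - ((exp (s *\<^sub>R z) * z) * (exp (- (s *\<^sub>R z)) * (y - z)))"
    by (simp add: z' mult.assoc)
  also have "\<dots> = adj z * (y - z)" by (simp add: comm z' mult.assoc)
  finally have 2: "\<tau> (adj z * (exp (s *\<^sub>R (- z)) * (y - z) * exp (s *\<^sub>R z))) = \<tau> (adj z * (y - z))" .
  \<comment> \<open>The error of replacing \<open>exp (s *\<^sub>R y)\<close> by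
    \<open>exp (s *\<^sub>R z)\<close> in the derivative. Besides \<open>y - z\<close> it contains a
    difference of exponentials of the same order, hence the quadratic bound.\<close>
  define B where "B = adj z * (exp (s *\<^sub>R (- z)) * (y - z) * (exp (s *\<^sub>R y) - exp (s *\<^sub>R z)))"
  have "\<tau> (adj z * ?w' s) - \<tau> (adj z * (y - z)) = \<tau> B"
  proof -
    have "B = adj z * ?w' s - adj z * (exp (s *\<^sub>R (- z)) * (y - z) * exp (s *\<^sub>R z))"
      by (simp only: B_def right_diff_distrib)
    also have "\<tau> \<dots> = \<tau> (adj z * ?w' s) - \<tau> (adj z * (exp (s *\<^sub>R (- z)) * (y - z) * exp (s *\<^sub>R z)))"
      by (intro trace_diff mult diff mem)
    finally show ?thesis unfolding 2 by simp
  qed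
  then have "\<bar>Re (\<tau> (adj z * (exp (- z) * exp y))) - Re (\<tau> (adj z * (y - z)))\<bar> = \<bar>Re (\<tau> B)\<bar>"
    by (simp add: 1 flip: minus_complex.simps)
  also have "\<dots> \<le> norm B" using mem by (intro abs_Re_trace_le) (simp add: B_def mult diff)
  also have "\<dots> \<le> r * (exp r * norm (y - z) * (exp r * norm (y - z)))"
  proof -
    have sr: "norm (s *\<^sub>R x) \<le> r" if "norm x \<le> r" for x :: "'h bop"
      using s that mult_mono [of s 1 "norm x" r] r0 by simp
    have a: "norm (exp (s *\<^sub>R (- z))) \<le> exp r"
      using norm_exp [of "s *\<^sub>R (- z)"] sr [of "- z"] r by (intro order_trans [OF norm_exp]) simp
    have "norm (exp (s *\<^sub>R y) - exp (s *\<^sub>R z)) \<le> exp r * norm (s *\<^sub>R y - s *\<^sub>R z)"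
      by (intro norm_exp_diff_le sr r)
    also have "\<dots> \<le> exp r * norm (y - z)"
      using s by (simp add: mult_left_le_one_le flip: scaleR_diff_right)
    finally have b: "norm (exp (s *\<^sub>R y) - exp (s *\<^sub>R z)) \<le> exp r * norm (y - z)" .
    show ?thesis
      unfolding B_def using r(1) r0
      by (intro order_trans [OF norm_mult_ineq] mult_mono a b) auto
  qed
  finally show ?thesis by (simp add: power2_eq_square mult_ac)
qed

text \<open>Factoring out \<open>exp z\<close> and \<open>exp (- y)\<close>, which are unitary by
  skew-adjointness, leaves the commutator of \<open>exp (- z) * exp y\<close> with
  \<open>p\<close>.\<close>

lemma norm2_orbit_exp_diff:
  assumes z: "z \<in> horizontal M E" and y: "y \<in> horizontal M E"
  shows "norm2 \<tau> (orbit_exp y - orbit_exp z) =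
    sqrt (2 * \<kappa>) * norm2 \<tau> (exp (- z) * exp y - E (exp (- z) * exp y))"
proof -
  note z' = horizontal_memD [OF z] and y' = horizontal_memD [OF y]
  let ?W = "exp (- z) * exp y"
  have mem: "exp z \<in> M" "exp (- y) \<in> M" "?W \<in> M"
    using z' y' by (simp_all add: M.mult M.exp M.minus)
  have "orbit_exp y - orbit_exp z = exp z * (?W * p - p * ?W) * exp (- y)"
    by (simp add: orbit_exp_def algebra_simps)
  then have "norm2 \<tau> (orbit_exp y - orbit_exp z) = norm2 \<tau> (?W * p - p * ?W)"
    using mem by (simp add: norm2_mult_unitary norm2_unitary_mult M_A p_A mult diff adj_exp z' y' del: mult.assoc)
  then show ?thesis using norm2_commutator [OF mem(3)] by simp
qed

text \<open>Under the trace \<open>z\<close> is orthogonal to \<open>N\<close>, so pairing with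
  \<open>z\<close> does not see \<open>E W\<close> for \<open>W = exp (- z) * exp y\<close>.
  Cauchy--Schwarz then produces \<open>norm2 \<tau> (W - E W)\<close>, the chord up to the factor
  \<open>sqrt (2 * \<kappa>)\<close>.\<close>

lemma radial_increment_le:
  assumes z: "z \<in> horizontal M E" and y: "y \<in> horizontal M E" and r: "norm z \<le> r" "norm y \<le> r"
  shows "Re (\<tau> (adj z * (y - z)))
    \<le> norm2 \<tau> z * (norm2 \<tau> (orbit_exp y - orbit_exp z) / sqrt (2 * \<kappa>)) + r * exp r * exp r * (norm (y - z))\<^sup>2"
proof -
  note z' = horizontal_memD [OF z] and y' = horizontal_memD [OF y]
  let ?W = "exp (- z) * exp y"
  have W: "?W \<in> M" "?W - E ?W \<in> M"
    using z' y' by (simp_all add: M.mult M.exp M.minus M.diff E_M)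
  have "\<tau> (adj z * E ?W) = \<tau> (E (adj z * E ?W))"
    using W E_horizontal_zero [OF z] by (simp add: trace_E M.mult E_M)
  also have "\<dots> = 0"
    using W E_horizontal_zero [OF z] by (simp add: E_mult_right E_N trace_zero)
  finally have "\<tau> (adj z * ?W) = \<tau> (adj z * (?W - E ?W))"
    using W E_horizontal_zero [OF z] unfolding right_diff_distrib
    by (subst trace_diff) (simp_all add: M_A E_M mult)
  then have "Re (\<tau> (adj z * ?W)) \<le> norm2 \<tau> (?W - E ?W) * norm2 \<tau> z"
    using trace_cauchy_schwarz [OF M_A [OF W(2)] M_A [OF z'(1)]] by simp
  also have "norm2 \<tau> (?W - E ?W) = norm2 \<tau> (orbit_exp y - orbit_exp z) / sqrt (2 * \<kappa>)"
    using \<kappa>_pos by (simp add: norm2_orbit_exp_diff [OF z y])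
  finally show ?thesis
    using trace_radial_increment [OF z y'(1) r] by (simp add: abs_le_iff mult.commute)
qed

text \<open>The regularisation by \<open>\<epsilon>\<close> makes the radius function \<open>z \<mapsto> \<parallel>z\<parallel>\<^sub>2\<close> smooth at the origin.\<close>

lemma regularized_radius_increment_le:
  assumes z: "z \<in> horizontal M E" and y: "y \<in> horizontal M E" and r: "norm z \<le> r" "norm y \<le> r"
    and \<epsilon>: "0 < \<epsilon>"
  shows "sqrt ((norm2 \<tau> y)\<^sup>2 + \<epsilon>) \<le> sqrt ((norm2 \<tau> z)\<^sup>2 + \<epsilon>)
    + norm2 \<tau> (orbit_exp y - orbit_exp z) / sqrt (2 * \<kappa>)
    + (2 * (r * exp r * exp r) + 1) / (2 * sqrt \<epsilon>) * (norm (y - z))\<^sup>2"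
proof -
  note z' = horizontal_memD [OF z] and y' = horizontal_memD [OF y]
  let ?f = "sqrt ((norm2 \<tau> z)\<^sup>2 + \<epsilon>)" and ?D = "norm2 \<tau> (orbit_exp y - orbit_exp z) / sqrt (2 * \<kappa>)"
  let ?C = "r * exp r * exp r" and ?d = "(norm (y - z))\<^sup>2"
  \<comment> \<open>The summand 1 accounts for the squared 2-norm of \<open>y - z\<close>, estimated
    by the operator norm.\<close>
  let ?B = "(2 * ?C + 1) * ?d"
  have r0: "0 \<le> r" using r(1) norm_ge_zero order_trans by blast
  have mem: "z \<in> A" "y \<in> A" "y - z \<in> A" using z' y' by (simp_all add: M_A diff)
  have D: "0 \<le> ?D"
    using \<kappa>_pos z' y' by (simp add: norm2_nonneg diff orbit_exp_A)
  have B: "0 \<le> ?B" using r0 by simp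
  have f: "norm2 \<tau> z \<le> ?f" "sqrt \<epsilon> \<le> ?f" "0 \<le> ?f"
    using \<epsilon> by (auto intro: real_le_rsqrt)
  have "(norm2 \<tau> (y - z))\<^sup>2 \<le> ?d"
    by (intro power_mono norm2_le_norm norm2_nonneg mem)
  moreover have "Re (\<tau> (adj (y - z) * z)) = Re (\<tau> (adj z * (y - z)))"
    using trace_adj [of "adj z * (y - z)"] mem by (simp add: mult adj)
  ultimately have "(norm2 \<tau> y)\<^sup>2 \<le> (norm2 \<tau> z)\<^sup>2 + 2 * Re (\<tau> (adj z * (y - z))) + ?d"
    using norm2_add_scaleR_square [of z "y - z" 1] mem by simp
  also have "\<dots> \<le> (norm2 \<tau> z)\<^sup>2 + 2 * (norm2 \<tau> z * ?D) + ?B"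
  proof -
    have "?B = 2 * (?C * ?d) + ?d" by (simp add: algebra_simps)
    then show ?thesis using radial_increment_le [OF z y r] by linarith
  qed
  \<comment> \<open>As \<open>sqrt \<epsilon> \<le> ?f\<close>, the remainder can be given the
    factor \<open>2 * ?f\<close>, after which the right-hand side is completed to a square.\<close>
  also have "\<dots> \<le> (norm2 \<tau> z)\<^sup>2 + 2 * (?f * ?D) + 2 * ?f * (?B / (2 * sqrt \<epsilon>))"
  proof -
    have "?B = 2 * sqrt \<epsilon> * (?B / (2 * sqrt \<epsilon>))" using \<epsilon> by simp
    also have "\<dots> \<le> 2 * ?f * (?B / (2 * sqrt \<epsilon>))"
      using f B \<epsilon> by (intro mult_right_mono) auto
    finally show ?thesis using mult_right_mono [OF f(1) D] by linarith
  qed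
  finally have "(norm2 \<tau> y)\<^sup>2 + \<epsilon> \<le> ?f\<^sup>2 + 2 * ?f * (?D + ?B / (2 * sqrt \<epsilon>))"
    using \<epsilon> by (simp add: distrib_left add_nonneg_pos less_imp_le)
  also have "\<dots> \<le> (?f + (?D + ?B / (2 * sqrt \<epsilon>)))\<^sup>2"
    unfolding power2_sum [of ?f] using zero_le_power2 [of "?D + ?B / (2 * sqrt \<epsilon>)"] by linarith
  finally have "sqrt ((norm2 \<tau> y)\<^sup>2 + \<epsilon>) \<le> ?f + (?D + ?B / (2 * sqrt \<epsilon>))"
    by (rule real_le_lsqrt [rotated -1]) (use f D B \<epsilon> in auto)
  then show ?thesis by (simp add: add.assoc)
qed

end

text \<open>The first bound limits the nonlinear part of \<open>orbit_exp\<close> to half of the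
  linear lower bound \<open>sqrt \<kappa>\<close>; the second gives the fixed point map of
  \<open>exp_factorization\<close> the contraction constant 1/2.\<close>

locale jones_radius = jones_setting +
  fixes r :: real
  assumes r_pos: "0 < r"
    and r_small: "(exp r - 1) * (exp r + 1) \<le> sqrt \<kappa> / 4"
      "(exp r - 1) * (exp r + 1) * (1 + 2 / sqrt \<kappa>) \<le> 1 / 2"
begin

text \<open>For \<open>x = z1 - z2\<close> the linear part is the commutator of \<open>x\<close>
  with \<open>p\<close>. Multiplied by \<open>p\<close> on the right it becomes
  \<open>x * p\<close>, because \<open>E x = 0\<close>, so Pimsner--Popa bounds it below by
  \<open>sqrt \<kappa> * norm x\<close>. The two exponentials contribute \<open>2 * norm x\<close>
  to the remainder, which costs half of this. Skew-adjointness is left out since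
  \<open>orbit_exp_surj\<close> uses injectivity to derive it.\<close>

lemma orbit_exp_expansive:
  assumes z: "z1 \<in> M" "z2 \<in> M" "E z1 = 0" "E z2 = 0" and r: "norm z1 \<le> r" "norm z2 \<le> r"
  shows "sqrt \<kappa> / 2 * norm (z1 - z2) \<le> norm (orbit_exp z1 - orbit_exp z2)"
proof -
  let ?x = "z1 - z2"
  let ?c = "?x * p - p * ?x"
  have "norm (orbit_exp z1 - orbit_exp z2 - (?x * p + p * (- z1 - - z2)))
      \<le> (exp r - 1) * (exp r + 1) * (norm ?x + norm (- z1 - - z2))"
    unfolding orbit_exp_def by (rule norm_exp_mult_exp_diff_le) (use r norm_p in auto)
  also have "\<dots> = (exp r - 1) * (exp r + 1) * (2 * norm ?x)" by (simp add: norm_minus_commute)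
  also have "\<dots> \<le> sqrt \<kappa> / 4 * (2 * norm ?x)" by (intro mult_right_mono r_small) simp
  also have "?x * p + p * (- z1 - - z2) = ?c" by (simp add: algebra_simps)
  finally have 1: "norm (orbit_exp z1 - orbit_exp z2 - ?c) \<le> sqrt \<kappa> / 2 * norm ?x" by simp
  have x: "?x \<in> M" "E ?x = 0" using z by (simp_all add: M.diff E_diff)
  then have "p * ?x * p = 0" by (simp only: p_mult_p) simp
  then have "?x * p = ?c * p" by (simp add: left_diff_distrib mult.assoc p_idem)
  have "sqrt \<kappa> * norm ?x \<le> norm (?c * p)"
    unfolding \<open>?x * p = ?c * p\<close> [symmetric] by (rule pimsner_popa [OF x(1)])
  also have "\<dots> \<le> norm ?c * 1"
    using norm_p by (intro order_trans [OF norm_mult_ineq] mult_left_mono) auto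
  also have "\<dots> \<le> norm (orbit_exp z1 - orbit_exp z2) + norm (orbit_exp z1 - orbit_exp z2 - ?c)"
    using norm_triangle_sub [of ?c "orbit_exp z1 - orbit_exp z2"] by (simp add: norm_minus_commute)
  finally show ?thesis using 1 by (simp add: field_simps)
qed

lemma orbit_exp_inj:
  assumes "z1 \<in> M" "z2 \<in> M" "E z1 = 0" "E z2 = 0" "norm z1 \<le> r" "norm z2 \<le> r"
    "orbit_exp z1 = orbit_exp z2"
  shows "z1 = z2"
  using orbit_exp_expansive [OF assms(1-6)] \<kappa>_pos assms(7) by (simp add: mult_le_0_iff)

text \<open>The constant of the splitting \<open>x = (x - E x) + E x\<close>: the sum of the norms
  of both parts is at most \<open>norm x + 2 * norm (E x)\<close>.\<close>

definition "c\<^sub>E = 1 + 2 / sqrt \<kappa>"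

lemma c\<^sub>E_pos: "1 < c\<^sub>E"
  using \<kappa>_pos by (simp add: c\<^sub>E_def)

text \<open>The element \<open>x\<close> with \<open>e\<^bsup>x - E x\<^esup> e\<^bsup>E x\<^esup> = w\<close> is a fixed point of \<open>x \<mapsto> x + w - e\<^bsup>x - E x\<^esup> e\<^bsup>E x\<^esup>\<close>.\<close>

lemma exp_factorization:
  assumes w: "w \<in> M" "norm (w - 1) \<le> r / (2 * c\<^sub>E)"
  shows "\<exists>z a. z \<in> M \<and> E z = 0 \<and> norm z < r \<and> a \<in> N \<and> exp z * exp a = w"
proof -
  \<comment> \<open>For \<open>norm x \<le> \<rho>\<close> both parts of \<open>x\<close> have norm
    at most \<open>r\<close>, where the exponential estimates hold.\<close>
  define \<rho> where "\<rho> = r / c\<^sub>E"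
  have \<rho>: "0 < \<rho>" "\<rho> * c\<^sub>E = r" "norm (w - 1) \<le> \<rho> / 2" using r_pos c\<^sub>E_pos w by (simp_all add: \<rho>_def mult.commute)
  define \<Phi> where "\<Phi> x = exp (x - E x) * 1 * exp (E x)" for x
  let ?G = "\<lambda>x. x + w - \<Phi> x"
  let ?S = "M \<inter> cball 0 \<rho>"
  have split: "norm (x - E x) + norm (E x) \<le> c\<^sub>E * norm x" if "x \<in> M" for x
  proof -
    have "c\<^sub>E * norm x = norm x + norm x / sqrt \<kappa> + norm x / sqrt \<kappa>"
      by (simp add: c\<^sub>E_def algebra_simps)
    then show ?thesis
      using norm_E_le [OF that] norm_triangle_ineq4 [of x "E x"] by linarith
  qed
  have small: "norm (x - E x) \<le> r" "norm (E x) \<le> r" if "x \<in> ?S" for x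
  proof -
    have "c\<^sub>E * norm x \<le> c\<^sub>E * \<rho>" using that c\<^sub>E_pos by (intro mult_left_mono) auto
    then have "norm (x - E x) + norm (E x) \<le> r"
      using split [of x] that \<rho>(2) by (simp add: mult.commute)
    then show "norm (x - E x) \<le> r" "norm (E x) \<le> r"
      using norm_ge_zero [of "x - E x"] norm_ge_zero [of "E x"] by linarith+
  qed
  have lip: "norm (?G x - ?G y) \<le> 1 / 2 * norm (x - y)" if xy: "x \<in> ?S" "y \<in> ?S" for x y
  proof -
    \<comment> \<open>The two parts of \<open>x\<close> add up to \<open>x\<close>, so the linear
      part of \<open>\<Phi>\<close> is the identity and \<open>?G\<close> is its nonlinear remainder
      up to sign and a constant.\<close>
    have "norm (\<Phi> x - \<Phi> y - ((x - E x - (y - E y)) * 1 + 1 * (E x - E y)))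
        \<le> (exp r - 1) * (exp r + 1) * (norm (x - E x - (y - E y)) + norm (E x - E y))"
      unfolding \<Phi>_def by (rule norm_exp_mult_exp_diff_le) (use small xy in auto)
    also have "\<dots> \<le> (exp r - 1) * (exp r + 1) * (c\<^sub>E * norm (x - y))"
    proof (rule mult_left_mono)
      have e: "x - E x - (y - E y) = (x - y) - E (x - y)" "E x - E y = E (x - y)"
        using xy by (simp_all add: E_diff)
      show "norm (x - E x - (y - E y)) + norm (E x - E y) \<le> c\<^sub>E * norm (x - y)"
        unfolding e using xy by (intro split M.diff) auto
    qed (use r_pos in simp)
    also have "\<dots> \<le> 1 / 2 * norm (x - y)"
      unfolding mult.assoc [symmetric] using r_small(2) by (intro mult_right_mono) (simp_all add: c\<^sub>E_def)
    also have "norm (\<Phi> x - \<Phi> y - ((x - E x - (y - E y)) * 1 + 1 * (E x - E y))) = norm (?G x - ?G y)"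
      by (subst norm_minus_cancel [symmetric]) (simp add: algebra_simps)
    finally show ?thesis .
  qed
  have E0: "E 0 = 0" using E_id [OF N.zero] .
  have "\<exists>!x\<in>?S. ?G x = x"
  proof (rule Banach_fix [where c = "1/2"])
    show "complete ?S" by (intro closed_Int M.closed closed_cball complete_eq_closed [THEN iffD2])
    show "?S \<noteq> {}" using M.zero \<rho> by auto
    show "?G ` ?S \<subseteq> ?S"
    proof safe
      fix x assume x: "x \<in> M" "x \<in> cball 0 \<rho>"
      have "norm (?G x) \<le> norm (?G x - ?G 0) + norm (?G 0)"
        using norm_triangle_sub [of "?G x" "?G 0"] by linarith
      also have "\<dots> \<le> 1 / 2 * norm (x - 0) + \<rho> / 2"
        using lip [of x 0] x M.zero \<rho> by (intro add_mono) (auto simp: \<Phi>_def E0)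
      also have "\<dots> \<le> \<rho>" using x by simp
      finally show "?G x \<in> cball 0 \<rho>" by simp
      show "?G x \<in> M" using x w unfolding \<Phi>_def
        by (intro M.diff M.add M.mult M.exp M.one E_M) auto
    qed
    show "dist (?G x) (?G y) \<le> 1 / 2 * dist x y" if "x \<in> ?S" "y \<in> ?S" for x y
      using lip [OF that] by (simp only: dist_norm)
  qed auto
  then obtain x where x: "x \<in> M" "norm x \<le> \<rho>" "?G x = x" by auto
  \<comment> \<open>Only one of the two terms \<open>1 / sqrt \<kappa>\<close> in
    \<open>c\<^sub>E\<close> is spent here, which makes the final bound strict.\<close>
  have "norm (x - E x) \<le> (1 + 1 / sqrt \<kappa>) * norm x"
    using norm_E_le [OF x(1)] norm_triangle_ineq4 [of x "E x"] by (simp add: algebra_simps)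
  also have "\<dots> \<le> (1 + 1 / sqrt \<kappa>) * \<rho>" using \<kappa>_pos x by (intro mult_left_mono) auto
  also have "\<dots> < c\<^sub>E * \<rho>" using \<kappa>_pos \<rho> unfolding c\<^sub>E_def
    by (intro mult_strict_right_mono) (auto simp: divide_strict_right_mono)
  finally have "norm (x - E x) < r" using \<rho> by (simp add: mult.commute)
  moreover have "E (x - E x) = 0" using x by (simp add: E_diff E_M E_id E_N)
  moreover have "exp (x - E x) * exp (E x) = w" using x(3) by (simp add: \<Phi>_def algebra_simps)
  ultimately show ?thesis
    using M.diff [OF x(1) E_M [OF x(1)]] E_N [OF x(1)]
    by (intro exI [where x = "x - E x"] exI [where x = "E x"] conjI)
qed

text \<open>Pimsner--Popa costs a factor \<open>sqrt \<kappa>\<close> in passing from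
  \<open>q - p\<close> to \<open>u - E u\<close>, whose norm must then be below the radius
  \<open>r / (2 * c\<^sub>E)\<close> of \<open>exp_factorization\<close>.\<close>

definition "r\<^sub>2 = sqrt \<kappa> * r / (2 * c\<^sub>E)"

lemma r\<^sub>2_pos: "0 < r\<^sub>2"
  using \<kappa>_pos r_pos c\<^sub>E_pos by (simp add: r\<^sub>2_def)

lemma orbit_exp_surj:
  assumes q: "q \<in> orbit M p" "norm (q - p) < r\<^sub>2"
  shows "\<exists>z\<in>horizontal M E. norm z < r \<and> q = orbit_exp z"
proof -
  obtain u where u: "u \<in> M" "adj u * u = 1" "u * adj u = 1" "q = u * p * adj u"
    using q(1) by (auto simp: orbit_def unitaries_def)
  have uu: "adj u * (u * x) = x" for x using u(2) by (simp flip: mult.assoc)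
  have nu: "norm u \<le> 1" using norm_adj_mult_self [of u] u(2) by (simp add: abs_square_eq_1 power2_eq_1_iff)
  define b where "b = E u"
  have b: "b \<in> N" "b \<in> M" "adj b \<in> N" "adj b \<in> M"
    using u by (simp_all add: b_def E_N E_M N.adj M.adj)
  \<comment> \<open>From \<open>q * u = u * p\<close> and \<open>p * u * p = E u * p\<close>: the
    distance of \<open>q\<close> from \<open>p\<close> controls that of \<open>u\<close> from
    \<open>N\<close>.\<close>
  have "(q - p) * u * p = (u - b) * p"
    using p_mult_p [OF u(1)] by (simp add: left_diff_distrib u(4) mult.assoc uu p_idem b_def)
  then have "sqrt \<kappa> * norm (u - b) \<le> norm ((q - p) * u * p)"
    using pimsner_popa [of "u - b"] u(1) b by (simp add: M.diff)
  also have "\<dots> \<le> norm (q - p) * 1 * 1"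
    using nu norm_p by (intro order_trans [OF norm_mult_ineq] mult_mono) auto
  also have "\<dots> < sqrt \<kappa> * (r / (2 * c\<^sub>E))" using q(2) by (simp add: r\<^sub>2_def)
  finally have ub: "norm (u - b) < r / (2 * c\<^sub>E)"
    using \<kappa>_pos by (subst (asm) mult_less_cancel_left_pos) simp_all
  define w where "w = u * adj b"
  have "w - 1 = u * adj (b - u)" by (simp add: w_def right_diff_distrib u(3))
  then have "norm (w - 1) \<le> norm u * norm (b - u)"
    using norm_mult_ineq [of u "adj (b - u)"] by (simp only: norm_adj)
  also have "\<dots> \<le> 1 * norm (u - b)"
    using nu by (intro mult_mono) (auto simp: norm_minus_commute)
  finally have "norm (w - 1) \<le> r / (2 * c\<^sub>E)" using ub by simp
  moreover have "w \<in> M" using u b by (simp add: w_def M.mult)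
  ultimately obtain z a where z: "z \<in> M" "E z = 0" "norm z < r" and a: "a \<in> N" "exp z * exp a = w"
    using exp_factorization by blast
  \<comment> \<open>Both \<open>adj b\<close> and \<open>exp a\<close> lie in \<open>N\<close> and
    pass through \<open>p\<close>, so only \<open>exp z\<close> survives in the formula for
    \<open>q\<close>.\<close>
  have "q * w = w * p"
    using p_commute [OF b(3)] by (simp add: u(4) w_def mult.assoc uu)
  then have "q * (exp z * exp a) = exp z * p * exp a"
    using p_commute [OF N.exp [OF a(1)]] by (simp add: a(2) [symmetric] mult.assoc)
  then have "q * (exp z * exp a) * exp (- a) * exp (- z) = exp z * p * exp a * exp (- a) * exp (- z)"
    by simp
  then have qz: "q = orbit_exp z" by (simp add: orbit_exp_def mult.assoc)
  \<comment> \<open>Taking adjoints exhibits \<open>- adj z\<close> as a second coordinate of the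
    same point, again in the kernel of \<open>E\<close>.\<close>
  have "adj q = q" by (simp add: u(4) p_adj mult.assoc)
  then have qz': "orbit_exp (- adj z) = orbit_exp z"
    using arg_cong [OF qz, of adj] qz by (simp add: orbit_exp_def adj_exp p_adj mult.assoc)
  have "- adj z = z"
    by (rule orbit_exp_inj [OF _ _ _ _ _ _ qz'])
      (use z E_id [OF N.zero] in \<open>simp_all add: M.minus M.adj E_minus E_adj less_imp_le\<close>)
  then have "adj z = - z" by (metis minus_minus)
  then have "z \<in> horizontal M E" using z by (simp add: horizontal_def)
  then show ?thesis using z qz by blast
qed

text \<open>The regularised radius minus the rescaled length
  \<open>I t / sqrt (2 * \<kappa>)\<close> has increments of at most quadratic size in time: the
  chord is at most the length of the arc, and expansivity together with a bound on the velocity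
  makes \<open>z\<close> Lipschitz.\<close>

lemma normal_coordinates_length_ge:
  assumes z: "\<And>t. t \<in> {0..1} \<Longrightarrow> z t \<in> horizontal M E" "\<And>t. t \<in> {0..1} \<Longrightarrow> norm (z t) \<le> r"
    and \<gamma>: "\<And>t. t \<in> {0..1} \<Longrightarrow> \<gamma> t = orbit_exp (z t)" and z0: "z 0 = 0"
    and D: "\<And>t. t \<in> {0..1} \<Longrightarrow> (\<gamma> has_vector_derivative \<gamma>' t) (at t within {0..1})"
    and cont: "continuous_on {0..1} \<gamma>'"
  shows "sqrt (2 * \<kappa>) * norm2 \<tau> (z 1) \<le> integral {0..1} (\<lambda>t. norm2 \<tau> (\<gamma>' t))"
proof -
  have \<gamma>A: "\<gamma> t \<in> A" if "t \<in> {0..1}" for t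
    using that by (simp add: \<gamma> orbit_exp_A horizontal_memD [OF z(1)])
  have \<gamma>'A: "\<gamma>' t \<in> A" if "t \<in> {0..1}" for t
    by (rule derivative_mem [OF zero_less_one that \<gamma>A D [OF that]])
  define I where "I t = integral {0..t} (\<lambda>t. norm2 \<tau> (\<gamma>' t))" for t
  have int: "(\<lambda>t. norm2 \<tau> (\<gamma>' t)) integrable_on {0..1}"
    by (intro integrable_continuous_interval continuous_on_norm2 cont \<gamma>'A)
  obtain L where L: "0 < L" "\<And>t. t \<in> {0..1} \<Longrightarrow> norm (\<gamma>' t) \<le> L"
    using compact_imp_bounded [OF compact_continuous_image [OF cont compact_Icc]]
    unfolding bounded_pos by auto
  have step: "norm2 \<tau> (\<gamma> b - \<gamma> a) \<le> I b - I a" "norm (z b - z a) \<le> 2 * L / sqrt \<kappa> * (b - a)"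
    if ab: "0 \<le> a" "a \<le> b" "b \<le> 1" for a b
  proof -
    have sub: "{a..b} \<subseteq> {0..1}" using ab by auto
    have D': "(\<gamma> has_vector_derivative \<gamma>' t) (at t within {a..b})" if "t \<in> {a..b}" for t
      using D sub that by (meson has_vector_derivative_within_subset subsetD)
    have "norm2 \<tau> (\<gamma> b - \<gamma> a) \<le> integral {a..b} (\<lambda>t. norm2 \<tau> (\<gamma>' t))"
      using sub by (intro norm2_diff_le_integral D' ab \<gamma>A \<gamma>'A continuous_on_subset [OF cont]) auto
    also have "\<dots> = I b - I a"
      unfolding I_def
      using Henstock_Kurzweil_Integration.integral_combine [OF ab(1,2), of "\<lambda>t. norm2 \<tau> (\<gamma>' t)"]
        integrable_on_subinterval [OF int, of 0 b] ab by auto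
    finally show "norm2 \<tau> (\<gamma> b - \<gamma> a) \<le> I b - I a" .
    have "(\<gamma>' has_integral (\<gamma> b - \<gamma> a)) {a..b}"
      by (rule fundamental_theorem_of_calculus [OF ab(2) D'])
    then have "norm (\<gamma> b - \<gamma> a) \<le> L * measure lborel {a..b}"
      by (rule has_integral_bound_real [OF less_imp_le [OF L(1)] finite.emptyI]) (use L sub in auto)
    moreover have "sqrt \<kappa> / 2 * norm (z b - z a) \<le> norm (\<gamma> b - \<gamma> a)"
    proof -
      have "a \<in> {0..1}" "b \<in> {0..1}" using ab by auto
      show ?thesis
        unfolding \<gamma> [OF \<open>a \<in> {0..1}\<close>] \<gamma> [OF \<open>b \<in> {0..1}\<close>]
        by (rule orbit_exp_expansive)
          (use z [OF \<open>a \<in> {0..1}\<close>] z [OF \<open>b \<in> {0..1}\<close>] in \<open>simp_all add: horizontal_def\<close>)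
    qed
    ultimately show "norm (z b - z a) \<le> 2 * L / sqrt \<kappa> * (b - a)"
      using \<kappa>_pos ab by (simp add: field_simps)
  qed
  have "norm2 \<tau> (z 1) \<le> I 1 / sqrt (2 * \<kappa>) + e" if e: "0 < e" for e
  proof -
    \<comment> \<open>With the regularisation \<open>e\<^sup>2\<close> this function starts at
      \<open>e\<close>, because \<open>z 0 = 0\<close>; \<open>e\<close> is arbitrary.\<close>
    let ?h = "\<lambda>t. sqrt ((norm2 \<tau> (z t))\<^sup>2 + e\<^sup>2) - I t / sqrt (2 * \<kappa>)"
    let ?C = "(2 * (r * exp r * exp r) + 1) / (2 * sqrt (e\<^sup>2))"
    have "?h 1 \<le> ?h 0"
    proof (rule increment_square_bound_imp_le)
      fix a b :: real assume ab: "0 \<le> a" "a \<le> b" "b \<le> 1"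
      have "sqrt ((norm2 \<tau> (z b))\<^sup>2 + e\<^sup>2) \<le> sqrt ((norm2 \<tau> (z a))\<^sup>2 + e\<^sup>2)
          + norm2 \<tau> (\<gamma> b - \<gamma> a) / sqrt (2 * \<kappa>) + ?C * (norm (z b - z a))\<^sup>2"
        using ab e regularized_radius_increment_le [OF z(1) z(1) z(2) z(2), of a b "e\<^sup>2"]
        by (simp add: \<gamma>)
      also have "\<dots> \<le> sqrt ((norm2 \<tau> (z a))\<^sup>2 + e\<^sup>2)
          + (I b - I a) / sqrt (2 * \<kappa>) + ?C * (2 * L / sqrt \<kappa> * (b - a))\<^sup>2"
        using step [OF ab] \<kappa>_pos e r_pos
        by (intro add_mono order_refl divide_right_mono mult_left_mono power_mono) auto
      also have "?C * (2 * L / sqrt \<kappa> * (b - a))\<^sup>2 = ?C * (2 * L / sqrt \<kappa>)\<^sup>2 * (b - a)\<^sup>2"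
        by (simp only: power_mult_distrib mult.assoc)
      finally show "?h b - ?h a \<le> ?C * (2 * L / sqrt \<kappa>)\<^sup>2 * (b - a)\<^sup>2"
        unfolding diff_divide_distrib by linarith
    qed
    moreover have "norm2 \<tau> (z 1) \<le> sqrt ((norm2 \<tau> (z 1))\<^sup>2 + e\<^sup>2)" by (rule real_le_rsqrt) simp
    moreover have "?h 0 = e" using e by (simp add: z0 I_def norm2_def trace_zero)
    ultimately show ?thesis by linarith
  qed
  then have "norm2 \<tau> (z 1) \<le> I 1 / sqrt (2 * \<kappa>)" by (rule field_le_epsilon)
  then show ?thesis using \<kappa>_pos by (simp add: I_def field_simps)
qed

end

section \<open>Minimality of geodesics\<close>

lemma smooth_curve_in_derivative:
  assumes "smooth_curve_in S \<gamma>"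
  obtains \<gamma>' where "\<And>t. t \<in> {0..1} \<Longrightarrow> (\<gamma> has_vector_derivative \<gamma>' t) (at t within {0..1})"
    "continuous_on {0..1} \<gamma>'" "\<And>t. t \<in> {0..1} \<Longrightarrow> \<gamma> t \<in> S"
proof -
  from assms obtain D where D: "D 0 = \<gamma>"
    "\<And>n t. t \<in> {0..1} \<Longrightarrow> (D n has_vector_derivative D (Suc n) t) (at t within {0..1})"
    unfolding smooth_curve_in_def by blast
  have "continuous_on {0..1} (D 1)"
    unfolding continuous_on_eq_continuous_within
    by (intro ballI has_vector_derivative_continuous [OF D(2)])
  moreover have "\<gamma> t \<in> S" if "t \<in> {0..1}" for t
    using assms that by (auto simp: smooth_curve_in_def)
  ultimately show ?thesis using D(2) [of _ 0] by (intro that [of "D 1"]) (simp_all add: D(1))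
qed

context jones_setting
begin

lemma unitaries_conj:
  assumes "u \<in> unitaries M"
  shows "u \<in> M" "adj u * u = 1" "u * adj u = 1" "adj u * (u * x) = x" "u * (adj u * x) = x"
    "adj u \<in> unitaries M"
  using assms by (auto simp: unitaries_def M.adj simp flip: mult.assoc)

lemma orbit_A: "q \<in> orbit M p \<Longrightarrow> q \<in> A"
  by (auto simp: orbit_def unitaries_def M_A p_A M.adj mult)

lemma length2_eq:
  assumes "\<And>t. t \<in> {0..1} \<Longrightarrow> (\<gamma> has_vector_derivative \<gamma>' t) (at t within {0..1})"
  shows "length2 \<tau> \<gamma> = integral {0..1} (\<lambda>t. norm2 \<tau> (\<gamma>' t))"
  unfolding length2_def
  by (intro integral_cong arg_cong [where f = "norm2 \<tau>"] vector_derivative_within_unit_interval assms)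

lemma norm2_conj:
  assumes "u \<in> unitaries M" "x \<in> A"
  shows "norm2 \<tau> (u * x * adj u) = norm2 \<tau> x"
  using unitaries_conj [OF assms(1)] assms(2)
  by (simp add: norm2_mult_unitary norm2_unitary_mult M_A M.adj mult)

text \<open>The speed is constant: each velocity is a unitary conjugate of the commutator of
  \<open>z\<close> with \<open>p\<close>, whose 2-norm is known from \<open>norm2_commutator\<close>
  and \<open>E z = 0\<close>.\<close>

lemma length2_geodesic:
  assumes u: "u \<in> unitaries M" and z: "z \<in> horizontal M E"
  shows "length2 \<tau> (geodesic_curve (u * p * adj u) (u * z * adj u)) = sqrt (2 * \<kappa>) * norm2 \<tau> z"
proof -
  note u' = unitaries_conj [OF u] and z' = horizontal_memD [OF z]
  let ?q = "u * p * adj u" and ?x = "u * z * adj u"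
  let ?g = "\<lambda>t. exp (t *\<^sub>R ?x) * (?x * ?q - ?q * ?x) * exp (t *\<^sub>R (- ?x))"
  have "((\<lambda>t. exp (t *\<^sub>R ?x) * ?q * exp (t *\<^sub>R (- ?x))) has_vector_derivative ?g t) (at t within {0..1})" for t
    by (rule has_vector_derivative_at_within, rule has_vector_derivative_eq_rhs [OF has_vector_derivative_mult
          [OF has_vector_derivative_mult_left [OF exp_scaleR_has_vector_derivative_right]
            exp_scaleR_has_vector_derivative_left]])
      (simp add: algebra_simps)
  moreover have "(\<lambda>t. exp (t *\<^sub>R ?x) * ?q * exp (t *\<^sub>R (- ?x))) = geodesic_curve ?q ?x"
    by (simp add: geodesic_curve_def)
  ultimately have len: "length2 \<tau> (geodesic_curve ?q ?x) = integral {0..1} (\<lambda>t. norm2 \<tau> (?g t))"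
    by (intro length2_eq) simp
  have "norm2 \<tau> (?g t) = sqrt (2 * \<kappa>) * norm2 \<tau> z" for t
  proof -
    have x: "?x \<in> M" "adj ?x = - ?x" using u' z' by (simp_all add: M.mult M.adj mult.assoc)
    have e: "exp (t *\<^sub>R ?x) \<in> unitaries M" "exp (t *\<^sub>R (- ?x)) = adj (exp (t *\<^sub>R ?x))"
      using x by (simp_all add: unitaries_def M.exp M.scaleR adj_exp del: adj_mult)
    have c: "z * p - p * z \<in> A" "u * (z * p - p * z) * adj u \<in> A"
      using z' u' by (simp_all add: diff mult M_A p_A M.adj)
    have "?x * ?q - ?q * ?x = u * (z * p - p * z) * adj u"
      using u' by (simp add: algebra_simps)
    then have "norm2 \<tau> (?g t) = norm2 \<tau> (u * (z * p - p * z) * adj u)"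
      unfolding e(2) by (simp only: norm2_conj [OF e(1) c(2)])
    also have "\<dots> = norm2 \<tau> (z * p - p * z)"
      by (rule norm2_conj [OF u c(1)])
    also have "\<dots> = sqrt (2 * \<kappa>) * norm2 \<tau> z"
      using norm2_commutator [OF z'(1)] z' by simp
    finally show ?thesis .
  qed
  then show ?thesis unfolding len by simp
qed

end

context jones_radius
begin

lemma ex1_normal_coordinate:
  assumes "q \<in> orbit M p" "norm (q - p) < r\<^sub>2"
  shows "\<exists>!z. z \<in> horizontal M E \<and> norm z < r \<and> q = exp z * p * exp (- z)"
proof -
  obtain z where z: "z \<in> horizontal M E" "norm z < r" "q = orbit_exp z"
    using orbit_exp_surj [OF assms] by blast
  have "y = z" if "y \<in> horizontal M E" "norm y < r" "q = orbit_exp y" for y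
    by (rule orbit_exp_inj [of y z]) (use z that in \<open>auto simp: horizontal_def\<close>)
  then show ?thesis using z unfolding orbit_exp_def by blast
qed

text \<open>The curve stays in the image of the chart and is lifted pointwise; injectivity
  identifies the ends of the lift as 0 and \<open>z\<close>.\<close>

lemma short_curve_length_ge:
  assumes D: "\<And>t. t \<in> {0..1} \<Longrightarrow> (\<gamma> has_vector_derivative \<gamma>' t) (at t within {0..1})"
    and cont: "continuous_on {0..1} \<gamma>'" and orbit: "\<And>t. t \<in> {0..1} \<Longrightarrow> \<gamma> t \<in> orbit M p"
    and start: "\<gamma> 0 = p" and near: "\<And>t. t \<in> {0..1} \<Longrightarrow> norm (\<gamma> t - p) < r\<^sub>2"
    and z: "z \<in> horizontal M E" "norm z < r" "\<gamma> 1 = orbit_exp z"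
  shows "sqrt (2 * \<kappa>) * norm2 \<tau> z \<le> integral {0..1} (\<lambda>t. norm2 \<tau> (\<gamma>' t))"
proof -
  have "\<exists>y\<in>horizontal M E. norm y < r \<and> \<gamma> t = orbit_exp y" if "t \<in> {0..1}" for t
    by (rule orbit_exp_surj [OF orbit [OF that] near [OF that]])
  then obtain y where y: "\<And>t. t \<in> {0..1} \<Longrightarrow> y t \<in> horizontal M E"
    "\<And>t. t \<in> {0..1} \<Longrightarrow> norm (y t) < r" "\<And>t. t \<in> {0..1} \<Longrightarrow> \<gamma> t = orbit_exp (y t)"
    by metis
  have inj: "a = b" if "a \<in> horizontal M E" "b \<in> horizontal M E" "norm a < r" "norm b < r"
    "orbit_exp a = orbit_exp b" for a b
    by (rule orbit_exp_inj [of a b]) (use that in \<open>auto simp: horizontal_def\<close>)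
  have "0 \<in> horizontal M E" using E_id [OF N.zero] by (simp add: horizontal_def M.zero)
  then have "y 0 = 0"
    by (rule inj [rotated]) (use y [of 0] r_pos start in \<open>simp_all add: orbit_exp_0\<close>)
  moreover have "y 1 = z" by (rule inj) (use y [of 1] z in simp_all)
  ultimately show ?thesis
    using normal_coordinates_length_ge [of y \<gamma> \<gamma>'] y D cont by (simp add: less_imp_le)
qed

text \<open>Conjugation by \<open>adj u\<close> moves the starting point to \<open>p\<close> and
  preserves lengths. The distance from the starting point is at most
  \<open>length_inf \<gamma>\<close>, so the translated curve remains in the chart.\<close>

lemma exists_short_geodesic:
  assumes \<gamma>: "smooth_curve_in (orbit M p) \<gamma>" and len: "length_inf \<gamma> < r\<^sub>2"
  shows "\<exists>\<delta>. is_geodesic M E p \<delta> \<and> \<delta> 0 = \<gamma> 0 \<and> \<delta> 1 = \<gamma> 1 \<and> length2 \<tau> \<delta> \<le> length2 \<tau> \<gamma>"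
proof -
  obtain \<gamma>' where D: "\<And>t. t \<in> {0..1} \<Longrightarrow> (\<gamma> has_vector_derivative \<gamma>' t) (at t within {0..1})"
    and cont: "continuous_on {0..1} \<gamma>'" and orbit: "\<And>t. t \<in> {0..1} \<Longrightarrow> \<gamma> t \<in> orbit M p"
    using smooth_curve_in_derivative [OF \<gamma>] by blast
  obtain u where u: "u \<in> unitaries M" "\<gamma> 0 = u * p * adj u"
    using orbit [of 0] by (auto simp: orbit_def)
  note u' = unitaries_conj [OF u(1)]
  have nu: "norm u = 1" "norm (adj u) = 1"
    using norm_adj_mult_self [of u] u'(2) by (simp_all add: abs_square_eq_1 power2_eq_1_iff)
  have conj_le: "norm (adj u * x * u) \<le> norm x" for x
    using norm_mult_ineq [of "adj u * x" u] norm_mult_ineq [of "adj u" x] nu by simp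
  let ?\<beta> = "\<lambda>t. adj u * \<gamma> t * u" and ?\<beta>' = "\<lambda>t. adj u * \<gamma>' t * u"
  have D\<beta>: "(?\<beta> has_vector_derivative ?\<beta>' t) (at t within {0..1})" if "t \<in> {0..1}" for t
    by (intro has_vector_derivative_mult_left has_vector_derivative_mult_right D that)
  have start: "?\<beta> 0 = p" using u' by (simp add: u(2) mult.assoc)
  have near: "norm (?\<beta> t - p) < r\<^sub>2" if t: "t \<in> {0..1}" for t
  proof -
    have int: "(\<lambda>s. norm (\<gamma>' s)) integrable_on {0..1}"
      by (intro integrable_continuous_interval continuous_intros cont)
    have sub: "{0..t} \<subseteq> {0..1}" using t by auto
    have ft: "(\<gamma>' has_integral (\<gamma> t - \<gamma> 0)) {0..t}"
      using t sub by (intro fundamental_theorem_of_calculus) (auto intro: has_vector_derivative_within_subset [OF D sub])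
    have "?\<beta> t - p = adj u * (\<gamma> t - \<gamma> 0) * u" using start by (simp add: algebra_simps)
    then have "norm (?\<beta> t - p) \<le> norm (\<gamma> t - \<gamma> 0)" using conj_le by simp
    also have "\<dots> = norm (integral {0..t} \<gamma>')" using ft by (simp add: integral_unique)
    also have "\<dots> \<le> integral {0..t} (\<lambda>s. norm (\<gamma>' s))"
      using ft integrable_on_subinterval [OF int, of 0 t] sub
      by (intro integral_norm_bound_integral) (auto simp: has_integral_integrable)
    also have "\<dots> \<le> integral {0..1} (\<lambda>s. norm (\<gamma>' s))"
      using integrable_on_subinterval [OF int, of 0 t] sub int by (intro integral_subset_le) auto
    also have "\<dots> = length_inf \<gamma>"
      unfolding length_inf_def
      by (intro integral_cong arg_cong [where f = norm] vector_derivative_within_unit_interval [symmetric] D)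
    finally show ?thesis using len by simp
  qed
  have \<beta>_orbit: "?\<beta> t \<in> orbit M p" if "t \<in> {0..1}" for t
  proof -
    obtain v where v: "v \<in> unitaries M" "\<gamma> t = v * p * adj v" using orbit [OF \<open>t \<in> {0..1}\<close>] by (auto simp: orbit_def)
    have "adj u * v \<in> unitaries M"
      using u' unitaries_conj [OF v(1)] by (simp add: unitaries_def M.mult M.adj mult.assoc)
    moreover have "?\<beta> t = (adj u * v) * p * adj (adj u * v)" by (simp add: v(2) mult.assoc)
    ultimately show ?thesis unfolding orbit_def by blast
  qed
  obtain z where z: "z \<in> horizontal M E" "norm z < r" "?\<beta> 1 = orbit_exp z"
    using orbit_exp_surj [OF \<beta>_orbit near, of 1] by auto
  have "sqrt (2 * \<kappa>) * norm2 \<tau> z \<le> integral {0..1} (\<lambda>t. norm2 \<tau> (?\<beta>' t))"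
    by (rule short_curve_length_ge [of ?\<beta>, OF D\<beta> _ \<beta>_orbit start near z])
      (auto intro!: continuous_intros cont)
  also have "\<dots> = length2 \<tau> \<gamma>"
  proof -
    have "norm2 \<tau> (?\<beta>' t) = norm2 \<tau> (\<gamma>' t)" if "t \<in> {0..1}" for t
      using norm2_conj [OF u'(6), of "\<gamma>' t"] derivative_mem [OF zero_less_one that orbit_A D [OF that]] orbit
      by simp
    moreover have "length2 \<tau> \<gamma> = integral {0..1} (\<lambda>t. norm2 \<tau> (\<gamma>' t))" by (rule length2_eq [OF D])
    ultimately show ?thesis by (simp only:) (rule integral_cong)
  qed
  finally have "length2 \<tau> (geodesic_curve (\<gamma> 0) (u * z * adj u)) \<le> length2 \<tau> \<gamma>"
    using length2_geodesic [OF u(1) z(1)] by (simp add: u(2))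
  moreover have "geodesic_curve (\<gamma> 0) (u * z * adj u) 0 = \<gamma> 0" by (simp add: geodesic_curve_def)
  moreover have "geodesic_curve (\<gamma> 0) (u * z * adj u) 1 = \<gamma> 1"
  proof -
    have "exp (u * z * adj u) = u * exp z * adj u" "exp (- (u * z * adj u)) = u * exp (- z) * adj u"
      using exp_conjugate [OF u'(2,3), of z] exp_conjugate [OF u'(2,3), of "- z"] by simp_all
    then have "geodesic_curve (\<gamma> 0) (u * z * adj u) 1 = u * orbit_exp z * adj u"
      using u' by (simp add: geodesic_curve_def u(2) orbit_exp_def mult.assoc)
    also have "\<dots> = \<gamma> 1" using u' by (simp add: z(3) [symmetric] mult.assoc)
    finally show ?thesis .
  qed
  moreover have "is_geodesic M E p (geodesic_curve (\<gamma> 0) (u * z * adj u))"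
    unfolding is_geodesic_def horizontal_at_def using u z(1) orbit [of 0] by auto
  ultimately show ?thesis by blast
qed

end

theorem theorem5p3:
  fixes M N :: "'h::complex_hilbert bop set"
    and \<Omega> :: 'h
    and \<tau> :: "'h bop \<Rightarrow> complex"
    and E :: "'h bop \<Rightarrow> 'h bop"
    and p :: "'h bop"
  assumes "II1_factor M" and "II1_factor N" and "N \<subseteq> M"
    and "is_L2_space M \<tau> \<Omega>"
    and "jones_index M N < \<infinity>"
    and "p = jones_projection N \<Omega>"
    and "normalized_trace (basic_construction M N \<Omega>) \<tau>"
    and "trace_preserving_cond_exp M N \<tau> E"
  shows "\<exists>R>0. \<exists>R2>0.
    (\<forall>q\<in>orbit M p. norm (q - p) < R2 \<longrightarrow>
       (\<exists>!z. z \<in> horizontal M E \<and> norm z < R \<and> q = exp z * p * exp (- z))) \<and>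
    (\<forall>\<gamma>. smooth_curve_in (orbit M p) \<gamma> \<and> length_inf \<gamma> \<le> R2 \<longrightarrow>
       (\<exists>\<delta>. is_geodesic M E p \<delta> \<and> \<delta> 0 = \<gamma> 0 \<and> \<delta> 1 = \<gamma> 1 \<and> length2 \<tau> \<delta> \<le> length2 \<tau> \<gamma>)) \<and>
    (\<forall>\<gamma> z. smooth_curve_in (orbit M p) \<gamma> \<and> \<gamma> 0 = p \<and> (\<forall>t\<in>{0..1}. norm (\<gamma> t - p) < R2 / 2) \<and>
       z \<in> horizontal M E \<and> norm z < R \<and> \<gamma> 1 = exp z * p * exp (- z) \<longrightarrow>
       length2 \<tau> \<gamma> \<ge> length2 \<tau> (geodesic_curve p z))"
proof -
  interpret jones_setting M N \<Omega> \<tau> E p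
    using assms by unfold_locales (auto simp: II1_factor_def finite_factor_def factor_def)
  \<comment> \<open>The two bounds of \<open>jones_radius\<close>, the second one divided by
    \<open>1 + 2 / sqrt \<kappa>\<close>.\<close>
  let ?\<epsilon> = "min (sqrt \<kappa> / 4) (1 / 2 / (1 + 2 / sqrt \<kappa>))"
  have pos: "0 < ?\<epsilon>" using \<kappa>_pos by (simp add: add_pos_pos)
  have "((\<lambda>r::real. (exp r - 1) * (exp r + 1)) \<longlongrightarrow> (exp 0 - 1) * (exp 0 + 1)) (at_right 0)"
    by (intro tendsto_intros)
  then have "((\<lambda>r::real. (exp r - 1) * (exp r + 1)) \<longlongrightarrow> 0) (at_right 0)" by simp
  then have "\<forall>\<^sub>F r::real in at_right 0. (exp r - 1) * (exp r + 1) < ?\<epsilon>"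
    using pos by (rule order_tendstoD)
  moreover have "\<forall>\<^sub>F r::real in at_right 0. 0 < r" by (simp add: eventually_at_right_less)
  ultimately obtain r :: real where r: "0 < r" "(exp r - 1) * (exp r + 1) < ?\<epsilon>"
    using eventually_happens' [OF trivial_limit_at_right_real eventually_conj] by blast
  interpret jones_radius M N \<Omega> \<tau> E p r
  proof
    have "0 < 1 + 2 / sqrt \<kappa>" using \<kappa>_pos by (simp add: add_pos_pos)
    then show "(exp r - 1) * (exp r + 1) * (1 + 2 / sqrt \<kappa>) \<le> 1 / 2"
      using r(2) by (subst pos_le_divide_eq [symmetric]) auto
  qed (use r in auto)
  show ?thesis
  \<comment> \<open>\<open>R2\<close> is half of \<open>r\<^sub>2\<close>: the bound on
    \<open>length_inf \<gamma>\<close> in the theorem is not strict, while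
    \<open>exists_short_geodesic\<close> requires a strict one.\<close>
  proof (rule exI [where x = r], intro conjI, rule r_pos, rule exI [where x = "r\<^sub>2 / 2"],
      intro conjI ballI allI impI)
    show "0 < r\<^sub>2 / 2" using r\<^sub>2_pos by simp
    show "\<exists>!z. z \<in> horizontal M E \<and> norm z < r \<and> q = exp z * p * exp (- z)"
      if "q \<in> orbit M p" "norm (q - p) < r\<^sub>2 / 2" for q
      using that r\<^sub>2_pos by (intro ex1_normal_coordinate) auto
    show "\<exists>\<delta>. is_geodesic M E p \<delta> \<and> \<delta> 0 = \<gamma> 0 \<and> \<delta> 1 = \<gamma> 1 \<and> length2 \<tau> \<delta> \<le> length2 \<tau> \<gamma>"
      if "smooth_curve_in (orbit M p) \<gamma> \<and> length_inf \<gamma> \<le> r\<^sub>2 / 2" for \<gamma>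
      using that r\<^sub>2_pos by (intro exists_short_geodesic) auto
    fix \<gamma> z
    assume a: "smooth_curve_in (orbit M p) \<gamma> \<and> \<gamma> 0 = p \<and> (\<forall>t\<in>{0..1}. norm (\<gamma> t - p) < r\<^sub>2 / 2 / 2) \<and>
       z \<in> horizontal M E \<and> norm z < r \<and> \<gamma> 1 = exp z * p * exp (- z)"
    obtain \<gamma>' where D: "\<And>t. t \<in> {0..1} \<Longrightarrow> (\<gamma> has_vector_derivative \<gamma>' t) (at t within {0..1})"
      and cont: "continuous_on {0..1} \<gamma>'" and orbit: "\<And>t. t \<in> {0..1} \<Longrightarrow> \<gamma> t \<in> orbit M p"
      using smooth_curve_in_derivative a by blast
    have near: "norm (\<gamma> t - p) < r\<^sub>2" if "t \<in> {0..1}" for t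
      using a that r\<^sub>2_pos by fastforce
    have "length2 \<tau> \<gamma> = integral {0..1} (\<lambda>t. norm2 \<tau> (\<gamma>' t))" by (rule length2_eq [OF D])
    then have "sqrt (2 * \<kappa>) * norm2 \<tau> z \<le> length2 \<tau> \<gamma>"
      using short_curve_length_ge [OF D cont orbit _ near, of z] a by (simp add: orbit_exp_def)
    moreover have "1 \<in> unitaries M" by (simp add: unitaries_def M.one)
    ultimately show "length2 \<tau> (geodesic_curve p z) \<le> length2 \<tau> \<gamma>"
      using length2_geodesic [of 1 z] a by simp
  qed
qed

end
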